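(* There exists a universal constant $C>0$ such that for every $n\ge1$, every log-concave probability measure $\mu$ on $\mathbb{R}^n$ that is $1$ tilt-stable is $C\,n^{1/6}\tilde K_n^{1/3}$ strongly tilt-stable, where $$\tilde K_n=\sup_{\nu}\bigl\|\,|X|-\mathbb{E}|X|\,\bigr\|_{\psi_2}\quad(X\sim\nu),$$ the supremum running over all log-concave probability measures $\nu$ on $\mathbb{R}^n$ that are $1$ tilt-stable.
   Context: A probability measure $\mu$ on $\mathbb{R}^n$ is log-concave if $d\mu=e^{-V(x)}dx$ for some convex $V:\mathbb{R}^n\to\mathbb{R}\cup\{+\infty\}$. $|\cdot|$ is the Euclidean norm. For a real random variable $Y$, $\|Y\|_{\psi_2}=\inf\{t>0:\mathbb{E}e^{Y^2/t^2}\le 2\}$. For $t\ge0$ and $h\in\mathbb{R}^n$, the tilted measure $\mu_{t,h}$ is the probability measure with $$\frac{d\mu_{t,h}}{d\mu}(x)=\exp\Bigl(h\cdot x-\tfrac t2|x|^2-L_t(h)\Bigr),\qquad L_t(h)=\log\int_{\mathbb{R}^n}\exp\Bigl(h\cdot x-\tfrac t2|x|^2\Bigr)d\mu(x).$$ The measure $\mu$ is $\beta$ tilt-stable ($\beta>0$) if $\mathrm{Cov}(\mu_{0,h})\preceq\beta^2I_n$ for all $h\in\mathbb{R}^n$ (with $L_0(h)<\infty$ for all $h$ implicitly required), and $\beta$ strongly tilt-stable if $\mathrm{Cov}(\mu_{t,h})\preceq\beta^2I_n$ for all $h\in\mathbb{R}^n$ and all $t\ge0$. Here $A\preceq B$ means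 that $B-A$ is positive semidefinite. *)

theory Defs
  imports "HOL-Probability.Probability"
begin

text \<open>
  The dimension \<open>n\<close> is quantified inside the scope of a constant, so Euclidean space cannot be
  indexed by a type here.  Its points are the functions \<open>nat \<Rightarrow> real\<close> that are undefined outside
  \<open>{..<n}\<close>, its Borel sets and Lebesgue measure are those of the library's finite product measure.
\<close>

abbreviation Rn :: "nat \<Rightarrow> (nat \<Rightarrow> real) set"
  where "Rn n \<equiv> {..<n} \<rightarrow>\<^sub>E UNIV"

abbreviation lborel_n :: "nat \<Rightarrow> (nat \<Rightarrow> real) measure"
  where "lborel_n n \<equiv> \<Pi>\<^sub>M i\<in>{..<n}. lborel"

definition inner_n :: "nat \<Rightarrow> (nat \<Rightarrow> real) \<Rightarrow> (nat \<Rightarrow> real) \<Rightarrow> real"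
  where "inner_n n x y = (\<Sum>i<n. x i * y i)"

abbreviation norm_n :: "nat \<Rightarrow> (nat \<Rightarrow> real) \<Rightarrow> real"
  where "norm_n n x \<equiv> L2_set x {..<n}"

definition convex_fun_n :: "nat \<Rightarrow> ((nat \<Rightarrow> real) \<Rightarrow> ereal) \<Rightarrow> bool"
  where "convex_fun_n n V \<longleftrightarrow>
    (\<forall>x\<in>Rn n. V x \<noteq> -\<infinity>) \<and>
    (\<forall>x\<in>Rn n. \<forall>y\<in>Rn n. \<forall>u\<in>{0<..<1}.
       V (\<lambda>i\<in>{..<n}. u * x i + (1 - u) * y i) \<le> ereal u * V x + ereal (1 - u) * V y)"

definition exp_neg :: "ereal \<Rightarrow> real"
  where "exp_neg v = (if v = \<infinity> then 0 else exp (- real_of_ereal v))"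

text \<open>
  A convex \<open>V\<close> is Lebesgue measurable, but on the (null) boundary of its domain it need not be Borel.
  There it can be replaced by its lower semicontinuous hull without changing the measure, so asking
  for a Borel measurable \<open>V\<close> does not restrict the class of measures.
\<close>

definition log_concave :: "nat \<Rightarrow> (nat \<Rightarrow> real) measure \<Rightarrow> bool"
  where "log_concave n \<mu> \<longleftrightarrow> prob_space \<mu> \<and>
    (\<exists>V. convex_fun_n n V \<and> V \<in> borel_measurable (lborel_n n) \<and>
         \<mu> = density (lborel_n n) (\<lambda>x. ennreal (exp_neg (V x))))"

definition tilt_weight :: "nat \<Rightarrow> real \<Rightarrow> (nat \<Rightarrow> real) \<Rightarrow> (nat \<Rightarrow> real) \<Rightarrow> real"
  where "tilt_weight n t h x = exp (inner_n n h x - t / 2 * (norm_n n x)\<^sup>2)"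

text \<open>
  \<open>log_laplace\<close> is meaningful only if \<open>tilt_weight n t h\<close> is integrable, that is, if the logarithm
  of its integral is finite; the stability notions below demand this explicitly.
\<close>

definition log_laplace :: "nat \<Rightarrow> (nat \<Rightarrow> real) measure \<Rightarrow> real \<Rightarrow> (nat \<Rightarrow> real) \<Rightarrow> real"
  where "log_laplace n \<mu> t h = ln (\<integral>x. tilt_weight n t h x \<partial>\<mu>)"

definition tilted ::
  "nat \<Rightarrow> (nat \<Rightarrow> real) measure \<Rightarrow> real \<Rightarrow> (nat \<Rightarrow> real) \<Rightarrow> (nat \<Rightarrow> real) measure"
  where "tilted n \<mu> t h = density \<mu> (\<lambda>x. ennreal
    (exp (inner_n n h x - t / 2 * (norm_n n x)\<^sup>2 - log_laplace n \<mu> t h)))"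

definition cov_mat :: "(nat \<Rightarrow> real) measure \<Rightarrow> nat \<Rightarrow> nat \<Rightarrow> real"
  where "cov_mat \<nu> i j = (\<integral>x. (x i - (\<integral>y. y i \<partial>\<nu>)) * (x j - (\<integral>y. y j \<partial>\<nu>)) \<partial>\<nu>)"

definition psd :: "nat \<Rightarrow> (nat \<Rightarrow> nat \<Rightarrow> real) \<Rightarrow> bool"
  where "psd n A \<longleftrightarrow> (\<forall>i<n. \<forall>j<n. A i j = A j i) \<and>
    (\<forall>v\<in>Rn n. 0 \<le> (\<Sum>i<n. \<Sum>j<n. v i * A i j * v j))"

definition loewner_le :: "nat \<Rightarrow> (nat \<Rightarrow> nat \<Rightarrow> real) \<Rightarrow> (nat \<Rightarrow> nat \<Rightarrow> real) \<Rightarrow> bool"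
  where "loewner_le n A B \<longleftrightarrow> psd n (\<lambda>i j. B i j - A i j)"

definition id_mat :: "nat \<Rightarrow> nat \<Rightarrow> real"
  where "id_mat i j = (if i = j then 1 else 0)"

definition tilt_stable :: "nat \<Rightarrow> real \<Rightarrow> (nat \<Rightarrow> real) measure \<Rightarrow> bool"
  where "tilt_stable n \<beta> \<mu> \<longleftrightarrow> \<beta> > 0 \<and>
    (\<forall>h\<in>Rn n. integrable \<mu> (tilt_weight n 0 h) \<and>
       loewner_le n (cov_mat (tilted n \<mu> 0 h)) (\<lambda>i j. \<beta>\<^sup>2 * id_mat i j))"

definition strongly_tilt_stable :: "nat \<Rightarrow> real \<Rightarrow> (nat \<Rightarrow> real) measure \<Rightarrow> bool"
  where "strongly_tilt_stable n \<beta> \<mu> \<longleftrightarrow> \<beta> > 0 \<and>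
    (\<forall>t\<ge>0. \<forall>h\<in>Rn n. integrable \<mu> (tilt_weight n t h) \<and>
       loewner_le n (cov_mat (tilted n \<mu> t h)) (\<lambda>i j. \<beta>\<^sup>2 * id_mat i j))"

text \<open>
  The value is in \<open>ennreal\<close>, so that the infimum of the empty set is \<open>\<infinity>\<close>; likewise
  the expectation is a nonnegative integral, with value \<open>\<infinity>\<close> when it diverges.
  As \<open>enn2real \<infinity> = 0\<close> and the stability notions require \<open>\<beta> > 0\<close>, using \<open>enn2real (K_tilde n)\<close>
  as a factor of \<open>\<beta>\<close> implicitly asserts that \<open>K_tilde n\<close> is finite and positive.
\<close>

definition psi2_norm :: "'a measure \<Rightarrow> ('a \<Rightarrow> real) \<Rightarrow> ennreal"
  where "psi2_norm M Y =
    Inf {ennreal t | t. t > 0 \<and> (\<integral>\<^sup>+x. ennreal (exp ((Y x)\<^sup>2 / t\<^sup>2)) \<partial>M) \<le> 2}"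

definition K_tilde :: "nat \<Rightarrow> ennreal"
  where "K_tilde n = (SUP \<nu>\<in>{\<nu>. log_concave n \<nu> \<and> tilt_stable n 1 \<nu>}.
    psi2_norm \<nu> (\<lambda>x. norm_n n x - (\<integral>y. norm_n n y \<partial>\<nu>)))"

end

theory Submission
  imports Defs
begin

text \<open>
  For \<open>t > 0\<close> the density of the tilted measure is the exponential of a function that is concave even
  after \<open>t / 2\<close> times the squared norm is added.  The Prekopa-Leindler inequality then bounds the
  variance of a linear functional in a unit direction by \<open>2 / t\<close> (\<open>brascamp_lieb_linear\<close>).  This
  settles large \<open>t\<close>.  For small \<open>t\<close> the tilt-stability of \<open>\<mu>\<close> has to be carried over to the Gaussian
  tilts.

  Completing the square, the tilt by \<open>t\<close> and \<open>h\<close> is the Gaussian tilt, by \<open>t\<close> alone, of a translate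
  \<open>\<nu>\<close> of some linear tilt of \<open>\<mu>\<close>.  The measure \<open>\<nu>\<close> is again log-concave and 1 tilt-stable, and the
  translation can be chosen such that its barycentre has norm at most 1 (\<open>ex_almost_centred_tilt\<close>).
  The norm \<open>R\<close> under \<open>\<nu>\<close> then has a mean \<open>m\<close> with \<open>m\<^sup>2 \<le> 2 * n\<close>, and \<open>R - m\<close> is subgaussian with constant
  \<open>K\<close>, the value of \<open>K_tilde n\<close>.  The Gaussian weight is the exponential of
  \<open>- t / 2 * (m\<^sup>2 + 2 * m * (R - m) + (R - m)\<^sup>2)\<close>, where the first summand is constant
  and the others fluctuate little: the normalised density has a second moment of
  \<open>exp (O (1 + t * K\<^sup>2 + t\<^sup>2 * n * K\<^sup>2))\<close>.  Linear functionals of \<open>\<nu>\<close> are subgaussian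
  (\<open>tilt_stable_mgf_le\<close>), and for subgaussian functionals a change of density costs only the
  logarithm of this moment.  Their variance after the Gaussian tilt is thus
  \<open>O (1 + t * K\<^sup>2 + t\<^sup>2 * n * K\<^sup>2)\<close> (\<open>dir_var_gaussian_tilt_le\<close>).

  Let \<open>p ^ 3 = n * K\<^sup>2\<close>.  For \<open>t \<ge> 1 / p\<close> the first bound is \<open>O p\<close>; for \<open>t \<le> 1 / p\<close> so is the second, because
  \<open>t\<^sup>2 * n * K\<^sup>2 = t\<^sup>2 * p ^ 3 \<le> p\<close>, and the two other summands are absorbed by means of
  \<open>1 / 50 \<le> K \<le> sqrt (8 * n)\<close> (\<open>K_tilde_ge\<close>, \<open>K_tilde_le\<close>).  The square of the claimed stability
  constant is a multiple of \<open>p\<close>.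
\<close>

section \<open>The Prekopa-Leindler inequality for midpoints\<close>

text \<open>
  \<open>A\<close> need not have a largest element.  An element close enough to the supremum serves instead: only a
  set of small measure is cut off beyond it.
\<close>

lemma emeasure_initial_segment_approx:
  fixes A :: "real set"
  assumes A: "A \<in> sets borel" and c: "c < emeasure lborel A"
  shows "\<exists>a\<in>A. c < emeasure lborel (A \<inter> {..a})"
proof -
  have "(SUP k. emeasure lborel (A \<inter> {..real k})) = emeasure lborel (\<Union>k. A \<inter> {..real k})"
    using A by (intro SUP_emeasure_incseq) (auto simp: incseq_def)
  also have "(\<Union>k. A \<inter> {..real k}) = A"
  proof -
    have "\<exists>k. x \<le> real k" for x by (rule real_arch_simple)
    thus ?thesis by blast
  qed
  finally have "c < (SUP k. emeasure lborel (A \<inter> {..real k}))" using c by simp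
  then obtain k where k: "c < emeasure lborel (A \<inter> {..real k})"
    unfolding less_SUP_iff by blast
  define B where "B = A \<inter> {..real k}"
  have B: "B \<in> sets borel" "bdd_above B" using A unfolding B_def by auto
  have ne: "B \<noteq> {}" using k unfolding B_def by auto
  define s where "s = Sup B"
  have less_s: "\<exists>a\<in>B. x < a" if "x < s" for x
    using that B(2) ne unfolding s_def by (simp add: less_cSup_iff)
  have "emeasure lborel B = emeasure lborel (B \<inter> {..<s})"
  proof (intro emeasure_eq_AE)
    show "AE x in lborel. (x \<in> B) = (x \<in> B \<inter> {..<s})"
      using AE_lborel_singleton[of s]
    proof eventually_elim
      case (elim x)
      have "x \<in> B \<Longrightarrow> x \<le> s" unfolding s_def using B(2) by (simp add: cSup_upper)
      with elim show ?case by auto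
    qed
  qed (use B in auto)
  also have "B \<inter> {..<s} = (\<Union>j. B \<inter> {..s - 1 / real (Suc j)})"
  proof -
    have "\<exists>j. x \<le> s - 1 / real (Suc j)" if "x < s" for x
    proof -
      have "0 < s - x" using that by simp
      then obtain j where "1 / real (Suc j) < s - x" by (rule nat_approx_posE)
      thus ?thesis by (intro exI[of _ j]) auto
    qed
    moreover have "x < s" if "x \<le> s - 1 / real (Suc j)" for x j
    proof -
      have "0 < 1 / real (Suc j)" by simp
      thus ?thesis using that by linarith
    qed
    ultimately show ?thesis by auto
  qed
  also have "emeasure lborel (\<Union>j. B \<inter> {..s - 1 / real (Suc j)}) =
      (SUP j. emeasure lborel (B \<inter> {..s - 1 / real (Suc j)}))"
  proof (intro SUP_emeasure_incseq[symmetric])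
    show "incseq (\<lambda>j. B \<inter> {..s - 1 / real (Suc j)})"
    proof (rule incseq_SucI)
      fix j
      have "1 / real (Suc (Suc j)) \<le> 1 / real (Suc j)" by (simp add: frac_le)
      thus "B \<inter> {..s - 1 / real (Suc j)} \<subseteq> B \<inter> {..s - 1 / real (Suc (Suc j))}" by auto
    qed
  qed (use B in auto)
  finally have "c < (SUP j. emeasure lborel (B \<inter> {..s - 1 / real (Suc j)}))"
    using k unfolding B_def by simp
  then obtain j where j: "c < emeasure lborel (B \<inter> {..s - 1 / real (Suc j)})"
    unfolding less_SUP_iff by blast
  have "s - 1 / real (Suc j) < s" by simp
  from less_s[OF this] obtain a where a: "a \<in> B" "s - 1 / real (Suc j) < a" by blast
  have "emeasure lborel (B \<inter> {..s - 1 / real (Suc j)}) \<le> emeasure lborel (A \<inter> {..a})"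
    using a A by (intro emeasure_mono) (auto simp: B_def)
  with j have "c < emeasure lborel (A \<inter> {..a})" by (rule less_le_trans)
  thus ?thesis using a unfolding B_def by auto
qed

lemma emeasure_lborel_reflect:
  assumes "A \<in> sets borel"
  shows "emeasure lborel {x::real. - x \<in> A} = emeasure lborel A"
proof -
  have "emeasure lborel A = emeasure (distr lborel borel uminus) A"
    by (simp only: lborel_distr_uminus)
  also have "\<dots> = emeasure lborel (uminus -` A \<inter> space lborel)"
    using assms by (intro emeasure_distr) auto
  also have "uminus -` A \<inter> space lborel = {x. - x \<in> A}" by auto
  finally show ?thesis by simp
qed

lemma emeasure_final_segment_approx:
  fixes A :: "real set"
  assumes A: "A \<in> sets borel" and c: "c < emeasure lborel A"
  shows "\<exists>a\<in>A. c < emeasure lborel (A \<inter> {a..})"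
proof -
  have m: "{x. - x \<in> A} \<in> sets borel"
    using measurable_sets[of uminus borel borel A] A by (simp add: vimage_def)
  have "\<exists>a\<in>{x. - x \<in> A}. c < emeasure lborel ({x. - x \<in> A} \<inter> {..a})"
    using emeasure_lborel_reflect[OF A] c by (intro emeasure_initial_segment_approx m) simp
  then obtain a where a: "- a \<in> A" "c < emeasure lborel ({x. - x \<in> A} \<inter> {..a})" by auto
  have "{x. - x \<in> A} \<inter> {..a} = {x. - x \<in> A \<inter> {- a..}}" by auto
  with a(2) have "c < emeasure lborel (A \<inter> {- a..})"
    using emeasure_lborel_reflect[of "A \<inter> {- a..}"] A by simp
  with a(1) show ?thesis by blast
qed

text \<open>
  For \<open>a \<in> A\<close> and \<open>b \<in> B\<close> the translates \<open>(A \<inter> {..a}) + b\<close> and \<open>a + (B \<inter> {b..})\<close> lie in the sum set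
  \<open>A + B\<close> and meet at most in the point \<open>a + b\<close>, so that their measures add up.  Letting \<open>a\<close> and \<open>b\<close>
  approach the two ends loses nothing.  The set \<open>S\<close> takes the place of \<open>(A + B) / 2\<close>, because a sum of
  two Borel sets is not always Borel.
\<close>

lemma brunn_minkowski_line:
  fixes A B S :: "real set"
  assumes [measurable]: "A \<in> sets borel" "B \<in> sets borel" "S \<in> sets borel"
    and ne: "A \<noteq> {}" "B \<noteq> {}"
    and mid: "\<And>a b. a \<in> A \<Longrightarrow> b \<in> B \<Longrightarrow> (a + b) / 2 \<in> S"
  shows "emeasure lborel A + emeasure lborel B \<le> 2 * emeasure lborel S"
proof -
  have seg: "emeasure lborel (A \<inter> {..a}) + emeasure lborel (B \<inter> {b..}) \<le> 2 * emeasure lborel S"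
    if a: "a \<in> A" and b: "b \<in> B" for a b
  proof -
    have "emeasure lborel (A \<inter> {..a}) = (\<integral>\<^sup>+z. indicator (A \<inter> {..a}) (- b + 1 * z) \<partial>lborel)"
      using nn_integral_real_affine[of "indicator (A \<inter> {..a})" 1 "- b"] by simp
    moreover have "emeasure lborel (B \<inter> {b..}) = (\<integral>\<^sup>+z. indicator (B \<inter> {b..}) (- a + 1 * z) \<partial>lborel)"
      using nn_integral_real_affine[of "indicator (B \<inter> {b..})" 1 "- a"] by simp
    ultimately have "emeasure lborel (A \<inter> {..a}) + emeasure lborel (B \<inter> {b..}) =
        (\<integral>\<^sup>+z. indicator (A \<inter> {..a}) (- b + 1 * z) + indicator (B \<inter> {b..}) (- a + 1 * z) \<partial>lborel)"
      by (simp add: nn_integral_add)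
    also have "\<dots> \<le> (\<integral>\<^sup>+z. indicator S (0 + 1/2 * z) \<partial>lborel)"
    proof (intro nn_integral_mono_AE)
      show "AE z in lborel. indicator (A \<inter> {..a}) (- b + 1 * z) + indicator (B \<inter> {b..}) (- a + 1 * z)
          \<le> (indicator S (0 + 1/2 * z) :: ennreal)"
        using AE_lborel_singleton[of "a + b"]
      proof eventually_elim
        case (elim z)
        have "z - b \<in> A \<Longrightarrow> z / 2 \<in> S" using mid[of "z - b" b] b by simp
        moreover have "z - a \<in> B \<Longrightarrow> z / 2 \<in> S" using mid[of a "z - a"] a by simp
        ultimately show ?case using elim by (auto simp: indicator_def)
      qed
    qed
    also have "\<dots> = 2 * (ennreal \<bar>1/2\<bar> * (\<integral>\<^sup>+z. indicator S (0 + 1/2 * z) \<partial>lborel))"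
    proof -
      have "ennreal 2 * ennreal \<bar>1/2\<bar> = ennreal (2 * \<bar>1/2\<bar>)" by (rule ennreal_mult[symmetric]) simp_all
      hence "2 * ennreal \<bar>1/2\<bar> = 1" by (simp only: ennreal_numeral) simp
      thus ?thesis unfolding mult.assoc[symmetric] by (simp only: mult_1_left)
    qed
    also have "ennreal \<bar>1/2\<bar> * (\<integral>\<^sup>+z. indicator S (0 + 1/2 * z) \<partial>lborel) = emeasure lborel S"
      using nn_integral_real_affine[of "indicator S" "1/2" 0] by simp
    finally show ?thesis .
  qed
  have "emeasure lborel A \<le> (SUP a\<in>A. emeasure lborel (A \<inter> {..a}))"
  proof (rule dense_le)
    fix c assume "c < emeasure lborel A"
    then obtain a where a: "a \<in> A" "c < emeasure lborel (A \<inter> {..a})"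
      using emeasure_initial_segment_approx[of A c] assms by blast
    show "c \<le> (SUP a\<in>A. emeasure lborel (A \<inter> {..a}))"
      using a by (intro order_trans[OF less_imp_le SUP_upper])
  qed
  moreover have "emeasure lborel B \<le> (SUP b\<in>B. emeasure lborel (B \<inter> {b..}))"
  proof (rule dense_le)
    fix c assume "c < emeasure lborel B"
    then obtain b where b: "b \<in> B" "c < emeasure lborel (B \<inter> {b..})"
      using emeasure_final_segment_approx[of B c] assms by blast
    show "c \<le> (SUP b\<in>B. emeasure lborel (B \<inter> {b..}))"
      using b by (intro order_trans[OF less_imp_le SUP_upper])
  qed
  ultimately have "emeasure lborel A + emeasure lborel B \<le>
      (SUP a\<in>A. emeasure lborel (A \<inter> {..a})) + (SUP b\<in>B. emeasure lborel (B \<inter> {b..}))"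
    by (rule add_mono)
  also have "\<dots> = (SUP b\<in>B. SUP a\<in>A. emeasure lborel (A \<inter> {..a}) + emeasure lborel (B \<inter> {b..}))"
    using ne by (simp add: ennreal_SUP_add_left ennreal_SUP_add_right)
  also have "\<dots> \<le> 2 * emeasure lborel S"
    using seg by (intro SUP_least)
  finally show ?thesis .
qed

lemma nn_integral_layer_cake:
  fixes f :: "real \<Rightarrow> ennreal"
  assumes [measurable]: "f \<in> borel_measurable borel"
  shows "(\<integral>\<^sup>+x. f x \<partial>lborel) = (\<integral>\<^sup>+l. indicator {0..} l * emeasure lborel {x. ennreal l < f x} \<partial>lborel)"
proof -
  have 1: "f x = (\<integral>\<^sup>+l. indicator {0..} l * indicator {x. ennreal l < f x} x \<partial>lborel)" for x
  proof (cases "f x")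
    case (real r)
    have "(\<integral>\<^sup>+l. indicator {0..} l * indicator {x. ennreal l < f x} x \<partial>lborel) =
        (\<integral>\<^sup>+l. indicator {0..<r} l \<partial>lborel)"
      using real by (intro nn_integral_cong) (auto simp: indicator_def ennreal_less_iff)
    thus ?thesis using real by simp
  next
    case top
    have "(\<integral>\<^sup>+l. indicator {0..} l * indicator {x. ennreal l < f x} x \<partial>lborel) =
        (\<integral>\<^sup>+l. indicator {0::real..} l \<partial>lborel)"
      using top by (intro nn_integral_cong) (auto simp: indicator_def)
    also have "\<dots> = \<infinity>"
    proof -
      have "of_nat k \<le> emeasure lborel {0::real..}" for k
      proof -
        have "of_nat k = emeasure lborel {0..real k}" by (simp add: ennreal_of_nat_eq_real_of_nat)
        also have "\<dots> \<le> emeasure lborel {0::real..}" by (intro emeasure_mono) auto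
        finally show ?thesis .
      qed
      hence "emeasure lborel {0::real..} = top"
        by (metis ennreal_Ex_less_of_nat linorder_not_le top.not_eq_extremum)
      thus ?thesis by simp
    qed
    finally show ?thesis using top by simp
  qed
  have "(\<integral>\<^sup>+x. f x \<partial>lborel) =
      (\<integral>\<^sup>+x. \<integral>\<^sup>+l. indicator {0..} l * indicator {x. ennreal l < f x} x \<partial>lborel \<partial>lborel)"
    by (intro nn_integral_cong 1)
  also have "\<dots> = (\<integral>\<^sup>+l. \<integral>\<^sup>+x. indicator {0..} l * indicator {x. ennreal l < f x} x \<partial>lborel \<partial>lborel)"
    by (intro lborel_pair.Fubini') measurable
  also have "\<dots> = (\<integral>\<^sup>+l. indicator {0..} l * emeasure lborel {x. ennreal l < f x} \<partial>lborel)"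
    by (intro nn_integral_cong) (simp add: nn_integral_cmult)
  finally show ?thesis .
qed

lemma ennreal_AMGM: "4 * (a * b) \<le> (a + b)\<^sup>2" for a b :: ennreal
proof (cases "a = \<top> \<or> b = \<top>")
  case False
  then obtain x y where xy: "a = ennreal x" "b = ennreal y" "0 \<le> x" "0 \<le> y"
    by (metis ennreal_cases)
  have "4 * (x * y) \<le> (x + y)\<^sup>2" using sum_squares_bound[of x y] by (simp add: power2_sum)
  thus ?thesis using xy
    by (simp add: ennreal_power flip: ennreal_mult ennreal_plus ennreal_numeral)
qed (auto simp: power2_eq_square ennreal_top_mult)

lemma ennreal_square_less_mult:
  fixes c x y :: ennreal
  assumes "c < x" "c < y"
  shows "c * c < x * y"
proof -
  obtain r where r: "c = ennreal r" "0 \<le> r" using assms(1) by (cases c) auto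
  show ?thesis
    using assms r
    by (cases x; cases y)
       (auto simp: ennreal_less_iff ennreal_mult_top ennreal_top_mult less_top[symmetric]
         intro!: mult_strict_mono simp flip: ennreal_mult)
qed

text \<open>
  The Brunn-Minkowski inequality compares the level sets of \<open>f\<close>, \<open>g\<close> and \<open>h\<close> at each height, and the
  layer cake formula integrates over the heights.  The comparison can fail at a height where exactly one
  of the level sets of \<open>f\<close> and \<open>g\<close> is empty; equal suprema exclude this.
\<close>

lemma prekopa_leindler_line_normalised:
  fixes f g h :: "real \<Rightarrow> ennreal"
  assumes [measurable]: "f \<in> borel_measurable borel" "g \<in> borel_measurable borel" "h \<in> borel_measurable borel"
    and sup: "(SUP x. f x) = 1" "(SUP x. g x) = 1"
    and fgh: "\<And>x y. f x * g y \<le> (h ((x + y) / 2))\<^sup>2"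
  shows "(\<integral>\<^sup>+x. f x \<partial>lborel) + (\<integral>\<^sup>+x. g x \<partial>lborel) \<le> 2 * (\<integral>\<^sup>+x. h x \<partial>lborel)"
proof -
  have level: "emeasure lborel {x. ennreal l < f x} + emeasure lborel {x. ennreal l < g x}
      \<le> 2 * emeasure lborel {x. ennreal l < h x}" if l: "0 \<le> l" for l
  proof (cases "l < 1")
    case True
    hence l1: "ennreal l < 1" using l by (simp add: ennreal_less_one_iff)
    have "ennreal l < (SUP x. f x)" "ennreal l < (SUP x. g x)" using l1 sup by simp_all
    hence ne: "{x. ennreal l < f x} \<noteq> {}" "{x. ennreal l < g x} \<noteq> {}"
      unfolding less_SUP_iff by blast+
    show ?thesis
    proof (rule brunn_minkowski_line[OF _ _ _ ne])
      fix a b assume a: "a \<in> {x. ennreal l < f x}" and b: "b \<in> {x. ennreal l < g x}"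
      show "(a + b) / 2 \<in> {x. ennreal l < h x}"
      proof (rule ccontr)
        assume "(a + b) / 2 \<notin> {x. ennreal l < h x}"
        hence le: "h ((a + b) / 2) \<le> ennreal l" by (simp add: not_less)
        have "f a * g b \<le> (h ((a + b) / 2))\<^sup>2" by (rule fgh)
        also have "\<dots> \<le> ennreal l * ennreal l"
          unfolding power2_eq_square by (intro mult_mono le) simp_all
        also have "\<dots> < f a * g b"
          using a b by (intro ennreal_square_less_mult) auto
        finally show False by simp
      qed
    qed measurable
  next
    case False
    hence "1 \<le> ennreal l" by simp
    moreover have "f x \<le> 1" "g x \<le> 1" for x
      using SUP_upper[of x UNIV f] SUP_upper[of x UNIV g] sup by simp_all
    ultimately have "\<not> ennreal l < f x" "\<not> ennreal l < g x" for x
      unfolding not_less by (blast intro: order_trans)+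
    thus ?thesis by simp
  qed
  have "(\<integral>\<^sup>+x. f x \<partial>lborel) + (\<integral>\<^sup>+x. g x \<partial>lborel) =
      (\<integral>\<^sup>+l. indicator {0..} l * emeasure lborel {x. ennreal l < f x} +
            indicator {0..} l * emeasure lborel {x. ennreal l < g x} \<partial>lborel)"
    unfolding nn_integral_layer_cake[OF assms(1)] nn_integral_layer_cake[OF assms(2)]
    by (intro nn_integral_add[symmetric]) measurable
  also have "\<dots> \<le> (\<integral>\<^sup>+l. 2 * (indicator {0..} l * emeasure lborel {x. ennreal l < h x}) \<partial>lborel)"
    by (intro nn_integral_mono) (auto simp: indicator_def level)
  also have "\<dots> = 2 * (\<integral>\<^sup>+l. indicator {0..} l * emeasure lborel {x. ennreal l < h x} \<partial>lborel)"
    by (intro nn_integral_cmult) measurable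
  also have "\<dots> = 2 * (\<integral>\<^sup>+x. h x \<partial>lborel)"
    unfolding nn_integral_layer_cake[OF assms(3)] ..
  finally show ?thesis .
qed

text \<open>
  Scaling brings both suprema to 1; the inequality between arithmetic and geometric means then turns
  the sum into a product, and the product form is invariant under the scaling.
\<close>

lemma prekopa_leindler_line_bounded:
  fixes f g h :: "real \<Rightarrow> ennreal"
  assumes [measurable]: "f \<in> borel_measurable borel" "g \<in> borel_measurable borel" "h \<in> borel_measurable borel"
    and fin: "(SUP x. f x) < \<top>" "(SUP x. g x) < \<top>"
    and fgh: "\<And>x y. f x * g y \<le> (h ((x + y) / 2))\<^sup>2"
  shows "(\<integral>\<^sup>+x. f x \<partial>lborel) * (\<integral>\<^sup>+x. g x \<partial>lborel) \<le> (\<integral>\<^sup>+x. h x \<partial>lborel)\<^sup>2"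
proof -
  obtain F G where FG: "(SUP x. f x) = ennreal F" "0 \<le> F" "(SUP x. g x) = ennreal G" "0 \<le> G"
    using fin by (metis ennreal_cases less_irrefl)
  have ub: "f x \<le> ennreal F" "g x \<le> ennreal G" for x
    using SUP_upper[of x UNIV f] SUP_upper[of x UNIV g] FG by simp_all
  show ?thesis
  proof (cases "F = 0 \<or> G = 0")
    case True
    hence "(\<forall>x. f x = 0) \<or> (\<forall>x. g x = 0)" using ub by auto
    thus ?thesis by auto
  next
    case False
    hence pos: "0 < F" "0 < G" using FG by auto
    define r where "r = sqrt (F * G)"
    have r: "0 < r" "r * r = F * G" using pos by (auto simp: r_def)
    define f' where "f' x = ennreal (1 / F) * f x" for x
    define g' where "g' x = ennreal (1 / G) * g x" for x
    define h' where "h' x = ennreal (1 / r) * h x" for x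
    have [measurable]: "f' \<in> borel_measurable borel" "g' \<in> borel_measurable borel" "h' \<in> borel_measurable borel"
      unfolding f'_def g'_def h'_def by measurable
    have "(\<integral>\<^sup>+x. f' x \<partial>lborel) + (\<integral>\<^sup>+x. g' x \<partial>lborel) \<le> 2 * (\<integral>\<^sup>+x. h' x \<partial>lborel)"
    proof (rule prekopa_leindler_line_normalised)
      show "(SUP x. f' x) = 1" "(SUP x. g' x) = 1"
        unfolding f'_def g'_def SUP_mult_left_ennreal[symmetric] FG
        using pos by (simp_all flip: ennreal_mult)
      fix x y
      have "f' x * g' y = ennreal (1 / F) * ennreal (1 / G) * (f x * g y)"
        unfolding f'_def g'_def by (simp add: ac_simps)
      also have "\<dots> \<le> ennreal (1 / F) * ennreal (1 / G) * (h ((x + y) / 2))\<^sup>2"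
        by (intro mult_left_mono fgh) simp
      also have "ennreal (1 / F) * ennreal (1 / G) = (ennreal (1 / r))\<^sup>2"
        using pos r by (simp add: power2_eq_square flip: ennreal_mult)
      also have "\<dots> * (h ((x + y) / 2))\<^sup>2 = (h' ((x + y) / 2))\<^sup>2"
        unfolding h'_def by (simp add: power_mult_distrib)
      finally show "f' x * g' y \<le> (h' ((x + y) / 2))\<^sup>2" .
    qed measurable
    hence "((\<integral>\<^sup>+x. f' x \<partial>lborel) + (\<integral>\<^sup>+x. g' x \<partial>lborel))\<^sup>2 \<le> (2 * (\<integral>\<^sup>+x. h' x \<partial>lborel))\<^sup>2"
      by (intro power_mono) simp_all
    with ennreal_AMGM have le: "4 * ((\<integral>\<^sup>+x. f' x \<partial>lborel) * (\<integral>\<^sup>+x. g' x \<partial>lborel)) \<le> 4 * (\<integral>\<^sup>+x. h' x \<partial>lborel)\<^sup>2"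
      by (simp add: power_mult_distrib) (rule order_trans)
    have "f x = ennreal F * f' x" "g x = ennreal G * g' x" "h x = ennreal r * h' x" for x
      unfolding f'_def g'_def h'_def mult.assoc[symmetric] using pos r
      by (simp_all flip: ennreal_mult)
    hence eq: "(\<integral>\<^sup>+x. f x \<partial>lborel) = ennreal F * (\<integral>\<^sup>+x. f' x \<partial>lborel)"
      "(\<integral>\<^sup>+x. g x \<partial>lborel) = ennreal G * (\<integral>\<^sup>+x. g' x \<partial>lborel)"
      "(\<integral>\<^sup>+x. h x \<partial>lborel) = ennreal r * (\<integral>\<^sup>+x. h' x \<partial>lborel)"
      by (simp_all add: nn_integral_cmult)
    have "ennreal r * ennreal r = ennreal F * ennreal G" using r pos by (simp flip: ennreal_mult)
    moreover have "(\<integral>\<^sup>+x. f' x \<partial>lborel) * (\<integral>\<^sup>+x. g' x \<partial>lborel) \<le> (\<integral>\<^sup>+x. h' x \<partial>lborel)\<^sup>2"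
      using mult_left_mono[OF le, of "ennreal (1/4)"] unfolding mult.assoc[symmetric]
      by (simp flip: ennreal_mult ennreal_numeral)
    ultimately show ?thesis unfolding eq
      by (simp add: power2_eq_square ac_simps)
         (metis (no_types, lifting) mult.assoc mult.commute mult_left_mono zero_le)
  qed
qed

text \<open>
  In the induction over the dimension \<open>f\<close> and \<open>g\<close> are integrals over slices, which can be unbounded or
  even infinite, so the previous bound is extended by truncation and monotone convergence.
\<close>

lemma prekopa_leindler_line:
  fixes f g h :: "real \<Rightarrow> ennreal"
  assumes [measurable]: "f \<in> borel_measurable borel" "g \<in> borel_measurable borel" "h \<in> borel_measurable borel"
    and fgh: "\<And>x y. f x * g y \<le> (h ((x + y) / 2))\<^sup>2"
  shows "(\<integral>\<^sup>+x. f x \<partial>lborel) * (\<integral>\<^sup>+x. g x \<partial>lborel) \<le> (\<integral>\<^sup>+x. h x \<partial>lborel)\<^sup>2"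
proof -
  have trunc: "(\<integral>\<^sup>+x. u x \<partial>lborel) = (SUP k. \<integral>\<^sup>+x. min (u x) (of_nat k) \<partial>lborel)"
    if [measurable]: "u \<in> borel_measurable borel" for u :: "real \<Rightarrow> ennreal"
  proof -
    have sup: "u x = (SUP k. min (u x) (of_nat k))" for x
    proof -
      have "min (u x) (SUP k. of_nat k) = (SUP k. min (u x) (of_nat k :: ennreal))"
        by (simp add: inf_min[symmetric] inf_SUP)
      thus ?thesis by (simp add: ennreal_SUP_of_nat_eq_top)
    qed
    show ?thesis
      by (subst sup, intro nn_integral_monotone_convergence_SUP)
         (auto simp: incseq_def le_fun_def intro!: min.mono of_nat_mono simp del: min.bounded_iff)
  qed
  have bd: "(\<integral>\<^sup>+x. min (f x) (of_nat k) \<partial>lborel) * (\<integral>\<^sup>+x. min (g x) (of_nat j) \<partial>lborel)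
      \<le> (\<integral>\<^sup>+x. h x \<partial>lborel)\<^sup>2" for k j
  proof (rule prekopa_leindler_line_bounded)
    show "(SUP x. min (f x) (of_nat k)) < \<top>" 
      by (rule le_less_trans[OF SUP_least[of _ _ "of_nat k"]]) (auto simp: of_nat_less_top)
    show "(SUP x. min (g x) (of_nat j)) < \<top>"
      by (rule le_less_trans[OF SUP_least[of _ _ "of_nat j"]]) (auto simp: of_nat_less_top)
    show "min (f x) (of_nat k) * min (g y) (of_nat j) \<le> (h ((x + y) / 2))\<^sup>2" for x y
      by (rule order_trans[OF mult_mono fgh]) auto
  qed measurable
  show ?thesis
    unfolding trunc[OF assms(1)] trunc[OF assms(2)]
    by (simp add: SUP_mult_left_ennreal SUP_mult_right_ennreal bd SUP_least)
qed

lemma nn_integral_lborel_Suc: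
  assumes "f \<in> borel_measurable (lborel_n (Suc n))"
  shows "(\<integral>\<^sup>+x. f x \<partial>lborel_n (Suc n)) = (\<integral>\<^sup>+x. \<integral>\<^sup>+y. f (x(n := y)) \<partial>lborel \<partial>lborel_n n)"
proof -
  interpret product_sigma_finite "\<lambda>_::nat. lborel :: real measure" by standard
  have "{..<Suc n} = insert n {..<n}" by auto
  thus ?thesis using product_nn_integral_insert[of "{..<n}" n f] assms by simp
qed

text \<open>
  Integrating out the last coordinate preserves the hypothesis, by the one-dimensional inequality on
  each pair of slices; this makes an induction over the dimension possible.
\<close>

theorem prekopa_leindler:
  fixes f g h :: "(nat \<Rightarrow> real) \<Rightarrow> ennreal"
  assumes "f \<in> borel_measurable (lborel_n n)" "g \<in> borel_measurable (lborel_n n)"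
    "h \<in> borel_measurable (lborel_n n)"
    and "\<And>x y. x \<in> Rn n \<Longrightarrow> y \<in> Rn n \<Longrightarrow> f x * g y \<le> (h (\<lambda>i\<in>{..<n}. (x i + y i) / 2))\<^sup>2"
  shows "(\<integral>\<^sup>+x. f x \<partial>lborel_n n) * (\<integral>\<^sup>+x. g x \<partial>lborel_n n) \<le> (\<integral>\<^sup>+x. h x \<partial>lborel_n n)\<^sup>2"
  using assms
proof (induction n arbitrary: f g h)
  case 0
  interpret product_sigma_finite "\<lambda>_::nat. lborel :: real measure" by standard
  show ?case using "0.prems"(4)[of "\<lambda>_. undefined" "\<lambda>_. undefined"]
    by (simp add: nn_integral_empty)
next
  case (Suc n)
  have upd: "(\<lambda>(x, y). x(n := y)) \<in> measurable (lborel_n n \<Otimes>\<^sub>M lborel) (lborel_n (Suc n))"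
    using measurable_add_dim[of n "{..<n}" "\<lambda>_. lborel"] by (simp add: lessThan_Suc)
  have slice: "(\<lambda>x. \<integral>\<^sup>+y. u (x(n := y)) \<partial>lborel) \<in> borel_measurable (lborel_n n)"
    if "u \<in> borel_measurable (lborel_n (Suc n))" for u :: "(nat \<Rightarrow> real) \<Rightarrow> ennreal"
    using measurable_compose[OF upd that]
    by (intro lborel.borel_measurable_nn_integral) (simp add: case_prod_beta')
  have sect: "(\<lambda>y. u (x(n := y))) \<in> borel_measurable borel"
    if "u \<in> borel_measurable (lborel_n (Suc n))" "x \<in> Rn n" for u :: "(nat \<Rightarrow> real) \<Rightarrow> ennreal" and x
    using measurable_compose[OF measurable_Pair1'[of x "lborel_n n" lborel] measurable_compose[OF upd that(1)]] that(2)
    by (simp add: space_PiM)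
  have "(\<integral>\<^sup>+x. \<integral>\<^sup>+y. f (x(n := y)) \<partial>lborel \<partial>lborel_n n) * (\<integral>\<^sup>+x. \<integral>\<^sup>+y. g (x(n := y)) \<partial>lborel \<partial>lborel_n n)
      \<le> (\<integral>\<^sup>+x. \<integral>\<^sup>+y. h (x(n := y)) \<partial>lborel \<partial>lborel_n n)\<^sup>2"
  proof (intro Suc.IH slice Suc.prems(1-3))
    fix x x' assume x: "x \<in> Rn n" "x' \<in> Rn n"
    let ?m = "\<lambda>i\<in>{..<n}. (x i + x' i) / 2"
    show "(\<integral>\<^sup>+y. f (x(n := y)) \<partial>lborel) * (\<integral>\<^sup>+y. g (x'(n := y)) \<partial>lborel)
        \<le> (\<integral>\<^sup>+y. h (?m(n := y)) \<partial>lborel)\<^sup>2"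
    proof (rule prekopa_leindler_line)
      fix y y'
      have mid: "(\<lambda>i\<in>{..<Suc n}. ((x(n := y)) i + (x'(n := y')) i) / 2) = ?m(n := (y + y') / 2)"
        by (auto simp: restrict_def fun_eq_iff)
      have mem: "x(n := y) \<in> Rn (Suc n)" "x'(n := y') \<in> Rn (Suc n)"
        using x by (auto simp: PiE_iff extensional_def)
      show "f (x(n := y)) * g (x'(n := y')) \<le> (h (?m(n := (y + y') / 2)))\<^sup>2"
        using Suc.prems(4)[OF mem] unfolding mid .
    qed (rule sect, rule Suc.prems, use x in \<open>simp add: PiE_iff extensional_def\<close>)+
  qed
  thus ?case by (simp add: nn_integral_lborel_Suc Suc.prems)
qed

section \<open>Moment generating functions\<close>

lemma exp_quadratic_lower: "1 + x + x\<^sup>2 / 2 \<le> exp x" if "0 \<le> x" for x :: real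
  using exp_lower_Taylor_quadratic[OF that] by simp

text \<open>
  The expression \<open>exp x + exp (- x) - 2\<close> is the square of \<open>exp (x / 2) - exp (- x / 2)\<close>, whose absolute
  value is at least \<open>\<bar>x\<bar>\<close>.
\<close>

lemma exp_symmetric_lower: "2 + x\<^sup>2 \<le> exp x + exp (- x)" for x :: real
proof -
  have pos: "2 * y \<le> exp y - exp (- y)" if y: "0 \<le> y" for y :: real
  proof -
    define p q where "p = 1 + y + y\<^sup>2 / 2" and "q = 1 - y + y\<^sup>2 / 2"
    have p: "0 < p" "p \<le> exp y" using y exp_quadratic_lower[OF y] by (auto simp: p_def add_pos_nonneg)
    have "p * q = 1 + (y\<^sup>2)\<^sup>2 / 4" unfolding p_def q_def by (simp add: algebra_simps power2_eq_square)
    hence "1 \<le> p * q" by simp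
    hence "1 / p \<le> q" using p by (simp add: field_simps)
    moreover have "exp (- y) \<le> 1 / p" using p by (simp add: exp_minus field_simps)
    ultimately show ?thesis using p unfolding p_def q_def by simp
  qed
  define y where "y = \<bar>x\<bar> / 2"
  have "(2 * y)\<^sup>2 \<le> (exp y - exp (- y))\<^sup>2"
    by (intro power_mono pos) (auto simp: y_def)
  also have "\<dots> = exp (2 * y) + exp (- (2 * y)) - 2"
    by (simp add: algebra_simps power2_eq_square flip: exp_add)
  also have "exp (2 * y) + exp (- (2 * y)) = exp x + exp (- x)" by (auto simp: y_def abs_if)
  finally show ?thesis by (simp add: y_def)
qed

lemma abs_exp_minus_one_le: "\<bar>exp z - 1\<bar> \<le> \<bar>z\<bar> * exp \<bar>z\<bar>" for z :: real
proof (cases "0 \<le> z")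
  case True
  have "(1 - z) * exp z \<le> exp (- z) * exp z"
    using exp_ge_add_one_self[of "- z"] by (intro mult_right_mono) auto
  hence "exp z - 1 \<le> z * exp z" by (simp add: algebra_simps flip: exp_add)
  thus ?thesis using True by simp
next
  case False
  have "1 - exp z \<le> - z" using exp_ge_add_one_self[of z] by linarith
  also have "\<dots> \<le> - z * exp (- z)" using False by (intro mult_le_cancel_left1[THEN iffD2]) auto
  finally show ?thesis using False by simp
qed

lemma abs_power_exp_bound:
  fixes y s :: real
  assumes "m \<le> 2"
  shows "\<bar>y\<bar> ^ m * exp \<bar>y\<bar> * exp (s * y) \<le> 2 * (exp ((s + 2) * y) + exp ((s - 2) * y))"
proof -
  have "\<bar>y\<bar> ^ m \<le> 2 * exp \<bar>y\<bar>"
  proof -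
    define w where "w = \<bar>y\<bar>"
    have w: "0 \<le> w" "0 \<le> w\<^sup>2" "1 + w + w\<^sup>2 / 2 \<le> exp w"
      using exp_quadratic_lower[of w] by (simp_all add: w_def)
    from assms consider "m = 0" | "m = 1" | "m = 2" by linarith
    hence "w ^ m \<le> 2 * exp w"
    proof cases
      case 1
      show ?thesis unfolding 1 power_0 using w by linarith
    next
      case 2
      show ?thesis unfolding 2 power_one_right using w by linarith
    next
      case 3
      show ?thesis unfolding 3 using w by linarith
    qed
    thus ?thesis unfolding w_def .
  qed
  hence "\<bar>y\<bar> ^ m * (exp \<bar>y\<bar> * exp (s * y)) \<le> 2 * exp \<bar>y\<bar> * (exp \<bar>y\<bar> * exp (s * y))"
    by (intro mult_right_mono) auto
  also have "\<dots> = 2 * exp (2 * \<bar>y\<bar> + s * y)" by (simp flip: exp_add)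
  also have "exp (2 * \<bar>y\<bar> + s * y) \<le> exp ((s + 2) * y) + exp ((s - 2) * y)"
    by (cases "0 \<le> y") (simp_all add: algebra_simps)
  finally show ?thesis by (simp add: mult.assoc)
qed

lemma mgf_moment_integrable:
  fixes Y :: "'a \<Rightarrow> real"
  assumes [measurable]: "Y \<in> borel_measurable M" and int: "\<And>s. integrable M (\<lambda>x. exp (s * Y x))"
    and m: "m \<le> 2"
  shows "integrable M (\<lambda>x. Y x ^ m * exp (s * Y x))"
proof (rule Bochner_Integration.integrable_bound)
  show "integrable M (\<lambda>x. 2 * (exp ((s + 2) * Y x) + exp ((s - 2) * Y x)))" using int by simp
  show "AE x in M. norm (Y x ^ m * exp (s * Y x)) \<le> norm (2 * (exp ((s + 2) * Y x) + exp ((s - 2) * Y x)))"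
  proof (intro always_eventually allI)
    fix x
    have "\<bar>Y x\<bar> ^ m * 1 * exp (s * Y x) \<le> \<bar>Y x\<bar> ^ m * exp \<bar>Y x\<bar> * exp (s * Y x)"
      by (intro mult_right_mono mult_left_mono) auto
    with abs_power_exp_bound[OF m, of "Y x" s]
    show "norm (Y x ^ m * exp (s * Y x)) \<le> norm (2 * (exp ((s + 2) * Y x) + exp ((s - 2) * Y x)))"
      by (simp add: abs_mult power_abs)
  qed
qed measurable

text \<open>
  Differentiation under the integral sign: once the increment is at most 1 in absolute value, the
  difference quotients are dominated by the right-hand side of \<open>abs_power_exp_bound\<close>.
\<close>

lemma mgf_moment_has_derivative:
  fixes Y :: "'a \<Rightarrow> real"
  assumes [measurable]: "Y \<in> borel_measurable M" and int: "\<And>s. integrable M (\<lambda>x. exp (s * Y x))"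
    and k: "k \<le> 1"
  shows "((\<lambda>s. \<integral>x. Y x ^ k * exp (s * Y x) \<partial>M) has_real_derivative
      (\<integral>x. Y x ^ Suc k * exp (s * Y x) \<partial>M)) (at s)"
  unfolding DERIV_def tendsto_at_iff_sequentially
proof (intro allI impI, unfold comp_def)
  fix X :: "nat \<Rightarrow> real"
  assume X0: "\<forall>i. X i \<in> UNIV - {0}" and X: "X \<longlonglongrightarrow> 0"
  hence X0: "X i \<noteq> 0" for i by auto
  from X have "eventually (\<lambda>i. \<bar>X i\<bar> < 1) sequentially"
    using tendsto_rabs[OF X] by (auto dest: order_tendstoD(2)[where a = 1])
  then obtain N where N: "\<And>i. N \<le> i \<Longrightarrow> \<bar>X i\<bar> < 1" by (auto simp: eventually_sequentially)
  define q where "q i x = Y x ^ k * exp (s * Y x) * ((exp (X (i + N) * Y x) - 1) / X (i + N))" for i x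
  have "(\<lambda>i. \<integral>x. q i x \<partial>M) \<longlonglongrightarrow> (\<integral>x. Y x ^ Suc k * exp (s * Y x) \<partial>M)"
  proof (rule integral_dominated_convergence)
    show "integrable M (\<lambda>x. 2 * (exp ((s + 2) * Y x) + exp ((s - 2) * Y x)))" using int by simp
    show "AE x in M. (\<lambda>i. q i x) \<longlonglongrightarrow> Y x ^ Suc k * exp (s * Y x)"
    proof (intro always_eventually allI)
      fix x
      have "((\<lambda>u. exp (u * Y x)) has_real_derivative exp (0 * Y x) * Y x) (at 0)"
        by (auto intro!: derivative_eq_intros)
      hence "((\<lambda>h. (exp (h * Y x) - 1) / h) \<longlongrightarrow> Y x) (at 0)"
        by (simp add: has_field_derivative_iff)
      hence "(\<lambda>i. (exp (X (i + N) * Y x) - 1) / X (i + N)) \<longlonglongrightarrow> Y x"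
        using X0 LIMSEQ_ignore_initial_segment[OF X, of N]
        unfolding tendsto_at_iff_sequentially by (auto simp: comp_def)
      hence "(\<lambda>i. q i x) \<longlonglongrightarrow> Y x ^ k * exp (s * Y x) * Y x"
        unfolding q_def by (intro tendsto_mult tendsto_const)
      thus "(\<lambda>i. q i x) \<longlonglongrightarrow> Y x ^ Suc k * exp (s * Y x)" by (simp add: ac_simps)
    qed
    fix i
    show "AE x in M. norm (q i x) \<le> 2 * (exp ((s + 2) * Y x) + exp ((s - 2) * Y x))"
    proof (intro always_eventually allI)
      fix x
      have X1: "\<bar>X (i + N)\<bar> \<le> 1" using N[of "i + N"] by simp
      have "\<bar>(exp (X (i + N) * Y x) - 1) / X (i + N)\<bar> \<le> \<bar>Y x\<bar> * exp \<bar>X (i + N) * Y x\<bar>"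
        using abs_exp_minus_one_le[of "X (i + N) * Y x"] X0[of "i + N"]
        by (simp add: abs_mult field_simps)
      also have "\<dots> \<le> \<bar>Y x\<bar> * exp \<bar>Y x\<bar>"
        using mult_right_mono[OF X1, of "\<bar>Y x\<bar>"] by (intro mult_left_mono) (auto simp: abs_mult)
      finally have "\<bar>Y x\<bar> ^ k * exp (s * Y x) * \<bar>(exp (X (i + N) * Y x) - 1) / X (i + N)\<bar> \<le>
          \<bar>Y x\<bar> ^ k * exp (s * Y x) * (\<bar>Y x\<bar> * exp \<bar>Y x\<bar>)"
        by (intro mult_left_mono) auto
      also have "\<dots> = \<bar>Y x\<bar> ^ Suc k * exp \<bar>Y x\<bar> * exp (s * Y x)" by (simp add: ac_simps)
      also have "\<dots> \<le> 2 * (exp ((s + 2) * Y x) + exp ((s - 2) * Y x))"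
        using k by (intro abs_power_exp_bound) auto
      finally show "norm (q i x) \<le> 2 * (exp ((s + 2) * Y x) + exp ((s - 2) * Y x))"
        unfolding q_def by (simp add: abs_mult power_abs)
    qed
  qed (simp_all add: q_def)
  moreover have "(\<integral>x. q i x \<partial>M) =
      ((\<integral>x. Y x ^ k * exp ((s + X (i + N)) * Y x) \<partial>M) - (\<integral>x. Y x ^ k * exp (s * Y x) \<partial>M)) / X (i + N)" for i
  proof -
    have "(\<integral>x. q i x \<partial>M) =
        (\<integral>x. (Y x ^ k * exp ((s + X (i + N)) * Y x) - Y x ^ k * exp (s * Y x)) / X (i + N) \<partial>M)"
      unfolding q_def by (intro Bochner_Integration.integral_cong refl)
        (simp add: exp_add algebra_simps diff_divide_distrib)
    also have "\<dots> = (\<integral>x. Y x ^ k * exp ((s + X (i + N)) * Y x) - Y x ^ k * exp (s * Y x) \<partial>M) / X (i + N)"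
      by simp
    also have "\<dots> = ((\<integral>x. Y x ^ k * exp ((s + X (i + N)) * Y x) \<partial>M) - (\<integral>x. Y x ^ k * exp (s * Y x) \<partial>M)) / X (i + N)"
      using k by (subst Bochner_Integration.integral_diff) (auto intro!: mgf_moment_integrable int)
    finally show ?thesis .
  qed
  ultimately have "(\<lambda>i. ((\<integral>x. Y x ^ k * exp ((s + X (i + N)) * Y x) \<partial>M) -
      (\<integral>x. Y x ^ k * exp (s * Y x) \<partial>M)) / X (i + N)) \<longlonglongrightarrow> (\<integral>x. Y x ^ Suc k * exp (s * Y x) \<partial>M)"
    by simp
  thus "(\<lambda>i. ((\<integral>x. Y x ^ k * exp ((s + X i) * Y x) \<partial>M) -
      (\<integral>x. Y x ^ k * exp (s * Y x) \<partial>M)) / X i) \<longlonglongrightarrow> (\<integral>x. Y x ^ Suc k * exp (s * Y x) \<partial>M)"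
    by (rule LIMSEQ_offset)
qed

text \<open>
  The second derivative at \<open>s\<close> of the logarithm of the moment generating function is the variance of
  \<open>Y\<close> under the measure reweighted by \<open>exp (s * Y)\<close>.  The hypothesis says that it is at most \<open>c\<close>, so the
  claim is a second-order Taylor bound on the interval from 0 to 1.
\<close>

lemma (in prob_space) mgf_le_of_tilted_variance_le:
  fixes Y :: "'a \<Rightarrow> real"
  assumes [measurable]: "Y \<in> borel_measurable M" and int: "\<And>s. integrable M (\<lambda>x. exp (s * Y x))"
    and var: "\<And>s. (\<integral>x. (Y x)\<^sup>2 * exp (s * Y x) \<partial>M) * (\<integral>x. exp (s * Y x) \<partial>M)
        - (\<integral>x. Y x * exp (s * Y x) \<partial>M)\<^sup>2 \<le> c * (\<integral>x. exp (s * Y x) \<partial>M)\<^sup>2"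
  shows "(\<integral>x. exp (Y x) \<partial>M) \<le> exp ((\<integral>x. Y x \<partial>M) + c / 2)"
proof -
  define M0 where "M0 s = (\<integral>x. exp (s * Y x) \<partial>M)" for s
  define M1 where "M1 s = (\<integral>x. Y x * exp (s * Y x) \<partial>M)" for s
  define M2 where "M2 s = (\<integral>x. (Y x)\<^sup>2 * exp (s * Y x) \<partial>M)" for s
  have pos: "0 < M0 s" for s
  proof -
    have "(\<integral>x. exp (s * Y x) \<partial>M) \<noteq> 0"
      using integral_nonneg_eq_0_iff_AE[OF int[of s]] emeasure_space_1 by (auto simp: AE_False)
    moreover have "0 \<le> (\<integral>x. exp (s * Y x) \<partial>M)"
      by (intro Bochner_Integration.integral_nonneg) simp
    ultimately show ?thesis unfolding M0_def by linarith
  qed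
  have D0: "(M0 has_real_derivative M1 s) (at s)" for s
    using mgf_moment_has_derivative[OF assms(1) int, of 0 s] by (simp add: M0_def[abs_def] M1_def)
  have D1: "(M1 has_real_derivative M2 s) (at s)" for s
    using mgf_moment_has_derivative[OF assms(1) int, of 1 s]
    by (simp add: M1_def[abs_def] M2_def power2_eq_square)
  define \<phi> where "\<phi> s = M1 s / M0 s - M1 0 - c * s" for s
  have chi: "\<phi> s \<le> \<phi> 0" if "0 \<le> s" for s
  proof (rule DERIV_nonpos_imp_nonincreasing[OF that])
    fix u :: real
    have "(\<phi> has_real_derivative (M2 u * M0 u - M1 u * M1 u) / (M0 u * M0 u) - c) (at u)"
      unfolding \<phi>_def[abs_def] using pos[of u]
      by (auto intro!: derivative_eq_intros D0 D1)
    moreover have "(M2 u * M0 u - M1 u * M1 u) / (M0 u * M0 u) \<le> c"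
      using var[of u] pos[of u] by (simp add: M0_def M1_def M2_def power2_eq_square divide_le_eq)
    ultimately show "\<exists>y. (\<phi> has_real_derivative y) (at u) \<and> y \<le> 0" by (meson diff_le_0_iff_le)
  qed
  define \<psi> where "\<psi> s = ln (M0 s) - s * M1 0 - c * s\<^sup>2 / 2" for s
  have "\<psi> 1 \<le> \<psi> 0"
  proof (rule DERIV_nonpos_imp_nonincreasing[of 0 1 \<psi>])
    fix u :: real assume u: "0 \<le> u"
    have "(\<psi> has_real_derivative \<phi> u) (at u)"
      unfolding \<psi>_def[abs_def] \<phi>_def using pos[of u]
      by (auto intro!: derivative_eq_intros D0)
    moreover have "\<phi> u \<le> 0" using chi[OF u] by (simp add: \<phi>_def M0_def prob_space)
    ultimately show "\<exists>y. (\<psi> has_real_derivative y) (at u) \<and> y \<le> 0" by blast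
  qed simp
  hence "ln (M0 1) \<le> M1 0 + c / 2" by (simp add: \<psi>_def M0_def prob_space)
  hence "M0 1 \<le> exp (M1 0 + c / 2)" using pos[of 1] by (metis exp_le_cancel_iff exp_ln)
  thus ?thesis by (simp add: M0_def M1_def)
qed

lemma gaussian_mgf:
  fixes y :: real
  shows "(\<integral>\<^sup>+g. ennreal (std_normal_density g * exp (g * y)) \<partial>lborel) = ennreal (exp (y\<^sup>2 / 2))"
proof -
  have "std_normal_density g * exp (g * y) = exp (y\<^sup>2 / 2) * normal_density y 1 g" for g
  proof -
    have "exp (- (g\<^sup>2 / 2)) * exp (g * y) = exp (y\<^sup>2 / 2) * exp (- ((g - y)\<^sup>2 / 2))"
      by (simp add: power2_diff add_divide_distrib diff_divide_distrib algebra_simps flip: exp_add)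
    thus ?thesis by (simp add: normal_density_def)
  qed
  hence "(\<integral>\<^sup>+g. ennreal (std_normal_density g * exp (g * y)) \<partial>lborel) =
      (\<integral>\<^sup>+g. ennreal (exp (y\<^sup>2 / 2)) * ennreal (normal_density y 1 g) \<partial>lborel)"
    by (simp add: ennreal_mult)
  also have "\<dots> = ennreal (exp (y\<^sup>2 / 2)) * (\<integral>\<^sup>+g. ennreal (normal_density y 1 g) \<partial>lborel)"
    by (intro nn_integral_cmult) measurable
  also have "(\<integral>\<^sup>+g. ennreal (normal_density y 1 g) \<partial>lborel) = 1"
    using prob_space.emeasure_space_1[OF prob_space_normal_density[of 1 y]]
    by (simp add: emeasure_density)
  finally show ?thesis by simp
qed

text \<open>
  Up to scaling, \<open>exp (y\<^sup>2 / 4)\<close> is a moment generating function of the standard Gaussian at \<open>y\<close>.  After an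
  exchange of the two integrals the subgaussian bound applies to \<open>Y\<close> for each value of the Gaussian
  variable, and what remains is a Gaussian integral.
\<close>

lemma (in prob_space) exp_square_le_of_subgaussian:
  fixes Y :: "'a \<Rightarrow> real"
  assumes [measurable]: "Y \<in> borel_measurable M"
    and sub: "\<And>s. (\<integral>\<^sup>+x. ennreal (exp (s * Y x)) \<partial>M) \<le> ennreal (exp (s\<^sup>2 / 2))"
  shows "(\<integral>\<^sup>+x. ennreal (exp ((Y x)\<^sup>2 / 4)) \<partial>M) \<le> ennreal (sqrt 2)"
proof -
  have "(\<integral>\<^sup>+x. ennreal (exp ((Y x)\<^sup>2 / 4)) \<partial>M) =
      (\<integral>\<^sup>+x. \<integral>\<^sup>+g. ennreal (std_normal_density g * exp (g * (Y x / sqrt 2))) \<partial>lborel \<partial>M)"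
    by (subst gaussian_mgf) (simp add: power_divide)
  also have "\<dots> = (\<integral>\<^sup>+g. \<integral>\<^sup>+x. ennreal (std_normal_density g * exp (g * (Y x / sqrt 2))) \<partial>M \<partial>lborel)"
  proof -
    interpret P: pair_sigma_finite M lborel ..
    show ?thesis by (intro P.Fubini'[symmetric]) measurable
  qed
  also have "\<dots> \<le> (\<integral>\<^sup>+g. ennreal (sqrt 2) * ennreal (normal_density 0 (sqrt 2) g) \<partial>lborel)"
  proof (intro nn_integral_mono)
    fix g :: real
    have "(\<integral>\<^sup>+x. ennreal (std_normal_density g * exp (g * (Y x / sqrt 2))) \<partial>M) =
        ennreal (std_normal_density g) * (\<integral>\<^sup>+x. ennreal (exp (g / sqrt 2 * Y x)) \<partial>M)"
      by (subst nn_integral_cmult[symmetric]) (auto simp: ennreal_mult)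
    also have "\<dots> \<le> ennreal (std_normal_density g) * ennreal (exp ((g / sqrt 2)\<^sup>2 / 2))"
      by (intro mult_left_mono sub) simp
    also have "\<dots> = ennreal (sqrt 2) * ennreal (normal_density 0 (sqrt 2) g)"
    proof -
      have "exp (- (g\<^sup>2 / 2)) * exp (g\<^sup>2 / 4) = exp (- (g\<^sup>2 / 4))" by (simp flip: exp_add)
      moreover have "1 / sqrt 2 = sqrt 2 / 2" by (simp add: real_div_sqrt field_simps)
      hence "z / (sqrt 2 * sqrt pi) = sqrt 2 * z / (2 * sqrt pi)" for z
        by (simp add: field_simps)
      ultimately show ?thesis
        by (simp add: normal_density_def power_divide real_sqrt_mult flip: ennreal_mult)
    qed
    finally show "(\<integral>\<^sup>+x. ennreal (std_normal_density g * exp (g * (Y x / sqrt 2))) \<partial>M) \<le>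
        ennreal (sqrt 2) * ennreal (normal_density 0 (sqrt 2) g)" .
  qed
  also have "\<dots> = ennreal (sqrt 2) * (\<integral>\<^sup>+g. ennreal (normal_density 0 (sqrt 2) g) \<partial>lborel)"
    by (intro nn_integral_cmult) measurable
  also have "(\<integral>\<^sup>+g. ennreal (normal_density 0 (sqrt 2) g) \<partial>lborel) = 1"
    using prob_space.emeasure_space_1[OF prob_space_normal_density[of "sqrt 2" 0]]
    by (simp add: emeasure_density)
  finally show ?thesis by simp
qed

section \<open>Reweighted probability measures\<close>

text \<open>
  A tilt is determined by a weight up to a constant factor.  With the normalisation built in, constant
  factors drop out, successive tilts multiply the weights, and no logarithmic Laplace transform has to
  be tracked.
\<close>

definition reweight :: "'a measure \<Rightarrow> ('a \<Rightarrow> real) \<Rightarrow> 'a measure"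
  where "reweight M w = density M (\<lambda>x. ennreal (w x / (\<integral>y. w y \<partial>M)))"

lemma sets_reweight [simp]: "sets (reweight M w) = sets M"
  by (simp add: reweight_def)

lemma (in prob_space) integral_pos_of_pos:
  fixes w :: "'a \<Rightarrow> real"
  assumes int: "integrable M w" and pos: "\<And>x. 0 < w x"
  shows "0 < (\<integral>x. w x \<partial>M)"
proof -
  have "(\<integral>x. w x \<partial>M) \<noteq> 0"
  proof
    assume "(\<integral>x. w x \<partial>M) = 0"
    hence "AE x in M. w x = 0"
      using integral_nonneg_eq_0_iff_AE[OF int] pos by (auto intro: less_imp_le)
    hence "AE x in M. False" using pos by (auto simp: less_imp_neq[symmetric] elim!: eventually_mono)
    thus False using emeasure_space_1 by (auto simp: AE_False)
  qed
  moreover have "0 \<le> (\<integral>x. w x \<partial>M)"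
    by (intro Bochner_Integration.integral_nonneg) (auto intro: less_imp_le pos)
  ultimately show ?thesis by linarith
qed

context prob_space
begin

context
  fixes w :: "'a \<Rightarrow> real"
  assumes int: "integrable M w" and pos: "\<And>x. 0 < w x"
begin

lemma integrable_reweight_iff:
  fixes f :: "'a \<Rightarrow> real"
  assumes [measurable]: "f \<in> borel_measurable M"
  shows "integrable (reweight M w) f \<longleftrightarrow> integrable M (\<lambda>x. w x * f x)"
proof -
  have [measurable]: "w \<in> borel_measurable M" using int by auto
  note Z = integral_pos_of_pos[OF int pos]
  have "integrable (reweight M w) f \<longleftrightarrow> integrable M (\<lambda>x. w x / (\<integral>y. w y \<partial>M) * f x)"
    unfolding reweight_def using pos Z
    by (subst integrable_density) (auto intro!: less_imp_le)
  also have "\<dots> \<longleftrightarrow> integrable M (\<lambda>x. w x * f x)"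
  proof
    assume "integrable M (\<lambda>x. w x / (\<integral>y. w y \<partial>M) * f x)"
    hence "integrable M (\<lambda>x. (\<integral>y. w y \<partial>M) * (w x / (\<integral>y. w y \<partial>M) * f x))"
      by (rule integrable_mult_right)
    thus "integrable M (\<lambda>x. w x * f x)" using Z by simp
  next
    assume "integrable M (\<lambda>x. w x * f x)"
    hence "integrable M (\<lambda>x. 1 / (\<integral>y. w y \<partial>M) * (w x * f x))"
      by (rule integrable_mult_right)
    thus "integrable M (\<lambda>x. w x / (\<integral>y. w y \<partial>M) * f x)" by simp
  qed
  finally show ?thesis .
qed

lemma integral_reweight:
  fixes f :: "'a \<Rightarrow> real"
  assumes [measurable]: "f \<in> borel_measurable M"
  shows "(\<integral>x. f x \<partial>reweight M w) = (\<integral>x. w x * f x \<partial>M) / (\<integral>x. w x \<partial>M)"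
proof -
  have [measurable]: "w \<in> borel_measurable M" using int by auto
  note Z = integral_pos_of_pos[OF int pos]
  have "(\<integral>x. f x \<partial>reweight M w) = (\<integral>x. w x / (\<integral>y. w y \<partial>M) * f x \<partial>M)"
    unfolding reweight_def using pos Z
    by (subst integral_density) (auto intro!: less_imp_le)
  also have "\<dots> = (\<integral>x. w x * f x / (\<integral>y. w y \<partial>M) \<partial>M)"
    by simp
  finally show ?thesis by simp
qed

lemma prob_space_reweight: "prob_space (reweight M w)"
proof
  have [measurable]: "w \<in> borel_measurable M" using int by auto
  note Z = integral_pos_of_pos[OF int pos]
  have "emeasure (reweight M w) (space (reweight M w)) = (\<integral>\<^sup>+x. ennreal (w x / (\<integral>y. w y \<partial>M)) \<partial>M)"
    unfolding reweight_def by (simp add: emeasure_density cong: nn_integral_cong)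
  also have "\<dots> = ennreal (\<integral>x. w x / (\<integral>y. w y \<partial>M) \<partial>M)"
    using int pos Z by (intro nn_integral_eq_integral) (auto intro!: less_imp_le)
  also have "\<dots> = 1" using Z by simp
  finally show "emeasure (reweight M w) (space (reweight M w)) = 1" .
qed

lemma reweight_reweight:
  fixes u :: "'a \<Rightarrow> real"
  assumes [measurable]: "u \<in> borel_measurable M" and u: "\<And>x. 0 < u x"
  shows "reweight (reweight M w) u = reweight M (\<lambda>x. w x * u x)"
proof -
  have [measurable]: "w \<in> borel_measurable M" using int by auto
  note Z = integral_pos_of_pos[OF int pos]
  define I where "I = (\<integral>x. w x * u x \<partial>M)"
  have I: "0 \<le> I" unfolding I_def using pos u
    by (intro Bochner_Integration.integral_nonneg) (auto intro: less_imp_le)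
  have "reweight (reweight M w) u =
      density M (\<lambda>x. ennreal (w x / (\<integral>y. w y \<partial>M)) * ennreal (u x / (I / (\<integral>y. w y \<partial>M))))"
    unfolding reweight_def[of "reweight M w"] integral_reweight[OF assms(1)] I_def
    unfolding reweight_def by (intro density_density_eq) measurable
  also have "\<dots> = reweight M (\<lambda>x. w x * u x)"
    unfolding reweight_def I_def[symmetric]
  proof (intro arg_cong[where f = "density M"] ext)
    fix x
    have "w x / (\<integral>y. w y \<partial>M) * (u x / (I / (\<integral>y. w y \<partial>M))) = w x * u x / I"
      using Z by (simp add: field_simps)
    thus "ennreal (w x / (\<integral>y. w y \<partial>M)) * ennreal (u x / (I / (\<integral>y. w y \<partial>M))) = ennreal (w x * u x / I)"
      using Z I pos[of x] u[of x] by (subst ennreal_mult[symmetric]) auto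
  qed
  finally show ?thesis .
qed

end

end

lemma reweight_cmult:
  fixes w :: "'a \<Rightarrow> real"
  assumes "c \<noteq> 0"
  shows "reweight M (\<lambda>x. c * w x) = reweight M w"
  using assms by (simp add: reweight_def)

lemma reweight_distr:
  fixes w :: "'b \<Rightarrow> real"
  assumes [measurable]: "T \<in> measurable M N" "w \<in> borel_measurable N"
  shows "reweight (distr M N T) w = distr (reweight M (\<lambda>x. w (T x))) N T"
  unfolding reweight_def by (simp add: density_distr integral_distr)

section \<open>Linear functionals and covariances\<close>

text \<open>
  Vectors enter below through these functions only, so that sums and multiples of vectors can be formed
  as plain functions, whatever their values beyond the first \<open>n\<close> coordinates.
\<close>

lemma inner_n_restrict [simp]:
  "inner_n n (restrict f {..<n}) = inner_n n f" "inner_n n x (restrict f {..<n}) = inner_n n x f"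
  by (simp_all add: inner_n_def fun_eq_iff)

lemma norm_n_restrict [simp]: "norm_n n (restrict f {..<n}) = norm_n n f"
  by (simp add: L2_set_def)

lemma tilt_weight_restrict [simp]:
  "tilt_weight n t (restrict h {..<n}) = tilt_weight n t h"
  "tilt_weight n t h (restrict x {..<n}) = tilt_weight n t h x"
  by (simp_all add: tilt_weight_def fun_eq_iff)

lemma inner_n_add: "inner_n n (\<lambda>i. a i + b i) x = inner_n n a x + inner_n n b x"
  by (simp add: inner_n_def sum.distrib algebra_simps)

lemma inner_n_diff: "inner_n n (\<lambda>i. a i - b i) x = inner_n n a x - inner_n n b x"
  by (simp add: inner_n_def sum_subtractf algebra_simps)

lemma inner_n_scale: "inner_n n (\<lambda>i. c * a i) x = c * inner_n n a x"
  by (simp add: inner_n_def sum_distrib_left algebra_simps)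

lemma inner_n_commute: "inner_n n a x = inner_n n x a"
  by (simp add: inner_n_def mult.commute)

lemma norm_n_sq: "(norm_n n x)\<^sup>2 = (\<Sum>i<n. (x i)\<^sup>2)"
  by (simp add: L2_set_def sum_nonneg)

lemma norm_n_sq_inner: "(norm_n n x)\<^sup>2 = inner_n n x x"
  unfolding norm_n_sq inner_n_def by (simp add: power2_eq_square)

lemma abs_inner_n_le: "\<bar>inner_n n v x\<bar> \<le> norm_n n v * norm_n n x"
proof -
  have "\<bar>inner_n n v x\<bar> \<le> (\<Sum>i<n. \<bar>v i\<bar> * \<bar>x i\<bar>)"
    unfolding inner_n_def by (rule order_trans[OF sum_abs]) (simp add: abs_mult)
  also have "\<dots> \<le> norm_n n v * norm_n n x" by (rule L2_set_mult_ineq)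
  finally show ?thesis .
qed

lemma norm_n_scale: "norm_n n (\<lambda>i. c * x i) = \<bar>c\<bar> * norm_n n x"
  by (simp add: L2_set_def power_mult_distrib real_sqrt_mult flip: sum_distrib_left)

lemma borel_measurable_inner_n [measurable]: "inner_n n h \<in> borel_measurable (lborel_n n)"
  unfolding inner_n_def[abs_def] by measurable

lemma borel_measurable_norm_n [measurable]: "norm_n n \<in> borel_measurable (lborel_n n)"
  unfolding L2_set_def by measurable

lemma borel_measurable_tilt_weight [measurable]: "tilt_weight n t h \<in> borel_measurable (lborel_n n)"
  unfolding tilt_weight_def[abs_def] by measurable

lemma tilt_weight_pos: "0 < tilt_weight n t h x"
  by (simp add: tilt_weight_def)

text \<open>
  Finite exponential moments of all linear functionals pass to every tilt with \<open>t \<ge> 0\<close> and to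
  translates, and they make quadratic functions integrable.  All covariances in the argument are
  therefore genuine ones, not default values of a divergent integral.
\<close>

locale exp_moments = prob_space M for n :: nat and M :: "(nat \<Rightarrow> real) measure" +
  assumes sets_eq [measurable_cong]: "sets M = sets (lborel_n n)"
    and exp_int: "integrable M (\<lambda>x. exp (inner_n n h x))"
begin

lemma integrable_norm_sq: "integrable M (\<lambda>x. (norm_n n x)\<^sup>2)"
  unfolding norm_n_sq
proof (intro Bochner_Integration.integrable_sum)
  fix i assume i: "i \<in> {..<n}"
  define e where "e c j = (if j = i then c else 0 :: real)" for c j
  have e: "inner_n n (e c) x = c * x i" for c x
    using i by (simp add: inner_n_def e_def if_distrib[of "\<lambda>z. z * _"] sum.delta cong: if_cong)
  have [measurable]: "(\<lambda>x. x i) \<in> borel_measurable M" using i by measurable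
  show "integrable M (\<lambda>x. (x i)\<^sup>2)"
  proof (rule Bochner_Integration.integrable_bound)
    show "integrable M (\<lambda>x. exp (inner_n n (e 1) x) + exp (inner_n n (e (- 1)) x))"
      by (intro Bochner_Integration.integrable_add exp_int)
    have "(y :: real)\<^sup>2 \<le> exp y + exp (- y)" for y using exp_symmetric_lower[of y] by linarith
    thus "AE x in M. norm ((x i)\<^sup>2) \<le> norm (exp (inner_n n (e 1) x) + exp (inner_n n (e (- 1)) x))"
      by (simp add: e add_pos_pos[THEN less_imp_le])
  qed measurable
qed

lemma integrable_of_le_norm_sq:
  fixes f :: "_ \<Rightarrow> real"
  assumes "f \<in> borel_measurable M" and "\<And>x. \<bar>f x\<bar> \<le> c + d * (norm_n n x)\<^sup>2"
  shows "integrable M f"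
proof (rule Bochner_Integration.integrable_bound)
  show "integrable M (\<lambda>x. c + d * (norm_n n x)\<^sup>2)" using integrable_norm_sq by simp
  show "AE x in M. norm (f x) \<le> norm (c + d * (norm_n n x)\<^sup>2)"
    using assms(2) by (intro always_eventually allI) (simp add: order_trans[OF _ abs_ge_self])
qed fact

lemma integrable_norm: "integrable M (norm_n n)"
proof (rule integrable_of_le_norm_sq)
  fix x show "\<bar>norm_n n x\<bar> \<le> 1 + 1 * (norm_n n x)\<^sup>2"
  proof -
    have "0 \<le> norm_n n x" by (rule L2_set_nonneg)
    moreover have "2 * norm_n n x \<le> 1 + (norm_n n x)\<^sup>2"
      using sum_squares_bound[of 1 "norm_n n x"] by simp
    ultimately show ?thesis by linarith
  qed
qed measurable

lemma integrable_inner: "integrable M (inner_n n v)"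
proof (rule Bochner_Integration.integrable_bound)
  show "integrable M (\<lambda>x. norm_n n v * norm_n n x)" using integrable_norm by simp
  show "AE x in M. norm (inner_n n v x) \<le> norm (norm_n n v * norm_n n x)"
    using abs_inner_n_le by (simp add: abs_mult L2_set_nonneg)
qed measurable

lemma integrable_inner_sq: "integrable M (\<lambda>x. (inner_n n v x - c)\<^sup>2)"
proof (rule integrable_of_le_norm_sq)
  fix x
  have "(inner_n n v x)\<^sup>2 \<le> (norm_n n v * norm_n n x)\<^sup>2"
    using abs_inner_n_le[of n v x] by (metis abs_ge_zero power2_abs power_mono)
  moreover have "(inner_n n v x - c)\<^sup>2 \<le> 2 * (inner_n n v x)\<^sup>2 + 2 * c\<^sup>2"
    using zero_le_power2[of "inner_n n v x + c"] by (simp add: power2_sum power2_diff)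
  ultimately show "\<bar>(inner_n n v x - c)\<^sup>2\<bar> \<le> 2 * c\<^sup>2 + (2 * (norm_n n v)\<^sup>2) * (norm_n n x)\<^sup>2"
    by (simp add: power_mult_distrib)
qed measurable

lemma integrable_coord: "i < n \<Longrightarrow> integrable M (\<lambda>x. x i)"
proof (rule integrable_of_le_norm_sq)
  fix x assume i: "i < n"
  have "(x i)\<^sup>2 \<le> (norm_n n x)\<^sup>2" unfolding norm_n_sq using i
    by (intro member_le_sum) auto
  thus "\<bar>x i\<bar> \<le> 1 + 1 * (norm_n n x)\<^sup>2" using sum_squares_bound[of 1 "\<bar>x i\<bar>"] by simp
qed measurable

lemma integrable_coord_mult: "i < n \<Longrightarrow> j < n \<Longrightarrow> integrable M (\<lambda>x. x i * x j)"
proof (rule integrable_of_le_norm_sq)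
  fix x assume i: "i < n" "j < n"
  have "(x i)\<^sup>2 \<le> (norm_n n x)\<^sup>2" "(x j)\<^sup>2 \<le> (norm_n n x)\<^sup>2"
    unfolding norm_n_sq using i by (auto intro!: member_le_sum)
  thus "\<bar>x i * x j\<bar> \<le> 0 + 1 * (norm_n n x)\<^sup>2"
    using sum_squares_bound[of "\<bar>x i\<bar>" "\<bar>x j\<bar>"] by (simp add: abs_mult)
qed measurable

definition mean :: "nat \<Rightarrow> real"
  where "mean = (\<lambda>i\<in>{..<n}. \<integral>x. x i \<partial>M)"

lemma expectation_inner: "(\<integral>x. inner_n n v x \<partial>M) = inner_n n v mean"
  unfolding inner_n_def mean_def using integrable_coord by simp

lemma quadratic_form_cov_mat:
  "(\<Sum>i<n. \<Sum>j<n. v i * cov_mat M i j * v j) = variance (inner_n n v)"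
proof -
  define m where "m i = (\<integral>x. x i \<partial>M)" for i
  have int: "integrable M (\<lambda>x. (x i - m i) * (x j - m j))" if "i < n" "j < n" for i j
    using integrable_coord_mult[OF that] integrable_coord[OF that(1)] integrable_coord[OF that(2)]
    by (simp add: algebra_simps)
  have "(\<Sum>i<n. \<Sum>j<n. v i * cov_mat M i j * v j) =
      (\<Sum>i<n. \<Sum>j<n. \<integral>x. v i * v j * ((x i - m i) * (x j - m j)) \<partial>M)"
    unfolding cov_mat_def m_def[symmetric] by (simp add: ac_simps)
  also have "\<dots> = (\<integral>x. (\<Sum>i<n. \<Sum>j<n. v i * v j * ((x i - m i) * (x j - m j))) \<partial>M)"
  proof -
    have "(\<integral>x. (\<Sum>i<n. \<Sum>j<n. v i * v j * ((x i - m i) * (x j - m j))) \<partial>M) =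
        (\<Sum>i<n. \<integral>x. (\<Sum>j<n. v i * v j * ((x i - m i) * (x j - m j))) \<partial>M)"
      by (intro Bochner_Integration.integral_sum Bochner_Integration.integrable_sum
            integrable_mult_right int) auto
    also have "\<dots> = (\<Sum>i<n. \<Sum>j<n. \<integral>x. v i * v j * ((x i - m i) * (x j - m j)) \<partial>M)"
      by (intro sum.cong refl Bochner_Integration.integral_sum integrable_mult_right int) auto
    finally show ?thesis ..
  qed
  also have "\<dots> = (\<integral>x. (inner_n n v x - inner_n n v m)\<^sup>2 \<partial>M)"
  proof -
    have "inner_n n v x - inner_n n v m = (\<Sum>i<n. v i * (x i - m i))" for x
      by (simp add: inner_n_def right_diff_distrib sum_subtractf)
    thus ?thesis by (simp add: power2_eq_square sum_product ac_simps)
  qed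
  also have "inner_n n v m = (\<integral>x. inner_n n v x \<partial>M)"
    unfolding expectation_inner by (simp add: mean_def m_def[abs_def])
  finally show ?thesis .
qed

text \<open>
  All stability bounds are proved as bounds on variances of linear functionals.
\<close>

lemma loewner_le_cov_mat_iff:
  "loewner_le n (cov_mat M) (\<lambda>i j. b * id_mat i j) \<longleftrightarrow>
    (\<forall>v. variance (inner_n n v) \<le> b * (norm_n n v)\<^sup>2)"
proof -
  have sym: "b * id_mat i j - cov_mat M i j = b * id_mat j i - cov_mat M j i" for i j
    by (auto simp: id_mat_def cov_mat_def mult.commute)
  have "(\<Sum>i<n. \<Sum>j<n. v i * (b * id_mat i j - cov_mat M i j) * v j) =
      b * (norm_n n v)\<^sup>2 - variance (inner_n n v)" for v
  proof -
    have "(\<Sum>j<n. v i * (b * id_mat i j) * v j) = b * (v i)\<^sup>2" if "i < n" for i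
      using that by (simp add: id_mat_def if_distrib[of "\<lambda>z. z * _"] if_distrib[of "\<lambda>z. _ * z"]
        sum.delta' power2_eq_square cong: if_cong)
    hence "(\<Sum>i<n. \<Sum>j<n. v i * (b * id_mat i j) * v j) = b * (norm_n n v)\<^sup>2"
      by (simp add: norm_n_sq sum_distrib_left)
    thus ?thesis unfolding quadratic_form_cov_mat[symmetric]
      by (simp add: left_diff_distrib right_diff_distrib sum_subtractf)
  qed
  hence "loewner_le n (cov_mat M) (\<lambda>i j. b * id_mat i j) \<longleftrightarrow>
      (\<forall>v\<in>Rn n. variance (inner_n n v) \<le> b * (norm_n n v)\<^sup>2)"
    unfolding loewner_le_def psd_def using sym by auto
  also have "\<dots> \<longleftrightarrow> (\<forall>v. variance (inner_n n v) \<le> b * (norm_n n v)\<^sup>2)"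
  proof (intro iffI allI)
    fix v assume *: "\<forall>v\<in>Rn n. variance (inner_n n v) \<le> b * (norm_n n v)\<^sup>2"
    have "restrict v {..<n} \<in> Rn n" by simp
    from bspec[OF * this] show "variance (inner_n n v) \<le> b * (norm_n n v)\<^sup>2" by simp
  qed blast
  finally show ?thesis .
qed

lemma integrable_tilt_weight: "0 \<le> t \<Longrightarrow> integrable M (tilt_weight n t h)"
proof (rule Bochner_Integration.integrable_bound[OF exp_int[of h]])
  assume "0 \<le> t"
  thus "AE x in M. norm (tilt_weight n t h x) \<le> norm (exp (inner_n n h x))"
    by (simp add: tilt_weight_def)
qed measurable

lemma tilted_eq_reweight: "0 \<le> t \<Longrightarrow> tilted n M t h = reweight M (tilt_weight n t h)"
proof -
  assume "0 \<le> t"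
  hence "exp (log_laplace n M t h) = (\<integral>x. tilt_weight n t h x \<partial>M)"
    unfolding log_laplace_def
    by (intro exp_ln integral_pos_of_pos integrable_tilt_weight tilt_weight_pos)
  thus ?thesis
    unfolding tilted_def reweight_def tilt_weight_def[of n t h] by (simp only: exp_diff[of _ "log_laplace n M t h"])
qed

lemma exp_moments_tilted:
  assumes t: "0 \<le> t"
  shows "exp_moments n (tilted n M t h)"
proof -
  note rw = integrable_tilt_weight[OF t, of h] tilt_weight_pos[of n t h]
  interpret T: prob_space "reweight M (tilt_weight n t h)"
    by (rule prob_space_reweight[OF rw])
  show ?thesis
    unfolding tilted_eq_reweight[OF t]
  proof unfold_locales
    show "sets (reweight M (tilt_weight n t h)) = sets (lborel_n n)" by (simp add: sets_eq)
    fix k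
    have "integrable M (\<lambda>x. tilt_weight n t h x * exp (inner_n n k x))"
    proof (rule Bochner_Integration.integrable_bound[OF exp_int[of "\<lambda>i. h i + k i"]])
      show "AE x in M. norm (tilt_weight n t h x * exp (inner_n n k x))
          \<le> norm (exp (inner_n n (\<lambda>i. h i + k i) x))"
        using t by (simp add: tilt_weight_def inner_n_add flip: exp_add)
    qed measurable
    thus "integrable (reweight M (tilt_weight n t h)) (\<lambda>x. exp (inner_n n k x))"
      by (subst integrable_reweight_iff[OF rw]) auto
  qed
qed

end

lemma tilted_restrict: "tilted n \<mu> t (restrict h {..<n}) = tilted n \<mu> t h"
  by (simp add: tilted_def log_laplace_def)

section \<open>Variances under Gaussian tilts of log-concave measures\<close>

text \<open>
  After centring, both exponential moments \<open>E s\<close> and \<open>E (- s)\<close> are at least 1 by Jensen's inequality, so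
  their product is at least their sum minus 1, and the sum is at least \<open>2 + s\<^sup>2 * variance Y\<close>.
\<close>

lemma (in prob_space) variance_le_of_symmetrised_mgf_le:
  fixes Y :: "'a \<Rightarrow> real"
  assumes int: "integrable M Y" "integrable M (\<lambda>x. (Y x - expectation Y)\<^sup>2)"
    "integrable M (\<lambda>x. exp (s * Y x))" "integrable M (\<lambda>x. exp (- s * Y x))"
    and B: "(\<integral>x. exp (s * Y x) \<partial>M) * (\<integral>x. exp (- s * Y x) \<partial>M) \<le> B"
  shows "s\<^sup>2 * variance Y \<le> B - 1"
proof -
  define m where "m = expectation Y"
  define E where "E r = (\<integral>x. exp (r * (Y x - m)) \<partial>M)" for r
  have eq: "exp (r * (Y x - m)) = exp (- r * m) * exp (r * Y x)" for r x
    by (simp add: algebra_simps flip: exp_add)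
  have intE: "integrable M (\<lambda>x. exp (r * (Y x - m)))" if "r = s \<or> r = - s" for r
    unfolding eq using that int(3,4) by auto
  have E: "E r = exp (- r * m) * (\<integral>x. exp (r * Y x) \<partial>M)" for r
    unfolding E_def eq by simp
  have ge1: "1 \<le> E r" if "r = s \<or> r = - s" for r
  proof -
    have "(\<integral>x. 1 + r * (Y x - m) \<partial>M) \<le> E r"
      unfolding E_def using int(1) intE[OF that]
      by (intro integral_mono) (auto intro: exp_ge_add_one_self)
    also have "(\<integral>x. 1 + r * (Y x - m) \<partial>M) = 1" using int(1) by (simp add: m_def prob_space)
    finally show ?thesis .
  qed
  have "(\<integral>x. 2 + s\<^sup>2 * (Y x - m)\<^sup>2 \<partial>M) \<le> (\<integral>x. exp (s * (Y x - m)) + exp (- s * (Y x - m)) \<partial>M)"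
  proof (intro integral_mono)
    show "2 + s\<^sup>2 * (Y x - m)\<^sup>2 \<le> exp (s * (Y x - m)) + exp (- s * (Y x - m))" for x
      using exp_symmetric_lower[of "s * (Y x - m)"] by (simp add: power_mult_distrib)
    show "integrable M (\<lambda>x. exp (s * (Y x - m)) + exp (- s * (Y x - m)))"
      by (intro Bochner_Integration.integrable_add intE) simp_all
  qed (use int(2) in \<open>simp add: m_def[symmetric]\<close>)
  also have "\<dots> = E s + E (- s)" unfolding E_def
    by (intro Bochner_Integration.integral_add intE) simp_all
  also have "(\<integral>x. 2 + s\<^sup>2 * (Y x - m)\<^sup>2 \<partial>M) = 2 + s\<^sup>2 * variance Y"
    using int(2) by (simp add: m_def prob_space)
  finally have "2 + s\<^sup>2 * variance Y \<le> E s + E (- s)" .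
  moreover have "0 \<le> (E s - 1) * (E (- s) - 1)" using ge1 by simp
  moreover have "E s * E (- s) = (\<integral>x. exp (s * Y x) \<partial>M) * (\<integral>x. exp (- s * Y x) \<partial>M)"
    unfolding E by (simp add: exp_minus)
  ultimately show ?thesis using B by (simp add: algebra_simps)
qed

lemma exp_neg_nonneg [simp]: "0 \<le> exp_neg v"
  by (simp add: exp_neg_def)

lemma borel_measurable_exp_neg [measurable]: "exp_neg \<in> borel_measurable borel"
  unfolding exp_neg_def[abs_def] by measurable

lemma exp_neg_add: "v \<noteq> -\<infinity> \<Longrightarrow> exp_neg (v + ereal r) = exp_neg v * exp (- r)"
  by (cases v) (auto simp: exp_neg_def exp_diff exp_minus field_simps)

lemma exp_neg_midpoint:
  assumes V: "convex_fun_n n V" and x: "x \<in> Rn n" and y: "y \<in> Rn n"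
  shows "exp_neg (V x) * exp_neg (V y) \<le> (exp_neg (V (\<lambda>i\<in>{..<n}. (x i + y i) / 2)))\<^sup>2"
proof (cases "V x = \<infinity> \<or> V y = \<infinity>")
  case True
  thus ?thesis by (auto simp: exp_neg_def)
next
  case False
  let ?m = "\<lambda>i\<in>{..<n}. (x i + y i) / 2"
  have m: "?m \<in> Rn n" by simp
  have "V x \<noteq> -\<infinity>" "V y \<noteq> -\<infinity>" using V x y unfolding convex_fun_n_def by simp_all
  moreover have "V x \<noteq> \<infinity>" "V y \<noteq> \<infinity>" using False by simp_all
  moreover have "v = ereal (real_of_ereal v)" if "v \<noteq> -\<infinity>" "v \<noteq> \<infinity>" for v
    using that by (cases v) auto
  ultimately have ab: "V x = ereal (real_of_ereal (V x))" "V y = ereal (real_of_ereal (V y))"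
    by blast+
  define a b where "a = real_of_ereal (V x)" and "b = real_of_ereal (V y)"
  note ab = ab[folded a_def b_def]
  have mid: "(\<lambda>i\<in>{..<n}. 1/2 * x i + (1 - 1/2) * y i) = ?m" by (auto simp: fun_eq_iff restrict_def)
  have "(1/2 :: real) \<in> {0<..<1}" by simp
  with V x y have "V (\<lambda>i\<in>{..<n}. 1/2 * x i + (1 - 1/2) * y i) \<le> ereal (1/2) * V x + ereal (1 - 1/2) * V y"
    unfolding convex_fun_n_def by blast
  hence "V ?m \<le> ereal (1/2) * V x + ereal (1 - 1/2) * V y" unfolding mid .
  moreover have "V ?m \<noteq> -\<infinity>" using V m unfolding convex_fun_n_def by blast
  ultimately obtain c where c: "V ?m = ereal c" "c \<le> a / 2 + b / 2"
    unfolding ab by (cases "V ?m") auto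
  show ?thesis unfolding ab c(1)
    using c(2) by (simp add: exp_neg_def power2_eq_square flip: exp_add)
qed

text \<open>
  The parallelogram law leaves a surplus of \<open>t / 4\<close> times the squared distance of \<open>x\<close> and \<open>y\<close>, which
  absorbs the linear term up to the last factor.  This is where the strong convexity of the Gaussian
  weight enters.
\<close>

lemma tilt_weight_midpoint:
  assumes t: "0 < t"
  shows "tilt_weight n t h x * exp (s * inner_n n v x) * (tilt_weight n t h y * exp (- s * inner_n n v y))
    \<le> (tilt_weight n t h (\<lambda>i\<in>{..<n}. (x i + y i) / 2))\<^sup>2 * exp (s\<^sup>2 * (norm_n n v)\<^sup>2 / t)"
proof -
  define m where "m = (\<lambda>i. (x i + y i) / 2)"
  have coord: "- (t / 2) * (p\<^sup>2 + q\<^sup>2) + s * c * (p - q) \<le> - t * ((p + q) / 2)\<^sup>2 + s\<^sup>2 * c\<^sup>2 / t" for p q c :: real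
  proof -
    have "0 \<le> (t * (p - q) / 2 - s * c)\<^sup>2 / t" using t by simp
    also have "\<dots> = t * (p - q)\<^sup>2 / 4 - s * c * (p - q) + s\<^sup>2 * c\<^sup>2 / t"
      using t by (simp add: power2_diff power2_eq_square field_simps)
    also have "t * (p - q)\<^sup>2 / 4 = t / 2 * (p\<^sup>2 + q\<^sup>2) - t * ((p + q) / 2)\<^sup>2"
      by (simp add: power2_diff power2_sum power2_eq_square field_simps)
    finally show ?thesis by simp
  qed
  have "- (t / 2) * ((norm_n n x)\<^sup>2 + (norm_n n y)\<^sup>2) + s * (inner_n n v x - inner_n n v y) =
      (\<Sum>i<n. - (t / 2) * ((x i)\<^sup>2 + (y i)\<^sup>2) + s * v i * (x i - y i))"
    by (simp add: norm_n_sq inner_n_def sum.distrib sum_subtractf sum_distrib_left sum_negf algebra_simps)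
  also have "\<dots> \<le> (\<Sum>i<n. - t * (m i)\<^sup>2 + s\<^sup>2 * (v i)\<^sup>2 / t)"
    unfolding m_def by (intro sum_mono coord)
  also have "\<dots> = - t * (norm_n n m)\<^sup>2 + s\<^sup>2 * (norm_n n v)\<^sup>2 / t"
    by (simp add: norm_n_sq sum.distrib sum_distrib_left sum_divide_distrib sum_negf sum_subtractf)
  finally have "- (t / 2) * ((norm_n n x)\<^sup>2 + (norm_n n y)\<^sup>2) + s * (inner_n n v x - inner_n n v y)
      \<le> - t * (norm_n n m)\<^sup>2 + s\<^sup>2 * (norm_n n v)\<^sup>2 / t" .
  moreover have "inner_n n h x + inner_n n h y = 2 * inner_n n h m"
    unfolding inner_n_def m_def sum_distrib_left sum.distrib[symmetric]
    by (intro sum.cong) (auto simp: field_simps)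
  ultimately show ?thesis
    unfolding m_def[symmetric] tilt_weight_restrict
    by (simp add: tilt_weight_def power2_eq_square algebra_simps flip: exp_add)
qed

text \<open>
  The Brascamp-Lieb inequality for linear functions, up to a constant factor.  By the
  Prekopa-Leindler inequality the exponential moments of \<open>s * inner_n n v\<close> and of its negative under
  the tilted measure have a product of at most \<open>exp (s\<^sup>2 * (norm_n n v)\<^sup>2 / t)\<close>, which controls the
  variance.
\<close>

lemma brascamp_lieb_linear:
  assumes lc: "log_concave n \<mu>" and em: "exp_moments n \<mu>" and t: "0 < t"
  shows "(\<integral>x. (inner_n n v x - (\<integral>y. inner_n n v y \<partial>tilted n \<mu> t h))\<^sup>2 \<partial>tilted n \<mu> t h)
    \<le> 2 * (norm_n n v)\<^sup>2 / t"
proof (cases "norm_n n v = 0")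
  case True
  hence "\<bar>inner_n n v x\<bar> \<le> 0" for x using abs_inner_n_le[of n v x] by simp
  hence "inner_n n v x = 0" for x using abs_le_zero_iff by blast
  thus ?thesis by (simp add: True)
next
  case False
  hence v: "0 < (norm_n n v)\<^sup>2" by simp
  interpret exp_moments n \<mu> by (rule em)
  have t0: "0 \<le> t" using t by simp
  interpret T: exp_moments n "tilted n \<mu> t h" by (rule exp_moments_tilted[OF t0])
  note rw = integrable_tilt_weight[OF t0, of h] tilt_weight_pos[of n t h]
  note teq = tilted_eq_reweight[OF t0, of h]
  obtain V where V: "convex_fun_n n V" and [measurable]: "V \<in> borel_measurable (lborel_n n)"
    and mu: "\<mu> = density (lborel_n n) (\<lambda>x. ennreal (exp_neg (V x)))"
    using lc unfolding log_concave_def by blast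
  \<comment> \<open>This choice makes the exponent in the bound for the product equal to 1.\<close>
  define s where "s = sqrt (t / (norm_n n v)\<^sup>2)"
  have s2: "s\<^sup>2 = t / (norm_n n v)\<^sup>2" using t v by (simp add: s_def)
  define F where "F r x = tilt_weight n t h x * exp (r * inner_n n v x)" for r x
  have [measurable]: "F r \<in> borel_measurable (lborel_n n)" for r unfolding F_def[abs_def] by measurable
  have intF: "integrable \<mu> (F r)" for r
  proof -
    have "integrable (tilted n \<mu> t h) (\<lambda>x. exp (inner_n n (\<lambda>i. r * v i) x))" by (rule T.exp_int)
    thus ?thesis unfolding teq inner_n_scale F_def[abs_def]
      by (subst (asm) integrable_reweight_iff[OF rw]) auto
  qed
  have nnF: "(\<integral>\<^sup>+x. ennreal (exp_neg (V x) * F r x) \<partial>lborel_n n) = ennreal (\<integral>x. F r x \<partial>\<mu>)" for r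
  proof -
    have pos: "0 \<le> F r x" for x unfolding F_def using tilt_weight_pos[of n t h x] by simp
    have "(\<integral>\<^sup>+x. ennreal (exp_neg (V x) * F r x) \<partial>lborel_n n) = (\<integral>\<^sup>+x. ennreal (F r x) \<partial>\<mu>)"
      unfolding mu by (subst nn_integral_density) (auto simp: ennreal_mult pos)
    also have "\<dots> = ennreal (\<integral>x. F r x \<partial>\<mu>)"
      by (intro nn_integral_eq_integral intF) (simp add: pos)
    finally show ?thesis .
  qed
  define Z where "Z = (\<integral>x. F 0 x \<partial>\<mu>)"
  have Z: "0 < Z" "Z = (\<integral>x. tilt_weight n t h x \<partial>\<mu>)"
    using integral_pos_of_pos[OF rw] by (simp_all add: Z_def F_def)
  define c where "c = exp (s\<^sup>2 * (norm_n n v)\<^sup>2 / t)"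
  have c: "c = exp 1" using t v by (simp add: c_def s2)
  have "(\<integral>\<^sup>+x. ennreal (exp_neg (V x) * F s x) \<partial>lborel_n n) *
      (\<integral>\<^sup>+x. ennreal (exp_neg (V x) * F (- s) x) \<partial>lborel_n n)
    \<le> (\<integral>\<^sup>+x. ennreal (sqrt c) * ennreal (exp_neg (V x) * F 0 x) \<partial>lborel_n n)\<^sup>2"
  proof (intro prekopa_leindler)
    fix x y assume xy: "x \<in> Rn n" "y \<in> Rn n"
    let ?m = "\<lambda>i\<in>{..<n}. (x i + y i) / 2"
    have "exp_neg (V x) * F s x * (exp_neg (V y) * F (- s) y) =
        exp_neg (V x) * exp_neg (V y) * (F s x * F (- s) y)" by (simp add: ac_simps)
    also have "\<dots> \<le> (exp_neg (V ?m))\<^sup>2 * ((F 0 ?m)\<^sup>2 * c)"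
    proof (rule mult_mono[OF exp_neg_midpoint[OF V xy]])
      show "F s x * F (- s) y \<le> (F 0 ?m)\<^sup>2 * c"
        using tilt_weight_midpoint[OF t, of n h x s v y] unfolding F_def c_def by simp
      show "0 \<le> F s x * F (- s) y"
        unfolding F_def by (simp add: less_imp_le[OF tilt_weight_pos])
    qed simp
    also have "\<dots> = (sqrt c * (exp_neg (V ?m) * F 0 ?m))\<^sup>2"
      by (simp add: power_mult_distrib c_def)
    finally show "ennreal (exp_neg (V x) * F s x) * ennreal (exp_neg (V y) * F (- s) y) \<le>
        (ennreal (sqrt c) * ennreal (exp_neg (V ?m) * F 0 ?m))\<^sup>2"
      by (simp add: ennreal_power F_def less_imp_le[OF tilt_weight_pos] c_def flip: ennreal_mult)
  qed measurable
  also have "(\<integral>\<^sup>+x. ennreal (sqrt c) * ennreal (exp_neg (V x) * F 0 x) \<partial>lborel_n n) = ennreal (sqrt c * Z)"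
    using Z by (subst nn_integral_cmult) (auto simp: nnF Z_def ennreal_mult c_def)
  finally have nn: "(\<integral>\<^sup>+x. ennreal (exp_neg (V x) * F s x) \<partial>lborel_n n) *
      (\<integral>\<^sup>+x. ennreal (exp_neg (V x) * F (- s) x) \<partial>lborel_n n) \<le> (ennreal (sqrt c * Z))\<^sup>2" .
  have "(\<integral>x. F s x \<partial>\<mu>) * (\<integral>x. F (- s) x \<partial>\<mu>) \<le> (sqrt c * Z)\<^sup>2"
  proof -
    have "0 \<le> (\<integral>x. F r x \<partial>\<mu>)" for r
      unfolding F_def by (intro Bochner_Integration.integral_nonneg) (simp add: less_imp_le[OF tilt_weight_pos])
    moreover have "0 \<le> sqrt c * Z" using Z by (simp add: c_def)
    ultimately show ?thesis
      using nn unfolding nnF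
      by (simp only: ennreal_power ennreal_mult[symmetric] ennreal_le_iff[OF zero_le_power])
  qed
  hence le: "(\<integral>x. F s x \<partial>\<mu>) / Z * ((\<integral>x. F (- s) x \<partial>\<mu>) / Z) \<le> c"
    using Z by (simp add: power_mult_distrib c_def power2_eq_square divide_le_eq ac_simps)
  have mgf: "(\<integral>x. exp (r * inner_n n v x) \<partial>tilted n \<mu> t h) = (\<integral>x. F r x \<partial>\<mu>) / Z" for r
    unfolding teq Z(2) F_def by (intro integral_reweight[OF rw]) measurable
  have "s\<^sup>2 * T.variance (inner_n n v) \<le> c - 1"
    using T.exp_int[of "\<lambda>i. s * v i"] T.exp_int[of "\<lambda>i. - s * v i"] le
    unfolding inner_n_scale
    by (intro T.variance_le_of_symmetrised_mgf_le T.integrable_inner T.integrable_inner_sq)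
       (simp_all only: mgf)
  also have "\<dots> \<le> 2" using c exp_le by simp
  finally show ?thesis using t v by (simp add: s2 field_simps)
qed

section \<open>Linear tilts and translates of tilt-stable measures\<close>

definition dir_var :: "nat \<Rightarrow> (nat \<Rightarrow> real) measure \<Rightarrow> (nat \<Rightarrow> real) \<Rightarrow> real"
  where "dir_var n M v = (\<integral>x. (inner_n n v x - (\<integral>y. inner_n n v y \<partial>M))\<^sup>2 \<partial>M)"

lemma tilt_weight_0: "tilt_weight n 0 h = (\<lambda>x. exp (inner_n n h x))"
  by (simp add: tilt_weight_def fun_eq_iff)

definition shift :: "nat \<Rightarrow> (nat \<Rightarrow> real) \<Rightarrow> (nat \<Rightarrow> real) measure \<Rightarrow> (nat \<Rightarrow> real) measure"
  where "shift n a M = distr M (lborel_n n) (\<lambda>x. \<lambda>i\<in>{..<n}. x i - a i)"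

lemma measurable_subtract_vector [measurable]:
  "(\<lambda>x. \<lambda>i\<in>{..<n}. x i - a i) \<in> measurable (lborel_n n) (lborel_n n)"
  by (intro measurable_restrict) measurable

lemma inner_n_subtract: "inner_n n k (\<lambda>i. x i - a i) = inner_n n k x - inner_n n k a"
  by (simp add: inner_n_def right_diff_distrib sum_subtractf)

context exp_moments
begin

lemma loewner_le_cov_tilted_iff:
  assumes "0 \<le> t"
  shows "loewner_le n (cov_mat (tilted n M t h)) (\<lambda>i j. b * id_mat i j) \<longleftrightarrow>
    (\<forall>v. dir_var n (tilted n M t h) v \<le> b * (norm_n n v)\<^sup>2)"
  unfolding exp_moments.loewner_le_cov_mat_iff[OF exp_moments_tilted[OF assms]] dir_var_def ..

lemma tilt_stable_iff:
  "tilt_stable n b M \<longleftrightarrow> 0 < b \<and> (\<forall>h v. dir_var n (tilted n M 0 h) v \<le> b\<^sup>2 * (norm_n n v)\<^sup>2)"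
proof -
  have "(\<forall>h\<in>Rn n. \<forall>v. dir_var n (tilted n M 0 h) v \<le> b\<^sup>2 * (norm_n n v)\<^sup>2) \<longleftrightarrow>
      (\<forall>h v. dir_var n (tilted n M 0 h) v \<le> b\<^sup>2 * (norm_n n v)\<^sup>2)"
  proof (intro iffI allI)
    fix h v assume *: "\<forall>h\<in>Rn n. \<forall>v. dir_var n (tilted n M 0 h) v \<le> b\<^sup>2 * (norm_n n v)\<^sup>2"
    have "restrict h {..<n} \<in> Rn n" by simp
    with * show "dir_var n (tilted n M 0 h) v \<le> b\<^sup>2 * (norm_n n v)\<^sup>2"
      unfolding tilted_restrict[symmetric, of n M 0 h] by blast
  qed blast
  thus ?thesis
    unfolding tilt_stable_def loewner_le_cov_tilted_iff[OF order_refl]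
    using integrable_tilt_weight[OF order_refl] by simp
qed

lemma strongly_tilt_stableI:
  assumes "0 < b" and "\<And>t h v. 0 \<le> t \<Longrightarrow> dir_var n (tilted n M t h) v \<le> b\<^sup>2 * (norm_n n v)\<^sup>2"
  shows "strongly_tilt_stable n b M"
  unfolding strongly_tilt_stable_def
  using assms integrable_tilt_weight by (simp add: loewner_le_cov_tilted_iff)

lemma tilted_tilted:
  assumes t: "0 \<le> t"
  shows "tilted n (tilted n M 0 h) t k = tilted n M t (\<lambda>i. h i + k i)"
proof -
  note rw = integrable_tilt_weight[OF order_refl, of h] tilt_weight_pos[of n 0 h]
  have "tilted n (tilted n M 0 h) t k = reweight (tilted n M 0 h) (tilt_weight n t k)"
    by (intro exp_moments.tilted_eq_reweight exp_moments_tilted t order_refl)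
  also have "\<dots> = reweight M (\<lambda>x. tilt_weight n 0 h x * tilt_weight n t k x)"
    unfolding tilted_eq_reweight[OF order_refl]
    by (intro reweight_reweight[OF rw] tilt_weight_pos) measurable
  also have "(\<lambda>x. tilt_weight n 0 h x * tilt_weight n t k x) = tilt_weight n t (\<lambda>i. h i + k i)"
    by (simp add: tilt_weight_def inner_n_add fun_eq_iff algebra_simps flip: exp_add)
  finally show ?thesis by (simp add: tilted_eq_reweight[OF t])
qed

lemma exp_moments_shift: "exp_moments n (shift n a M)"
proof -
  interpret S: prob_space "shift n a M"
    unfolding shift_def by (intro prob_space_distr) measurable
  show ?thesis
  proof unfold_locales
    fix h
    have "integrable M (\<lambda>x. exp (inner_n n h x) * exp (- inner_n n h a))"
      using exp_int[of h] by simp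
    thus "integrable (shift n a M) (\<lambda>x. exp (inner_n n h x))"
      unfolding shift_def by (subst integrable_distr_eq) (auto simp: inner_n_subtract exp_diff exp_minus field_simps)
  qed (simp add: shift_def)
qed

lemma integral_shift:
  fixes f :: "_ \<Rightarrow> real"
  assumes [measurable]: "f \<in> borel_measurable (lborel_n n)"
  shows "(\<integral>x. f x \<partial>shift n a M) = (\<integral>x. f (\<lambda>i\<in>{..<n}. x i - a i) \<partial>M)"
  unfolding shift_def by (intro integral_distr) measurable

lemma dir_var_shift: "dir_var n (shift n a M) v = dir_var n M v"
proof -
  have "(\<integral>x. inner_n n v x \<partial>shift n a M) = (\<integral>x. inner_n n v x \<partial>M) - inner_n n v a"
    using integrable_inner by (simp add: integral_shift inner_n_subtract prob_space)
  thus ?thesis unfolding dir_var_def by (simp add: integral_shift inner_n_subtract)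
qed

lemma mean_shift: "exp_moments.mean n (shift n a M) = (\<lambda>i\<in>{..<n}. mean i - a i)"
proof -
  interpret S: exp_moments n "shift n a M" by (rule exp_moments_shift)
  show ?thesis
    unfolding S.mean_def mean_def using integrable_coord
    by (auto simp: integral_shift prob_space fun_eq_iff restrict_def)
qed

text \<open>
  Completing the square: recentring the Gaussian weight amounts to a linear tilt and a constant factor.
\<close>

lemma tilted_shift:
  assumes t: "0 \<le> t"
  shows "tilted n (shift n a M) t k = shift n a (tilted n M t (\<lambda>i. k i + t * a i))"
proof -
  interpret S: exp_moments n "shift n a M" by (rule exp_moments_shift)
  define c where "c = exp (- inner_n n k a - t / 2 * (norm_n n a)\<^sup>2)"
  have w: "tilt_weight n t k (\<lambda>i. x i - a i) = c * tilt_weight n t (\<lambda>i. k i + t * a i) x" for x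
  proof -
    have sq: "(norm_n n (\<lambda>i. x i - a i))\<^sup>2 = (norm_n n x)\<^sup>2 - 2 * inner_n n a x + (norm_n n a)\<^sup>2"
      unfolding norm_n_sq_inner
      by (simp add: inner_n_subtract inner_n_diff inner_n_commute[of n x a])
    show ?thesis
      unfolding tilt_weight_def c_def sq
      by (simp add: inner_n_subtract inner_n_add inner_n_scale algebra_simps flip: exp_add)
  qed
  have "tilted n (shift n a M) t k = reweight (shift n a M) (tilt_weight n t k)"
    by (rule S.tilted_eq_reweight[OF t])
  also have "\<dots> = shift n a (reweight M (\<lambda>x. tilt_weight n t k (\<lambda>i\<in>{..<n}. x i - a i)))"
    unfolding shift_def by (rule reweight_distr) measurable
  also have "(\<lambda>x. tilt_weight n t k (\<lambda>i\<in>{..<n}. x i - a i)) = (\<lambda>x. c * tilt_weight n t (\<lambda>i. k i + t * a i) x)"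
    by (simp add: w)
  also have "reweight M \<dots> = tilted n M t (\<lambda>i. k i + t * a i)"
    by (simp add: reweight_cmult c_def tilted_eq_reweight[OF t])
  finally show ?thesis .
qed

lemma tilt_stable_tilted:
  assumes "tilt_stable n b M"
  shows "tilt_stable n b (tilted n M 0 h)"
proof -
  interpret T: exp_moments n "tilted n M 0 h" by (rule exp_moments_tilted) simp
  show ?thesis using assms unfolding tilt_stable_iff T.tilt_stable_iff by (simp add: tilted_tilted)
qed

lemma tilt_stable_shift:
  assumes "tilt_stable n b M"
  shows "tilt_stable n b (shift n a M)"
proof -
  interpret S: exp_moments n "shift n a M" by (rule exp_moments_shift)
  have "dir_var n (tilted n (shift n a M) 0 h) v = dir_var n (tilted n M 0 h) v" for h v
    by (simp add: tilted_shift exp_moments.dir_var_shift[OF exp_moments_tilted])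
  thus ?thesis using assms unfolding tilt_stable_iff S.tilt_stable_iff by simp
qed

text \<open>
  The linear tilts along \<open>v\<close> are exactly the reweightings whose variances govern the moment generating
  function of \<open>inner_n n v\<close>, so a tilt-stable measure has subgaussian linear functionals.
\<close>

lemma tilt_stable_mgf_le:
  assumes "tilt_stable n 1 M"
  shows "(\<integral>x. exp (inner_n n v x) \<partial>M) \<le> exp (inner_n n v mean + (norm_n n v)\<^sup>2 / 2)"
  unfolding expectation_inner[symmetric]
proof (rule mgf_le_of_tilted_variance_le)
  have scaled: "integrable M (\<lambda>x. exp (s * inner_n n v x))" for s
    using exp_int[of "\<lambda>i. s * v i"] by (simp add: inner_n_scale)
  thus "integrable M (\<lambda>x. exp (s * inner_n n v x))" for s .
  fix s
  define h where "h = (\<lambda>i. s * v i)"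
  have w: "tilt_weight n 0 h = (\<lambda>x. exp (s * inner_n n v x))"
    by (simp add: tilt_weight_0 h_def inner_n_scale)
  interpret T: exp_moments n "tilted n M 0 h" by (rule exp_moments_tilted) simp
  note rw = integrable_tilt_weight[OF order_refl, of h] tilt_weight_pos[of n 0 h]
  note teq = tilted_eq_reweight[OF order_refl, of h]
  define Z where "Z = (\<integral>x. exp (s * inner_n n v x) \<partial>M)"
  have Z: "0 < Z" using integral_pos_of_pos[OF rw] by (simp add: Z_def w)
  have ints: "(\<integral>x. f x \<partial>tilted n M 0 h) = (\<integral>x. f x * exp (s * inner_n n v x) \<partial>M) / Z"
    if "f \<in> borel_measurable M" for f :: "_ \<Rightarrow> real"
    unfolding teq integral_reweight[OF rw that] by (simp add: w Z_def mult.commute)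
  have "T.variance (inner_n n v) = T.expectation (\<lambda>x. (inner_n n v x)\<^sup>2) - (T.expectation (inner_n n v))\<^sup>2"
    using T.integrable_inner_sq[of v 0] by (intro T.variance_eq T.integrable_inner) simp
  moreover have "T.variance (inner_n n v) \<le> (norm_n n v)\<^sup>2"
    using assms unfolding tilt_stable_iff dir_var_def by simp
  ultimately have "(\<integral>x. (inner_n n v x)\<^sup>2 * exp (s * inner_n n v x) \<partial>M) / Z
      - ((\<integral>x. inner_n n v x * exp (s * inner_n n v x) \<partial>M) / Z)\<^sup>2 \<le> (norm_n n v)\<^sup>2"
    by (simp add: ints)
  hence "((\<integral>x. (inner_n n v x)\<^sup>2 * exp (s * inner_n n v x) \<partial>M) / Z
      - ((\<integral>x. inner_n n v x * exp (s * inner_n n v x) \<partial>M) / Z)\<^sup>2) * Z\<^sup>2 \<le> (norm_n n v)\<^sup>2 * Z\<^sup>2"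
    by (intro mult_right_mono) auto
  thus "(\<integral>x. (inner_n n v x)\<^sup>2 * exp (s * inner_n n v x) \<partial>M) * (\<integral>x. exp (s * inner_n n v x) \<partial>M)
      - (\<integral>x. inner_n n v x * exp (s * inner_n n v x) \<partial>M)\<^sup>2
      \<le> (norm_n n v)\<^sup>2 * (\<integral>x. exp (s * inner_n n v x) \<partial>M)\<^sup>2"
    unfolding Z_def[symmetric] using Z
    by (simp add: left_diff_distrib power_divide) (simp add: power2_eq_square)
qed measurable

lemma tilt_stable_exp_square_le:
  assumes ts: "tilt_stable n 1 M" and v: "norm_n n v \<le> 1"
  shows "(\<integral>\<^sup>+x. ennreal (exp ((inner_n n v x - inner_n n v mean)\<^sup>2 / 4)) \<partial>M) \<le> ennreal (sqrt 2)"
proof (rule exp_square_le_of_subgaussian)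
  fix s
  have eq: "exp (s * (inner_n n v x - inner_n n v mean)) =
      exp (- inner_n n (\<lambda>i. s * v i) mean) * exp (inner_n n (\<lambda>i. s * v i) x)" for x
    by (simp add: inner_n_scale algebra_simps flip: exp_add)
  have "(\<integral>\<^sup>+x. ennreal (exp (s * (inner_n n v x - inner_n n v mean))) \<partial>M) =
      ennreal (exp (- inner_n n (\<lambda>i. s * v i) mean) * (\<integral>x. exp (inner_n n (\<lambda>i. s * v i) x) \<partial>M))"
    unfolding eq using exp_int[of "\<lambda>i. s * v i"]
    by (subst nn_integral_eq_integral) simp_all
  also have "\<dots> \<le> ennreal (exp (- inner_n n (\<lambda>i. s * v i) mean) *
      exp (inner_n n (\<lambda>i. s * v i) mean + (norm_n n (\<lambda>i. s * v i))\<^sup>2 / 2))"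
    by (intro ennreal_leI mult_left_mono tilt_stable_mgf_le ts) simp
  also have "\<dots> = ennreal (exp (s\<^sup>2 * (norm_n n v)\<^sup>2 / 2))"
    by (simp add: norm_n_scale power_mult_distrib flip: exp_add)
  also have "\<dots> \<le> ennreal (exp (s\<^sup>2 / 2))"
  proof -
    have "(norm_n n v)\<^sup>2 \<le> 1" using v L2_set_nonneg[of v "{..<n}"] by (simp add: power_le_one)
    hence "s\<^sup>2 * (norm_n n v)\<^sup>2 \<le> s\<^sup>2 * 1" by (intro mult_left_mono) auto
    thus ?thesis by (simp add: ennreal_leI)
  qed
  finally show "(\<integral>\<^sup>+x. ennreal (exp (s * (inner_n n v x - inner_n n v mean))) \<partial>M) \<le> ennreal (exp (s\<^sup>2 / 2))" .
qed measurable

end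

lemma exp_moments_of_tilt_stable:
  assumes "log_concave n \<mu>" "tilt_stable n b \<mu>"
  shows "exp_moments n \<mu>"
proof -
  interpret prob_space \<mu> using assms(1) by (simp add: log_concave_def)
  show ?thesis
  proof unfold_locales
    show "sets \<mu> = sets (lborel_n n)" using assms(1) by (auto simp: log_concave_def)
    fix h
    have "restrict h {..<n} \<in> Rn n" by simp
    hence "integrable \<mu> (tilt_weight n 0 (restrict h {..<n}))"
      using assms(2) unfolding tilt_stable_def by blast
    thus "integrable \<mu> (\<lambda>x. exp (inner_n n h x))" by (simp add: tilt_weight_0)
  qed
qed

lemma convex_fun_n_add_affine:
  assumes "convex_fun_n n V"
  shows "convex_fun_n n (\<lambda>x. V x + ereal (c + inner_n n k x))"
  unfolding convex_fun_n_def
proof (intro conjI ballI)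
  fix x assume "x \<in> Rn n"
  with assms have "V x \<noteq> -\<infinity>" unfolding convex_fun_n_def by blast
  thus "V x + ereal (c + inner_n n k x) \<noteq> -\<infinity>" by (cases "V x") auto
next
  fix x y and u :: real
  assume x: "x \<in> Rn n" and y: "y \<in> Rn n" and u: "u \<in> {0<..<1}"
  let ?m = "\<lambda>i\<in>{..<n}. u * x i + (1 - u) * y i"
  have "V x \<noteq> -\<infinity>" "V y \<noteq> -\<infinity>" "V ?m \<le> ereal u * V x + ereal (1 - u) * V y"
    using assms x y u unfolding convex_fun_n_def by blast+
  moreover have "inner_n n k ?m = u * inner_n n k x + (1 - u) * inner_n n k y"
    unfolding inner_n_restrict
    unfolding inner_n_def sum_distrib_left sum.distrib[symmetric]
    by (intro sum.cong) (auto simp: algebra_simps)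
  ultimately show "V ?m + ereal (c + inner_n n k ?m) \<le>
      ereal u * (V x + ereal (c + inner_n n k x)) + ereal (1 - u) * (V y + ereal (c + inner_n n k y))"
    using u by (cases "V x"; cases "V y"; cases "V ?m") (auto simp: algebra_simps)
qed

lemma convex_fun_n_translate:
  assumes "convex_fun_n n V"
  shows "convex_fun_n n (\<lambda>x. V (\<lambda>i\<in>{..<n}. x i + a i))"
  unfolding convex_fun_n_def
proof (intro conjI ballI)
  fix x assume "x \<in> Rn n"
  have "(\<lambda>i\<in>{..<n}. x i + a i) \<in> Rn n" by simp
  with assms show "V (\<lambda>i\<in>{..<n}. x i + a i) \<noteq> -\<infinity>" unfolding convex_fun_n_def by blast
next
  fix x y and u :: real
  assume x: "x \<in> Rn n" and y: "y \<in> Rn n" and u: "u \<in> {0<..<1}"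
  let ?x = "\<lambda>i\<in>{..<n}. x i + a i" and ?y = "\<lambda>i\<in>{..<n}. y i + a i"
  have xy: "?x \<in> Rn n" "?y \<in> Rn n" by simp_all
  have "(\<lambda>i\<in>{..<n}. (\<lambda>i\<in>{..<n}. u * x i + (1 - u) * y i) i + a i) =
      (\<lambda>i\<in>{..<n}. u * ?x i + (1 - u) * ?y i)"
    by (auto simp: fun_eq_iff restrict_def algebra_simps)
  thus "V (\<lambda>i\<in>{..<n}. (\<lambda>i\<in>{..<n}. u * x i + (1 - u) * y i) i + a i) \<le> ereal u * V ?x + ereal (1 - u) * V ?y"
    using assms xy u unfolding convex_fun_n_def by presburger
qed

lemma log_concave_tilted:
  assumes lc: "log_concave n \<mu>" and em: "exp_moments n \<mu>"
  shows "log_concave n (tilted n \<mu> 0 h)"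
proof -
  interpret exp_moments n \<mu> by (rule em)
  interpret T: exp_moments n "tilted n \<mu> 0 h" by (rule exp_moments_tilted) simp
  obtain V where V: "convex_fun_n n V" and [measurable]: "V \<in> borel_measurable (lborel_n n)"
    and mu: "\<mu> = density (lborel_n n) (\<lambda>x. ennreal (exp_neg (V x)))"
    using lc unfolding log_concave_def by blast
  define L where "L = log_laplace n \<mu> 0 h"
  define W where "W x = V x + ereal (L + inner_n n (\<lambda>i. - h i) x)" for x
  have "convex_fun_n n W" unfolding W_def[abs_def] by (rule convex_fun_n_add_affine[OF V])
  moreover have "W \<in> borel_measurable (lborel_n n)" unfolding W_def[abs_def] by measurable
  moreover have "tilted n \<mu> 0 h = density (lborel_n n) (\<lambda>x. ennreal (exp_neg (W x)))"
  proof -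
    have "tilted n \<mu> 0 h = density \<mu> (\<lambda>x. ennreal (exp (inner_n n h x - L)))"
      by (simp add: tilted_def L_def)
    also have "\<dots> = density (lborel_n n)
        (\<lambda>x. ennreal (exp_neg (V x)) * ennreal (exp (inner_n n h x - L)))"
      unfolding mu by (rule density_density_eq) measurable
    also have "\<dots> = density (lborel_n n) (\<lambda>x. ennreal (exp_neg (W x)))"
    proof (rule density_cong)
      have "ennreal (exp_neg (V x)) * ennreal (exp (inner_n n h x - L)) = ennreal (exp_neg (W x))"
        if "x \<in> Rn n" for x
      proof -
        have "V x \<noteq> -\<infinity>" using V that unfolding convex_fun_n_def by blast
        moreover have "- (L + inner_n n (\<lambda>i. - h i) x) = inner_n n h x - L"
          by (simp add: inner_n_def sum_negf)
        ultimately show ?thesis by (simp add: W_def exp_neg_add ennreal_mult del: plus_ereal.simps)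
      qed
      thus "AE x in lborel_n n. ennreal (exp_neg (V x)) * ennreal (exp (inner_n n h x - L)) = ennreal (exp_neg (W x))"
        by (intro AE_I2) (simp add: space_PiM)
    qed (simp_all add: W_def[abs_def])
    finally show ?thesis .
  qed
  ultimately show ?thesis unfolding log_concave_def using T.prob_space_axioms by blast
qed

lemma lborel_n_translate: "distr (lborel_n n) (lborel_n n) (\<lambda>x. \<lambda>i\<in>{..<n}. x i - a i) = lborel_n n"
proof -
  interpret product_sigma_finite "\<lambda>_::nat. lborel :: real measure" by standard
  show ?thesis
  proof (rule PiM_eqI)
    fix A :: "nat \<Rightarrow> real set" assume A: "\<And>i. i \<in> {..<n} \<Longrightarrow> A i \<in> sets lborel"
    hence A': "A i \<in> sets borel" if "i < n" for i using that by simp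
    have PA: "Pi\<^sub>E {..<n} A \<in> sets (lborel_n n)" by (intro sets_PiM_I_finite) (simp_all add: A')
    have tr: "emeasure lborel ((\<lambda>y. y - c) -` B) = emeasure lborel B" "(\<lambda>y. y - c) -` B \<in> sets lborel"
      if "B \<in> sets lborel" for B :: "real set" and c
    proof -
      show m: "(\<lambda>y. y - c) -` B \<in> sets lborel"
        using measurable_sets[of "\<lambda>y. y - c" lborel lborel B] that by simp
      have "emeasure lborel B = emeasure (distr lborel borel ((+) (- c))) B"
        by (simp only: lborel_distr_plus)
      also have "\<dots> = emeasure lborel ((+) (- c) -` B)"
        using that by (subst emeasure_distr) auto
      also have "(+) (- c) -` B = (\<lambda>y. y - c) -` B" by auto
      finally show "emeasure lborel ((\<lambda>y. y - c) -` B) = emeasure lborel B" by simp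
    qed
    have "emeasure (distr (lborel_n n) (lborel_n n) (\<lambda>x. \<lambda>i\<in>{..<n}. x i - a i)) (Pi\<^sub>E {..<n} A) =
        emeasure (lborel_n n) ((\<lambda>x. \<lambda>i\<in>{..<n}. x i - a i) -` Pi\<^sub>E {..<n} A \<inter> space (lborel_n n))"
      by (rule emeasure_distr[OF measurable_subtract_vector PA])
    also have "(\<lambda>x. \<lambda>i\<in>{..<n}. x i - a i) -` Pi\<^sub>E {..<n} A \<inter> space (lborel_n n) =
        (\<Pi>\<^sub>E i\<in>{..<n}. (\<lambda>y. y - a i) -` A i)"
      by (auto simp: space_PiM PiE_iff)
    also have "emeasure (lborel_n n) \<dots> = (\<Prod>i<n. emeasure lborel ((\<lambda>y. y - a i) -` A i))"
      by (intro emeasure_PiM tr) (simp_all add: A')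
    also have "\<dots> = (\<Prod>i\<in>{..<n}. emeasure lborel (A i))"
      by (intro prod.cong refl tr) (simp add: A')
    finally show "emeasure (distr (lborel_n n) (lborel_n n) (\<lambda>x. \<lambda>i\<in>{..<n}. x i - a i)) (Pi\<^sub>E {..<n} A) =
        (\<Prod>i\<in>{..<n}. emeasure lborel (A i))" .
  qed simp_all
qed

lemma log_concave_shift:
  assumes lc: "log_concave n \<mu>" and em: "exp_moments n \<mu>"
  shows "log_concave n (shift n a \<mu>)"
proof -
  interpret exp_moments n \<mu> by (rule em)
  interpret S: exp_moments n "shift n a \<mu>" by (rule exp_moments_shift)
  obtain V where V: "convex_fun_n n V" and [measurable]: "V \<in> borel_measurable (lborel_n n)"
    and mu: "\<mu> = density (lborel_n n) (\<lambda>x. ennreal (exp_neg (V x)))"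
    using lc unfolding log_concave_def by blast
  define W where "W x = V (\<lambda>i\<in>{..<n}. x i + a i)" for x
  have [measurable]: "(\<lambda>x. \<lambda>i\<in>{..<n}. x i + a i) \<in> measurable (lborel_n n) (lborel_n n)"
    by (intro measurable_restrict) measurable
  have "convex_fun_n n W" unfolding W_def[abs_def] by (rule convex_fun_n_translate[OF V])
  moreover have [measurable]: "W \<in> borel_measurable (lborel_n n)" unfolding W_def[abs_def] by measurable
  moreover have "shift n a \<mu> = density (lborel_n n) (\<lambda>x. ennreal (exp_neg (W x)))"
  proof -
    have "\<mu> = density (lborel_n n) (\<lambda>x. ennreal (exp_neg (W (\<lambda>i\<in>{..<n}. x i - a i))))"
      unfolding mu
    proof (rule density_cong)
      have "(\<lambda>i\<in>{..<n}. (\<lambda>i\<in>{..<n}. x i - a i) i + a i) = x" if "x \<in> Rn n" for x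
        using that by (auto simp: fun_eq_iff restrict_def PiE_iff extensional_def)
      thus "AE x in lborel_n n. ennreal (exp_neg (V x)) = ennreal (exp_neg (W (\<lambda>i\<in>{..<n}. x i - a i)))"
        by (intro AE_I2) (simp add: space_PiM W_def)
    qed measurable
    hence "shift n a \<mu> = distr (density (lborel_n n) (\<lambda>x. ennreal (exp_neg (W (\<lambda>i\<in>{..<n}. x i - a i)))))
        (lborel_n n) (\<lambda>x. \<lambda>i\<in>{..<n}. x i - a i)"
      unfolding shift_def by simp
    also have "\<dots> = density (distr (lborel_n n) (lborel_n n) (\<lambda>x. \<lambda>i\<in>{..<n}. x i - a i))
        (\<lambda>x. ennreal (exp_neg (W x)))"
      by (intro density_distr[symmetric]) measurable
    finally show ?thesis by (simp only: lborel_n_translate)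
  qed
  ultimately show ?thesis unfolding log_concave_def using S.prob_space_axioms by blast
qed

section \<open>Concentration of the norm\<close>

definition unit_vec :: "nat \<Rightarrow> nat \<Rightarrow> real"
  where "unit_vec i j = (if j = i then 1 else 0)"

lemma inner_n_unit_vec: "i < n \<Longrightarrow> inner_n n (unit_vec i) x = x i"
  by (simp add: inner_n_def unit_vec_def if_distrib[of "\<lambda>z. z * _"] sum.delta cong: if_cong)

lemma norm_n_unit_vec: "i < n \<Longrightarrow> norm_n n (unit_vec i) = 1"
proof -
  assume i: "i < n"
  have "(norm_n n (unit_vec i))\<^sup>2 = 1"
    using inner_n_unit_vec[OF i] by (simp add: norm_n_sq_inner unit_vec_def)
  thus ?thesis by (simp add: power2_eq_1_iff) (metis L2_set_nonneg neg_0_le_iff_le not_one_le_zero)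
qed

lemma norm_n_triangle_diff: "\<bar>norm_n n x - norm_n n b\<bar> \<le> norm_n n (\<lambda>i. x i - b i)"
proof -
  have "norm_n n (\<lambda>i. (x i - b i) + b i) \<le> norm_n n (\<lambda>i. x i - b i) + norm_n n b"
    by (rule L2_set_triangle_ineq)
  moreover have "norm_n n (\<lambda>i. (- 1) * (x i - b i) + x i) \<le> norm_n n (\<lambda>i. (- 1) * (x i - b i)) + norm_n n x"
    by (rule L2_set_triangle_ineq)
  ultimately show ?thesis by (simp only: norm_n_scale) simp
qed

context exp_moments
begin

lemma tilted_0: "tilted n M 0 (\<lambda>_. 0) = M"
proof -
  have "tilt_weight n 0 (\<lambda>_. 0) = (\<lambda>_. 1)" by (simp add: tilt_weight_0 inner_n_def)
  thus ?thesis by (simp add: tilted_eq_reweight reweight_def prob_space density_1)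
qed

lemma tilt_stable_dir_var_le: "tilt_stable n b M \<Longrightarrow> dir_var n M v \<le> b\<^sup>2 * (norm_n n v)\<^sup>2"
  unfolding tilt_stable_iff by (metis tilted_0)

lemma integrable_coord_sq: "i < n \<Longrightarrow> integrable M (\<lambda>x. (x i - c)\<^sup>2)"
  using integrable_inner_sq[of "unit_vec i" c] by (simp add: inner_n_unit_vec)

lemma coord_variance_le:
  assumes "tilt_stable n 1 M" "i < n"
  shows "(\<integral>x. (x i - mean i)\<^sup>2 \<partial>M) \<le> 1"
  using tilt_stable_dir_var_le[OF assms(1), of "unit_vec i"] assms(2)
  by (simp add: dir_var_def inner_n_unit_vec norm_n_unit_vec mean_def)

lemma integral_sq_distance_le:
  assumes "tilt_stable n 1 M"
  shows "(\<integral>x. (norm_n n (\<lambda>i. x i - mean i))\<^sup>2 \<partial>M) \<le> n"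
proof -
  have "(\<integral>x. (norm_n n (\<lambda>i. x i - mean i))\<^sup>2 \<partial>M) = (\<Sum>i<n. \<integral>x. (x i - mean i)\<^sup>2 \<partial>M)"
    unfolding norm_n_sq by (intro Bochner_Integration.integral_sum integrable_coord_sq) simp
  also have "\<dots> \<le> (\<Sum>i<n. 1)" by (intro sum_mono coord_variance_le assms) simp
  finally show ?thesis by simp
qed

lemma integral_norm_sq_le:
  assumes "tilt_stable n 1 M"
  shows "(\<integral>x. (norm_n n x)\<^sup>2 \<partial>M) \<le> n + (norm_n n mean)\<^sup>2"
proof -
  have "(\<integral>x. (x i)\<^sup>2 \<partial>M) \<le> 1 + (mean i)\<^sup>2" if i: "i < n" for i
  proof -
    have "(\<integral>x. (x i - mean i)\<^sup>2 \<partial>M) = (\<integral>x. (x i)\<^sup>2 \<partial>M) - (\<integral>x. x i \<partial>M)\<^sup>2"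
      using variance_eq[of "\<lambda>x. x i"] integrable_coord[OF i] integrable_coord_sq[OF i, of 0] i
      by (simp add: mean_def)
    thus ?thesis using coord_variance_le[OF assms i] i by (simp add: mean_def)
  qed
  hence "(\<Sum>i<n. \<integral>x. (x i)\<^sup>2 \<partial>M) \<le> (\<Sum>i<n. 1 + (mean i)\<^sup>2)" by (intro sum_mono) simp
  also have "\<dots> = n + (norm_n n mean)\<^sup>2" by (simp add: norm_n_sq sum.distrib)
  also have "(\<Sum>i<n. \<integral>x. (x i)\<^sup>2 \<partial>M) = (\<integral>x. (norm_n n x)\<^sup>2 \<partial>M)"
    unfolding norm_n_sq using integrable_coord_sq[of _ 0]
    by (intro Bochner_Integration.integral_sum[symmetric]) simp
  finally show ?thesis .
qed

lemma borel_measurable_distance [measurable]: "(\<lambda>x. norm_n n (\<lambda>i. x i - b i)) \<in> borel_measurable M"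
  unfolding L2_set_def by measurable

text \<open>
  The norm of \<open>x\<close> and its mean are both compared with the norm of the barycentre; the mean distance to
  the barycentre is at most \<open>sqrt n\<close>, since each coordinate has variance at most 1.
\<close>

lemma abs_norm_minus_mean_le:
  assumes ts: "tilt_stable n 1 M" and n: "1 \<le> n"
  shows "\<bar>norm_n n x - (\<integral>y. norm_n n y \<partial>M)\<bar> \<le> norm_n n (\<lambda>i. x i - mean i) + sqrt n"
proof -
  define r where "r = sqrt (real n)"
  have r: "0 < r" "r\<^sup>2 = n" using n by (auto simp: r_def)
  define D where "D x = norm_n n (\<lambda>i. x i - mean i)" for x
  have D0: "0 \<le> D x" for x by (simp add: D_def)
  have [measurable]: "D \<in> borel_measurable M" unfolding D_def[abs_def] by measurable
  have intD2: "integrable M (\<lambda>x. (D x)\<^sup>2)"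
    unfolding D_def norm_n_sq by (intro Bochner_Integration.integrable_sum integrable_coord_sq) simp
  have Dle: "D x \<le> (D x)\<^sup>2 / (2 * r) + r / 2" for x
    using sum_squares_bound[of "D x" r] r by (simp add: field_simps power2_eq_square)
  have intD: "integrable M D"
  proof (rule Bochner_Integration.integrable_bound)
    show "integrable M (\<lambda>x. (D x)\<^sup>2 / (2 * r) + r / 2)" using intD2 by simp
    show "AE x in M. norm (D x) \<le> norm ((D x)\<^sup>2 / (2 * r) + r / 2)"
      using Dle D0 r by (intro AE_I2) (auto intro: order_trans[OF _ abs_ge_self])
  qed measurable
  have "(\<integral>x. D x \<partial>M) \<le> (\<integral>x. (D x)\<^sup>2 / (2 * r) + r / 2 \<partial>M)"
    using intD intD2 Dle by (intro integral_mono) auto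
  also have "\<dots> = (\<integral>x. (D x)\<^sup>2 \<partial>M) / (2 * r) + r / 2" using intD2 by (simp add: prob_space)
  also have "\<dots> \<le> r\<^sup>2 / (2 * r) + r / 2"
    using integral_sq_distance_le[OF ts] r unfolding D_def
    by (intro add_right_mono divide_right_mono) auto
  also have "\<dots> = r" using r(1) by (simp add: power2_eq_square)
  finally have ED: "(\<integral>x. D x \<partial>M) \<le> r" .
  have tri: "\<bar>norm_n n x - norm_n n mean\<bar> \<le> D x" for x
    unfolding D_def by (rule norm_n_triangle_diff)
  have "\<bar>\<integral>y. norm_n n y - norm_n n mean \<partial>M\<bar> \<le> (\<integral>y. \<bar>norm_n n y - norm_n n mean\<bar> \<partial>M)"
    by (rule integral_abs_bound)
  also have "\<dots> \<le> (\<integral>y. D y \<partial>M)"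
    using integrable_norm intD tri by (intro integral_mono) auto
  finally have "\<bar>(\<integral>y. norm_n n y \<partial>M) - norm_n n mean\<bar> \<le> r"
    using integrable_norm ED by (simp add: prob_space)
  with tri[of x] show ?thesis unfolding D_def[symmetric] r_def[symmetric] by linarith
qed

text \<open>
  The squared distance to the barycentre, divided by \<open>n\<close>, is an average over the coordinates.  By
  convexity of \<open>exp\<close> its exponential moment is bounded by those of the single coordinates, which are
  subgaussian.
\<close>

lemma psi2_norm_norm_le:
  assumes ts: "tilt_stable n 1 M" and n: "1 \<le> n"
  shows "psi2_norm M (\<lambda>x. norm_n n x - (\<integral>y. norm_n n y \<partial>M)) \<le> ennreal (sqrt (8 * n))"
proof -
  define m where "m = (\<integral>y. norm_n n y \<partial>M)"
  define D where "D x = norm_n n (\<lambda>i. x i - mean i)" for x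
  have pw: "exp ((norm_n n x - m)\<^sup>2 / (sqrt (8 * n))\<^sup>2) \<le>
      exp (1 / 4) / n * (\<Sum>i<n. exp ((x i - mean i)\<^sup>2 / 4))" for x
  proof -
    have "(norm_n n x - m)\<^sup>2 \<le> (D x + sqrt n)\<^sup>2"
      using power_mono[OF abs_norm_minus_mean_le[OF ts n, of x], of 2] by (simp add: D_def m_def)
    also have "\<dots> \<le> 2 * (D x)\<^sup>2 + 2 * n"
      using zero_le_power2[of "D x - sqrt n"] by (simp add: power2_sum power2_diff)
    finally have "(norm_n n x - m)\<^sup>2 / (8 * n) \<le> (2 * (D x)\<^sup>2 + 2 * n) / (8 * n)"
      by (intro divide_right_mono) auto
    also have "\<dots> = 1 / 4 + (\<Sum>i<n. 1 / n * ((x i - mean i)\<^sup>2 / 4))"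
      using n unfolding sum_distrib_left[symmetric] sum_divide_distrib[symmetric] D_def norm_n_sq
      by (simp add: field_simps)
    finally have "exp ((norm_n n x - m)\<^sup>2 / (8 * n)) \<le>
        exp (1 / 4) * exp (\<Sum>i<n. (1 / n) *\<^sub>R ((x i - mean i)\<^sup>2 / 4))"
      by (simp flip: exp_add)
    also have "\<dots> \<le> exp (1 / 4) * (\<Sum>i<n. 1 / n * exp ((x i - mean i)\<^sup>2 / 4))"
      using n by (intro mult_left_mono convex_on_sum[OF _ _ exp_convex]) (auto simp: lessThan_empty_iff)
    finally show ?thesis unfolding sum_distrib_left[symmetric] by (simp add: ac_simps)
  qed
  have "(\<integral>\<^sup>+x. ennreal (exp ((norm_n n x - m)\<^sup>2 / (sqrt (8 * n))\<^sup>2)) \<partial>M) \<le>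
      (\<integral>\<^sup>+x. ennreal (exp (1 / 4) / n) * (\<Sum>i<n. ennreal (exp ((x i - mean i)\<^sup>2 / 4))) \<partial>M)"
    using pw by (intro nn_integral_mono) (simp add: sum_nonneg flip: ennreal_mult)
  also have "\<dots> = ennreal (exp (1 / 4) / n) * (\<Sum>i<n. \<integral>\<^sup>+x. ennreal (exp ((x i - mean i)\<^sup>2 / 4)) \<partial>M)"
  proof -
    have "(\<integral>\<^sup>+x. (\<Sum>i<n. ennreal (exp ((x i - mean i)\<^sup>2 / 4))) \<partial>M) =
        (\<Sum>i<n. \<integral>\<^sup>+x. ennreal (exp ((x i - mean i)\<^sup>2 / 4)) \<partial>M)"
      by (intro nn_integral_sum) measurable
    moreover have "(\<lambda>x. \<Sum>i<n. ennreal (exp ((x i - mean i)\<^sup>2 / 4))) \<in> borel_measurable M"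
      by measurable
    ultimately show ?thesis by (simp only: nn_integral_cmult)
  qed
  also have "\<dots> \<le> ennreal (exp (1 / 4) / n) * (\<Sum>i<n. ennreal (sqrt 2))"
  proof (intro mult_left_mono sum_mono)
    fix i assume "i \<in> {..<n}"
    thus "(\<integral>\<^sup>+x. ennreal (exp ((x i - mean i)\<^sup>2 / 4)) \<partial>M) \<le> ennreal (sqrt 2)"
      using tilt_stable_exp_square_le[OF ts, of "unit_vec i"]
      by (simp add: inner_n_unit_vec norm_n_unit_vec)
  qed simp
  also have "\<dots> = ennreal (exp (1 / 4) * sqrt 2)"
    using n by (simp add: ennreal_of_nat_eq_real_of_nat flip: ennreal_mult)
  also have "\<dots> \<le> ennreal 2"
  proof (intro ennreal_leI)
    have "(exp (1 / 2 :: real))\<^sup>2 \<le> 2\<^sup>2"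
      using exp_le by (simp flip: exp_double)
    hence "exp (1 / 2 :: real) \<le> 2" by (rule power2_le_imp_le) simp
    hence "exp (1 / 4 :: real) \<le> sqrt 2" by (intro real_le_rsqrt) (simp flip: exp_double)
    hence "exp (1 / 4) * sqrt 2 \<le> sqrt 2 * sqrt (2::real)" by (intro mult_right_mono) auto
    thus "exp (1 / 4) * sqrt 2 \<le> (2 :: real)" by simp
  qed
  finally show ?thesis unfolding psi2_norm_def m_def[symmetric]
    using n by (intro Inf_lower) (auto intro!: exI[of _ "sqrt (8 * n)"] simp del: real_sqrt_pow2_iff real_sqrt_pow2)
qed

end

lemma K_tilde_le:
  assumes "1 \<le> n"
  shows "K_tilde n \<le> ennreal (sqrt (8 * n))"
  unfolding K_tilde_def
proof (rule SUP_least)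
  fix \<nu> assume "\<nu> \<in> {\<nu>. log_concave n \<nu> \<and> tilt_stable n 1 \<nu>}"
  hence \<nu>: "log_concave n \<nu>" "tilt_stable n 1 \<nu>" by simp_all
  show "psi2_norm \<nu> (\<lambda>x. norm_n n x - (\<integral>y. norm_n n y \<partial>\<nu>)) \<le> ennreal (sqrt (8 * n))"
    by (rule exp_moments.psi2_norm_norm_le[OF exp_moments_of_tilt_stable[OF \<nu>] \<nu>(2) assms])
qed

text \<open>
  Every probability measure on a box of diameter at most 1 has a covariance of at most the identity, in
  particular every tilt of the uniform distribution.  If a single side is long, the norm is almost the coordinate
  along that side, which fluctuates by a constant amount whatever the dimension.  This witnesses that
  \<open>K_tilde n\<close> is bounded away from 0.
\<close>

definition thin_box_side :: "nat \<Rightarrow> nat \<Rightarrow> real"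
  where "thin_box_side n i = (if i = 0 then 1 / 2 else 1 / (8 * n))"

definition thin_box :: "nat \<Rightarrow> (nat \<Rightarrow> real) set"
  where "thin_box n = (\<Pi>\<^sub>E i\<in>{..<n}. {0..thin_box_side n i})"

definition thin_box_measure :: "nat \<Rightarrow> (nat \<Rightarrow> real) measure"
  where "thin_box_measure n = density (lborel_n n) (\<lambda>x. ennreal (indicator (thin_box n) x / (\<Prod>i<n. thin_box_side n i)))"

lemma sets_thin_box [measurable]: "thin_box n \<in> sets (lborel_n n)"
  unfolding thin_box_def by (intro sets_PiM_I_finite) auto

lemma norm_n_thin_box:
  assumes x: "x \<in> thin_box n" and n: "1 \<le> n"
  shows "x 0 \<le> norm_n n x" "norm_n n x \<le> x 0 + 1 / 8" "norm_n n x \<le> 1"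
proof -
  have c: "0 \<le> x i" "x i \<le> thin_box_side n i" if "i < n" for i
    using x that by (auto simp: thin_box_def PiE_iff)
  show "x 0 \<le> norm_n n x" using n by (intro member_le_L2_set) auto
  have "norm_n n x \<le> (\<Sum>i<n. x i)" using c by (intro L2_set_le_sum) auto
  also have "\<dots> = x 0 + (\<Sum>i\<in>{..<n} - {0}. x i)" using n by (intro sum.remove) auto
  also have "(\<Sum>i\<in>{..<n} - {0}. x i) \<le> (\<Sum>i\<in>{..<n} - {0}. 1 / (8 * real n))"
  proof (rule sum_mono)
    show "x i \<le> 1 / (8 * real n)" if "i \<in> {..<n} - {0}" for i
      using c(2)[of i] that by (simp add: thin_box_side_def)
  qed
  also have "\<dots> \<le> (\<Sum>i<n. 1 / (8 * real n))" by (intro sum_mono2) auto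
  also have "\<dots> = 1 / 8" using n by simp
  finally show 1: "norm_n n x \<le> x 0 + 1 / 8" by simp
  have "x 0 \<le> 1 / 2" using c[of 0] n by (simp add: thin_box_side_def)
  with 1 show "norm_n n x \<le> 1" by simp
qed

lemma emeasure_thin_box_slab:
  assumes n: "1 \<le> n" and pq: "0 \<le> p" "p \<le> q" "q \<le> 1 / 2"
  shows "{x \<in> thin_box n. x 0 \<in> {p..q}} \<in> sets (lborel_n n)"
    and "emeasure (thin_box_measure n) {x \<in> thin_box n. x 0 \<in> {p..q}} = ennreal (2 * (q - p))"
proof -
  interpret product_sigma_finite "\<lambda>_::nat. lborel :: real measure" by standard
  define A where "A i = (if i = 0 then {p..q} else {0..thin_box_side n i})" for i
  have slab: "{x \<in> thin_box n. x 0 \<in> {p..q}} = (\<Pi>\<^sub>E i\<in>{..<n}. A i)"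
  proof (intro set_eqI iffI)
    fix x assume x: "x \<in> {x \<in> thin_box n. x 0 \<in> {p..q}}"
    hence "x \<in> extensional {..<n}" by (simp add: thin_box_def PiE_iff)
    moreover have "x i \<in> A i" if "i < n" for i
      using x that by (cases "i = 0") (simp_all add: A_def thin_box_def PiE_iff)
    ultimately show "x \<in> (\<Pi>\<^sub>E i\<in>{..<n}. A i)" by (simp add: PiE_iff)
  next
    fix x assume x: "x \<in> (\<Pi>\<^sub>E i\<in>{..<n}. A i)"
    have 0: "x 0 \<in> {p..q}" using PiE_mem[OF x, of 0] n by (simp add: A_def)
    have "x i \<in> {0..thin_box_side n i}" if "i < n" for i
    proof (cases "i = 0")
      case True
      thus ?thesis using 0 pq by (simp add: thin_box_side_def)
    next
      case False
      thus ?thesis using PiE_mem[OF x, of i] that by (simp add: A_def)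
    qed
    thus "x \<in> {x \<in> thin_box n. x 0 \<in> {p..q}}" using x 0 by (simp add: thin_box_def PiE_iff)
  qed
  have A: "A i \<in> sets lborel" for i by (simp add: A_def)
  show S: "{x \<in> thin_box n. x 0 \<in> {p..q}} \<in> sets (lborel_n n)"
    unfolding slab using A by (intro sets_PiM_I_finite) simp_all
  have side: "0 < thin_box_side n i" for i using n by (simp add: thin_box_side_def)
  define P where "P = (\<Prod>i\<in>{..<n} - {0}. thin_box_side n i)"
  have P: "0 < P" unfolding P_def by (intro prod_pos side)
  have vol: "(\<Prod>i<n. thin_box_side n i) = P / 2"
    using n unfolding P_def by (subst prod.remove[of _ 0]) (auto simp: thin_box_side_def)
  have "emeasure (lborel_n n) (\<Pi>\<^sub>E i\<in>{..<n}. A i) = (\<Prod>i<n. emeasure lborel (A i))"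
    using A by (intro emeasure_PiM) auto
  also have "\<dots> = emeasure lborel (A 0) * (\<Prod>i\<in>{..<n} - {0}. emeasure lborel (A i))"
    using n by (intro prod.remove) auto
  also have "\<dots> = ennreal (q - p) * (\<Prod>i\<in>{..<n} - {0}. ennreal (thin_box_side n i))"
    using pq side by (intro arg_cong2[where f = "(*)"] prod.cong) (auto simp: A_def less_imp_le)
  also have "(\<Prod>i\<in>{..<n} - {0}. ennreal (thin_box_side n i)) = ennreal P"
    unfolding P_def using side by (intro prod_ennreal) (auto intro: less_imp_le)
  finally have leb: "emeasure (lborel_n n) {x \<in> thin_box n. x 0 \<in> {p..q}} = ennreal ((q - p) * P)"
    unfolding slab using pq P by (simp add: ennreal_mult)
  have "emeasure (thin_box_measure n) {x \<in> thin_box n. x 0 \<in> {p..q}} =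
      (\<integral>\<^sup>+x. ennreal (2 / P) * indicator {x \<in> thin_box n. x 0 \<in> {p..q}} x \<partial>lborel_n n)"
    unfolding thin_box_measure_def vol using S P
    by (subst emeasure_density) (auto intro!: nn_integral_cong simp: indicator_def)
  also have "\<dots> = ennreal (2 / P) * ennreal ((q - p) * P)"
    by (simp only: nn_integral_cmult_indicator[OF S] leb)
  also have "\<dots> = ennreal (2 * (q - p))" using P pq by (simp flip: ennreal_mult)
  finally show "emeasure (thin_box_measure n) {x \<in> thin_box n. x 0 \<in> {p..q}} = ennreal (2 * (q - p))" .
qed

lemma thin_box_side_pos: "1 \<le> n \<Longrightarrow> 0 < thin_box_side n i"
  by (simp add: thin_box_side_def)

lemma AE_thin_box_measure: "AE x in thin_box_measure n. x \<in> thin_box n"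
  unfolding thin_box_measure_def
  by (subst AE_density) (auto simp: indicator_def)

lemma prob_space_thin_box_measure:
  assumes n: "1 \<le> n"
  shows "prob_space (thin_box_measure n)"
proof
  have "emeasure (thin_box_measure n) (space (thin_box_measure n)) = emeasure (thin_box_measure n) {x \<in> thin_box n. x 0 \<in> {0..1/2}}"
  proof (rule emeasure_eq_AE)
    show "AE x in thin_box_measure n. (x \<in> space (thin_box_measure n)) = (x \<in> {x \<in> thin_box n. x 0 \<in> {0..1/2}})"
      using AE_thin_box_measure AE_space
    proof eventually_elim
      case (elim x)
      hence "x 0 \<in> {0..thin_box_side n 0}" using n PiE_mem[of x "{..<n}" "\<lambda>i. {0..thin_box_side n i}" 0]
        by (simp add: thin_box_def)
      thus ?case using elim by (simp add: thin_box_side_def)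
    qed
  qed (use emeasure_thin_box_slab(1)[OF n, of 0 "1/2"] in \<open>simp_all add: thin_box_measure_def\<close>)
  also have "\<dots> = 1" using emeasure_thin_box_slab(2)[OF n, of 0 "1/2"] by simp
  finally show "emeasure (thin_box_measure n) (space (thin_box_measure n)) = 1" .
qed

lemma log_concave_thin_box_measure:
  assumes n: "1 \<le> n"
  shows "log_concave n (thin_box_measure n)"
proof -
  define P where "P = (\<Prod>i<n. thin_box_side n i)"
  have P: "0 < P" unfolding P_def by (intro prod_pos thin_box_side_pos n)
  define V where "V x = (if x \<in> thin_box n then ereal (ln P) else \<infinity>)" for x
  have "convex_fun_n n V"
    unfolding convex_fun_n_def
  proof (intro conjI ballI)
    show "V x \<noteq> -\<infinity>" for x by (simp add: V_def)
    fix x y and u :: real assume u: "u \<in> {0<..<1}"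
    show "V (\<lambda>i\<in>{..<n}. u * x i + (1 - u) * y i) \<le> ereal u * V x + ereal (1 - u) * V y"
    proof (cases "x \<in> thin_box n \<and> y \<in> thin_box n")
      case True
      have "u * x i + (1 - u) * y i \<in> {0..thin_box_side n i}" if "i < n" for i
      proof -
        have "x i \<in> {0..thin_box_side n i}" "y i \<in> {0..thin_box_side n i}"
          using True that by (auto simp: thin_box_def PiE_iff)
        thus ?thesis using u convexD[of "{0..thin_box_side n i}" "x i" "y i" u "1 - u"] by simp
      qed
      hence "(\<lambda>i\<in>{..<n}. u * x i + (1 - u) * y i) \<in> thin_box n" by (auto simp: thin_box_def)
      thus ?thesis using True by (simp add: V_def algebra_simps)
    next
      case False
      thus ?thesis using u by (auto simp: V_def)
    qed
  qed
  moreover have "V \<in> borel_measurable (lborel_n n)"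
    unfolding V_def[abs_def] by (intro measurable_If_set) (auto simp: space_PiM sets_thin_box)
  moreover have "thin_box_measure n = density (lborel_n n) (\<lambda>x. ennreal (exp_neg (V x)))"
    unfolding thin_box_measure_def P_def[symmetric]
    using P by (intro arg_cong[where f = "density _"] ext)
      (simp add: V_def exp_neg_def exp_minus field_simps indicator_def)
  ultimately show ?thesis
    unfolding log_concave_def using prob_space_thin_box_measure[OF n] by blast
qed

lemma exp_moments_thin_box_measure:
  assumes n: "1 \<le> n"
  shows "exp_moments n (thin_box_measure n)"
proof -
  interpret prob_space "thin_box_measure n" by (rule prob_space_thin_box_measure[OF n])
  show ?thesis
  proof unfold_locales
    show sets: "sets (thin_box_measure n) = sets (lborel_n n)" by (simp add: thin_box_measure_def)
    note [measurable_cong] = sets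
    fix h
    have "AE x in thin_box_measure n. norm (exp (inner_n n h x)) \<le> exp (norm_n n h)"
      using AE_thin_box_measure
    proof eventually_elim
      case (elim x)
      have "inner_n n h x \<le> norm_n n h * norm_n n x" using abs_inner_n_le[of n h x] by linarith
      also have "\<dots> \<le> norm_n n h * 1" by (intro mult_left_mono norm_n_thin_box elim n) simp
      finally show ?case by simp
    qed
    thus "integrable (thin_box_measure n) (\<lambda>x. exp (inner_n n h x))"
      by (rule integrable_const_bound) measurable
  qed
qed

lemma tilt_stable_thin_box_measure:
  assumes n: "1 \<le> n"
  shows "tilt_stable n 1 (thin_box_measure n)"
proof -
  interpret exp_moments n "thin_box_measure n" by (rule exp_moments_thin_box_measure[OF n])
  have "dir_var n (tilted n (thin_box_measure n) 0 h) v \<le> 1\<^sup>2 * (norm_n n v)\<^sup>2" for h v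
  proof -
    interpret T: exp_moments n "tilted n (thin_box_measure n) 0 h" by (rule exp_moments_tilted) simp
    have ae: "AE x in tilted n (thin_box_measure n) 0 h. x \<in> thin_box n"
      unfolding tilted_def using AE_thin_box_measure by (subst AE_density) auto
    have "T.variance (inner_n n v) = T.expectation (\<lambda>x. (inner_n n v x)\<^sup>2) - (T.expectation (inner_n n v))\<^sup>2"
      using T.integrable_inner_sq[of v 0] by (intro T.variance_eq T.integrable_inner) simp
    also have "\<dots> \<le> T.expectation (\<lambda>x. (inner_n n v x)\<^sup>2)" by simp
    also have "\<dots> \<le> T.expectation (\<lambda>x. (norm_n n v)\<^sup>2)"
    proof (rule integral_mono_AE)
      show "AE x in tilted n (thin_box_measure n) 0 h. (inner_n n v x)\<^sup>2 \<le> (norm_n n v)\<^sup>2"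
        using ae
      proof eventually_elim
        case (elim x)
        have "\<bar>inner_n n v x\<bar> \<le> norm_n n v * norm_n n x" by (rule abs_inner_n_le)
        also have "\<dots> \<le> norm_n n v * 1" by (intro mult_left_mono norm_n_thin_box elim n) simp
        finally show ?case by (metis abs_ge_zero mult.right_neutral power2_abs power_mono)
      qed
    qed (use T.integrable_inner_sq[of v 0] in simp_all)
    finally show ?thesis by (simp add: dir_var_def T.prob_space)
  qed
  thus ?thesis unfolding tilt_stable_iff by simp
qed

text \<open>
  Wherever \<open>m\<close> lies, the norm differs from it by at least \<open>1 / 16\<close> on a slab of probability \<open>1 / 4\<close>, at one
  of the two ends of the long side.
\<close>

lemma psi2_norm_thin_box_measure_ge:
  assumes n: "1 \<le> n"
  shows "ennreal (1 / 50) \<le> psi2_norm (thin_box_measure n) (\<lambda>x. norm_n n x - m)"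
  unfolding psi2_norm_def
proof (rule Inf_greatest, safe)
  interpret exp_moments n "thin_box_measure n" by (rule exp_moments_thin_box_measure[OF n])
  fix t :: real
  assume t: "0 < t" and le2: "(\<integral>\<^sup>+x. ennreal (exp ((norm_n n x - m)\<^sup>2 / t\<^sup>2)) \<partial>thin_box_measure n) \<le> 2"
  \<comment> \<open>The norm exceeds \<open>x 0\<close> by at most \<open>1 / 8\<close>, so it is at most \<open>1 / 4\<close> on the lower slab and at least
     \<open>3 / 8\<close> on the upper one; \<open>5 / 16\<close> is the midpoint of these values.\<close>
  obtain p q where pq: "0 \<le> p" "p \<le> q" "q \<le> 1/2" "q - p = 1 / 8"
    and far: "\<And>x. x \<in> thin_box n \<Longrightarrow> x 0 \<in> {p..q} \<Longrightarrow> 1 / 16 \<le> \<bar>norm_n n x - m\<bar>"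
  proof (cases "m \<le> 5 / 16")
    case True
    show ?thesis
    proof (rule that[of "3/8" "1/2"])
      fix x assume "x \<in> thin_box n" "x 0 \<in> {3 / 8..1 / 2}"
      thus "1 / 16 \<le> \<bar>norm_n n x - m\<bar>" using norm_n_thin_box(1)[OF _ n, of x] True by auto
    qed auto
  next
    case False
    show ?thesis
    proof (rule that[of 0 "1/8"])
      fix x assume "x \<in> thin_box n" "x 0 \<in> {0..1 / 8}"
      thus "1 / 16 \<le> \<bar>norm_n n x - m\<bar>" using norm_n_thin_box(2)[OF _ n, of x] False by auto
    qed auto
  qed
  define S where "S = {x \<in> thin_box n. x 0 \<in> {p..q}}"
  have S: "S \<in> sets (thin_box_measure n)" "emeasure (thin_box_measure n) S = ennreal (1 / 4)"
    using emeasure_thin_box_slab[OF n pq(1-3)] pq(4) by (simp_all add: S_def sets_eq)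
  define c where "c = exp (1 / (256 * t\<^sup>2))"
  have "ennreal (c / 4) = (\<integral>\<^sup>+x. ennreal c * indicator S x \<partial>thin_box_measure n)"
    using S by (simp add: nn_integral_cmult_indicator c_def flip: ennreal_mult)
  also have "\<dots> \<le> (\<integral>\<^sup>+x. ennreal (exp ((norm_n n x - m)\<^sup>2 / t\<^sup>2)) \<partial>thin_box_measure n)"
  proof (intro nn_integral_mono)
    fix x
    have "c \<le> exp ((norm_n n x - m)\<^sup>2 / t\<^sup>2)" if "x \<in> S"
    proof -
      have "(1 / 16)\<^sup>2 \<le> \<bar>norm_n n x - m\<bar>\<^sup>2"
        using far that by (intro power_mono) (auto simp: S_def)
      hence "(1 / 16)\<^sup>2 / t\<^sup>2 \<le> (norm_n n x - m)\<^sup>2 / t\<^sup>2" by (intro divide_right_mono) auto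
      thus ?thesis by (simp add: c_def power_divide)
    qed
    thus "ennreal c * indicator S x \<le> ennreal (exp ((norm_n n x - m)\<^sup>2 / t\<^sup>2))"
      by (auto simp: indicator_def ennreal_leI)
  qed
  also note le2
  finally have "ennreal (c / 4) \<le> ennreal 2" by simp
  hence "c \<le> 8" by (subst (asm) ennreal_le_iff) auto
  moreover have "1 + 1 / (256 * t\<^sup>2) \<le> c" unfolding c_def by (rule exp_ge_add_one_self)
  ultimately have "1 / (256 * t\<^sup>2) \<le> 7" by linarith
  hence "1 \<le> 1792 * t\<^sup>2" using t by (simp add: divide_le_eq)
  hence "(1 / 50)\<^sup>2 \<le> t\<^sup>2" by (simp add: power_divide)
  hence "1 / 50 \<le> t" by (rule power2_le_imp_le) (use t in simp)
  thus "ennreal (1 / 50) \<le> ennreal t" by (rule ennreal_leI)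
qed

lemma K_tilde_ge:
  assumes n: "1 \<le> n"
  shows "ennreal (1 / 50) \<le> K_tilde n"
  unfolding K_tilde_def
  using log_concave_thin_box_measure[OF n] tilt_stable_thin_box_measure[OF n]
  by (intro SUP_upper2[of "thin_box_measure n"] psi2_norm_thin_box_measure_ge n) simp

section \<open>Weak Gaussian tilts of tilt-stable measures\<close>

lemma dir_var_le_of_unit:
  assumes unit: "\<And>u. norm_n n u \<le> 1 \<Longrightarrow> dir_var n M u \<le> B"
  shows "dir_var n M v \<le> B * (norm_n n v)\<^sup>2"
proof (cases "norm_n n v = 0")
  case True
  hence "\<bar>inner_n n v x\<bar> \<le> 0" for x using abs_inner_n_le[of n v x] by simp
  hence "inner_n n v x = 0" for x using abs_le_zero_iff by blast
  thus ?thesis by (simp add: True dir_var_def)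
next
  case False
  define r where "r = norm_n n v"
  have r: "0 < r" using False L2_set_nonneg[of v "{..<n}"] unfolding r_def by linarith
  define u where "u = (\<lambda>i. 1 / r * v i)"
  have "inner_n n v x = r * inner_n n u x" for x
    using r unfolding u_def inner_n_scale by simp
  hence "dir_var n M v = r\<^sup>2 * dir_var n M u"
    by (simp add: dir_var_def power_mult_distrib flip: right_diff_distrib)
  moreover have "norm_n n u \<le> 1" using r unfolding u_def norm_n_scale r_def[symmetric] by simp
  ultimately show ?thesis using unit[of u] r by (simp add: r_def mult.commute mult_left_mono)
qed

lemma (in prob_space) exp_integral_le:
  fixes Y :: "'a \<Rightarrow> real"
  assumes "integrable M Y" "integrable M (\<lambda>x. exp (Y x))"
  shows "exp (\<integral>x. Y x \<partial>M) \<le> (\<integral>x. exp (Y x) \<partial>M)"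
proof -
  define c where "c = (\<integral>x. Y x \<partial>M)"
  have "(\<integral>x. exp c * (1 + (Y x - c)) \<partial>M) \<le> (\<integral>x. exp (Y x) \<partial>M)"
  proof (rule integral_mono)
    fix x
    have "exp c * (1 + (Y x - c)) \<le> exp c * exp (Y x - c)"
      by (intro mult_left_mono exp_ge_add_one_self) simp
    thus "exp c * (1 + (Y x - c)) \<le> exp (Y x)" by (simp flip: exp_add)
  qed (use assms in simp_all)
  also have "(\<integral>x. exp c * (1 + (Y x - c)) \<partial>M) = exp c"
    using assms(1) by (simp add: c_def prob_space)
  finally show ?thesis by (simp add: c_def)
qed

lemma (in prob_space) expectation_le_ln_exp:
  fixes f :: "'a \<Rightarrow> real"
  assumes f: "integrable M f" "integrable M (\<lambda>x. exp (f x))"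
    and B: "0 < B" "(\<integral>x. exp (f x) \<partial>M) \<le> B"
  shows "(\<integral>x. f x \<partial>M) \<le> ln B"
  using exp_integral_le[OF f] B by (metis exp_ln exp_le_cancel_iff order_trans)

lemma (in prob_space) variance_le_second_moment:
  fixes Y :: "'a \<Rightarrow> real"
  assumes int: "integrable M Y" "integrable M (\<lambda>x. (Y x)\<^sup>2)"
  shows "variance Y \<le> (\<integral>x. (Y x - c)\<^sup>2 \<partial>M)"
proof -
  have "(\<integral>x. (Y x - c)\<^sup>2 \<partial>M) = expectation (\<lambda>x. (Y x)\<^sup>2) - 2 * c * expectation Y + c\<^sup>2"
    using int by (simp add: power2_diff prob_space algebra_simps)
  moreover have "variance Y = expectation (\<lambda>x. (Y x)\<^sup>2) - (expectation Y)\<^sup>2"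
    by (intro variance_eq int)
  moreover have "0 \<le> (expectation Y)\<^sup>2 - 2 * c * expectation Y + c\<^sup>2"
    using zero_le_power2[of "expectation Y - c"] by (simp add: power2_diff ac_simps)
  ultimately show ?thesis by linarith
qed

context exp_moments
begin

text \<open>
  The barycentre of the tilt by \<open>k\<close> is the gradient at \<open>k\<close> of the logarithmic Laplace transform \<open>\<Lambda>\<close>, so
  the vector in the claim is the gradient of \<open>F k = \<Lambda> k + (norm_n n (\<lambda>i. k i - h i))\<^sup>2 / (2 * t)\<close>.  The
  function \<open>F\<close> is bounded below, and tilt stability bounds its second derivative by \<open>c = 1 + 1 / t\<close>.
  Near the infimum the gradient is hence small: otherwise a gradient step would lead below the infimum.
\<close>

lemma ex_almost_centred_tilt:
  assumes ts: "tilt_stable n 1 M" and t: "0 < t"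
  shows "\<exists>k. norm_n n (\<lambda>i. exp_moments.mean n (tilted n M 0 k) i - (h i - k i) / t) \<le> 1"
proof -
  define \<Lambda> where "\<Lambda> k = ln (\<integral>x. exp (inner_n n k x) \<partial>M)" for k
  define F where "F k = \<Lambda> k + (norm_n n (\<lambda>i. k i - h i))\<^sup>2 / (2 * t)" for k
  have pos: "0 < (\<integral>x. exp (inner_n n k x) \<partial>M)" for k
    by (intro integral_pos_of_pos exp_int) simp
  have "inner_n n h mean - t * (norm_n n mean)\<^sup>2 / 2 \<le> F k" for k
  proof -
    define d where "d = (\<lambda>i. k i - h i)"
    have "exp (inner_n n k mean) \<le> (\<integral>x. exp (inner_n n k x) \<partial>M)"
      using exp_integral_le[OF integrable_inner exp_int] by (simp add: expectation_inner)
    hence 1: "inner_n n k mean \<le> \<Lambda> k" unfolding \<Lambda>_def by (subst ln_ge_iff[OF pos])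
    have "\<bar>inner_n n d mean\<bar> \<le> norm_n n d * norm_n n mean" by (rule abs_inner_n_le)
    moreover have "norm_n n d * norm_n n mean \<le> (norm_n n d)\<^sup>2 / (2 * t) + t * (norm_n n mean)\<^sup>2 / 2"
    proof -
      have "0 \<le> (norm_n n d - t * norm_n n mean)\<^sup>2 / (2 * t)" using t by simp
      also have "\<dots> = (norm_n n d)\<^sup>2 / (2 * t) - norm_n n d * norm_n n mean + t * (norm_n n mean)\<^sup>2 / 2"
        using t by (simp add: power2_diff field_simps power2_eq_square)
      finally show ?thesis by simp
    qed
    moreover have "inner_n n d mean = inner_n n k mean - inner_n n h mean"
      unfolding d_def by (rule inner_n_diff)
    ultimately show ?thesis using 1 unfolding F_def d_def[symmetric] by linarith
  qed
  hence bdd: "bdd_below (range F)" by (auto simp: bdd_below_def)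
  define c where "c = 1 + 1 / t"
  have c: "0 < c" using t by (simp add: c_def add_pos_pos)
  have "Inf (range F) < Inf (range F) + 1 / (2 * c)" using c by simp
  then obtain k where k: "F k < Inf (range F) + 1 / (2 * c)"
    using cInf_lessD[of "range F"] by blast
  interpret T: exp_moments n "tilted n M 0 k" by (rule exp_moments_tilted) simp
  define g where "g = (\<lambda>i. T.mean i - (h i - k i) / t)"
  \<comment> \<open>The step that minimises the quadratic upper bound on \<open>F\<close>, proved next.\<close>
  define v where "v = (\<lambda>i. - 1 / c * g i)"
  have F: "F (\<lambda>i. k i + v i) \<le> F k + inner_n n g v + c * (norm_n n v)\<^sup>2 / 2"
  proof -
    define Q where "Q = (\<integral>x. exp (inner_n n (\<lambda>i. k i + v i) x) \<partial>M) / (\<integral>x. exp (inner_n n k x) \<partial>M)"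
    have Q: "0 < Q" unfolding Q_def using pos by (intro divide_pos_pos)
    have "Q = (\<integral>x. exp (inner_n n v x) \<partial>tilted n M 0 k)"
      using integral_reweight[OF integrable_tilt_weight[OF order_refl, of k] tilt_weight_pos, of "\<lambda>x. exp (inner_n n v x)"]
      by (simp add: Q_def tilted_eq_reweight tilt_weight_0 inner_n_add exp_add)
    also have "\<dots> \<le> exp (inner_n n v T.mean + (norm_n n v)\<^sup>2 / 2)"
      by (intro T.tilt_stable_mgf_le tilt_stable_tilted ts)
    finally have "ln Q \<le> ln (exp (inner_n n v T.mean + (norm_n n v)\<^sup>2 / 2))"
      using Q by (subst ln_le_cancel_iff) auto
    moreover have "ln Q = \<Lambda> (\<lambda>i. k i + v i) - \<Lambda> k"
      unfolding Q_def \<Lambda>_def using pos by (intro ln_divide_pos)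
    ultimately have L: "\<Lambda> (\<lambda>i. k i + v i) \<le> \<Lambda> k + inner_n n v T.mean + (norm_n n v)\<^sup>2 / 2"
      by simp
    have "(norm_n n (\<lambda>i. (k i + v i) - h i))\<^sup>2 =
        (norm_n n (\<lambda>i. k i - h i))\<^sup>2 + 2 * (\<Sum>i<n. (k i - h i) * v i) + (norm_n n v)\<^sup>2"
      unfolding norm_n_sq sum_distrib_left sum.distrib[symmetric]
      by (intro sum.cong) (auto simp: power2_eq_square algebra_simps)
    hence "(norm_n n (\<lambda>i. (k i + v i) - h i))\<^sup>2 / (2 * t) =
        (norm_n n (\<lambda>i. k i - h i))\<^sup>2 / (2 * t) + (\<Sum>i<n. (k i - h i) * v i) / t + (norm_n n v)\<^sup>2 / (2 * t)"
      using t by (simp add: field_simps)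
    moreover have "inner_n n g v = inner_n n v T.mean + (\<Sum>i<n. (k i - h i) * v i) / t"
      unfolding g_def inner_n_def sum_divide_distrib sum.distrib[symmetric]
      by (intro sum.cong) (auto simp: field_simps diff_divide_distrib)
    ultimately show ?thesis using L unfolding F_def c_def by (simp add: field_simps)
  qed
  have gv: "inner_n n g v = - 1 / c * (norm_n n g)\<^sup>2"
    unfolding inner_n_commute[of n g v] unfolding v_def inner_n_scale norm_n_sq_inner ..
  have "(norm_n n v)\<^sup>2 = (norm_n n g)\<^sup>2 / c\<^sup>2"
    unfolding v_def norm_n_scale by (simp add: power_mult_distrib power_divide)
  hence "inner_n n g v + c * (norm_n n v)\<^sup>2 / 2 = - ((norm_n n g)\<^sup>2 / (2 * c))"
    unfolding gv using c by (simp add: field_simps power2_eq_square)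
  moreover have "Inf (range F) \<le> F (\<lambda>i. k i + v i)" by (intro cInf_lower bdd) simp
  ultimately have "(norm_n n g)\<^sup>2 / (2 * c) < 1 / (2 * c)"
    using F k by linarith
  hence "(norm_n n g)\<^sup>2 < 1\<^sup>2" using c by (simp add: divide_less_cancel)
  hence "norm_n n g < 1" by (rule power2_less_imp_less) simp
  thus ?thesis unfolding g_def by (intro exI[of _ k]) simp
qed

text \<open>
  Let \<open>w / Z\<close> be the density of the tilted measure with respect to \<open>M\<close>, let \<open>R\<close> be the norm and \<open>m\<close> its
  mean.  Expanding \<open>R\<^sup>2\<close> around \<open>m\<^sup>2\<close> gives \<open>w\<close> a main factor that depends on \<open>m\<close> only and cancels against
  \<open>Z\<close>; the rest is an exponential of \<open>t * m * (R - m)\<close>, which is under control because \<open>R - m\<close> is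
  subgaussian with constant \<open>\<tau>\<close>.  The second moment of \<open>w / Z\<close> is therefore at most \<open>2 * exp q\<close>.
  
  By Jensen's inequality the mean of \<open>f\<close> under the tilted measure is at most the logarithm of the mean
  of \<open>exp f\<close>, and the latter is bounded by the second moments of \<open>w / Z\<close> and \<open>exp f\<close> under \<open>M\<close>.  For an
  eighth of the square of a centred linear functional both are known, and the logarithm turns the
  factor \<open>exp q\<close> into the summand \<open>q\<close>.
\<close>

lemma dir_var_gaussian_tilt_le:
  assumes ts: "tilt_stable n 1 M" and n: "1 \<le> n" and mean: "norm_n n mean \<le> 1" and t: "0 \<le> t"
    and \<tau>: "0 < \<tau>"
    and psi: "(\<integral>\<^sup>+x. ennreal (exp ((norm_n n x - (\<integral>y. norm_n n y \<partial>M))\<^sup>2 / \<tau>\<^sup>2)) \<partial>M) \<le> 2"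
  shows "dir_var n (tilted n M t (\<lambda>_. 0)) v \<le> 8 * (1 + t * \<tau>\<^sup>2 + 2 * t\<^sup>2 * n * \<tau>\<^sup>2) * (norm_n n v)\<^sup>2"
proof -
  define R where "R = norm_n n"
  have [measurable]: "R \<in> borel_measurable M" unfolding R_def by measurable
  define m where "m = (\<integral>x. R x \<partial>M)"
  define w where "w x = exp (- t / 2 * (R x)\<^sup>2)" for x
  have w_eq: "tilt_weight n t (\<lambda>_. 0) = w"
    by (simp add: tilt_weight_def w_def R_def inner_n_def fun_eq_iff)
  have [measurable]: "w \<in> borel_measurable M" unfolding w_def[abs_def] by measurable
  have intw: "integrable M w" using integrable_tilt_weight[OF t, of "\<lambda>_. 0"] by (simp add: w_eq)
  have wpos: "0 < w x" for x by (simp add: w_def)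
  define Z where "Z = (\<integral>x. w x \<partial>M)"
  have Z: "0 < Z" unfolding Z_def by (intro integral_pos_of_pos intw wpos)
  have intR: "integrable M R" "integrable M (\<lambda>x. (R x)\<^sup>2)"
    unfolding R_def using integrable_norm integrable_norm_sq by auto
  have varR: "variance R = (\<integral>x. (R x)\<^sup>2 \<partial>M) - m\<^sup>2"
    unfolding m_def by (intro variance_eq intR)
  have m2: "m\<^sup>2 \<le> 2 * n"
  proof -
    have "m\<^sup>2 \<le> (\<integral>x. (R x)\<^sup>2 \<partial>M)" using variance_positive[of R] varR by simp
    also have "\<dots> \<le> n + (norm_n n mean)\<^sup>2" unfolding R_def by (rule integral_norm_sq_le[OF ts])
    also have "(norm_n n mean)\<^sup>2 \<le> 1" using mean by (simp add: power_le_one)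
    also have "real n + 1 \<le> 2 * n" using n by simp
    finally show ?thesis by simp
  qed
  define G where "G x = exp ((R x - m)\<^sup>2 / \<tau>\<^sup>2)" for x
  have [measurable]: "G \<in> borel_measurable M" unfolding G_def[abs_def] by measurable
  have psi': "(\<integral>\<^sup>+x. ennreal (G x) \<partial>M) \<le> ennreal 2"
    using psi by (simp add: G_def R_def m_def)
  have intG: "integrable M G"
    by (rule integrableI_nonneg) (use psi' in \<open>auto simp: G_def intro: le_less_trans\<close>)
  have EG: "(\<integral>x. G x \<partial>M) \<le> 2"
  proof -
    have "(\<integral>\<^sup>+x. ennreal (G x) \<partial>M) = ennreal (\<integral>x. G x \<partial>M)"
      by (intro nn_integral_eq_integral intG) (simp add: G_def)
    with psi' show ?thesis by (simp add: ennreal_le_iff del: ennreal_numeral)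
  qed
  have "variance R \<le> \<tau>\<^sup>2"
  proof -
    have "(\<integral>x. (R x - m)\<^sup>2 \<partial>M) \<le> (\<integral>x. \<tau>\<^sup>2 * (G x - 1) \<partial>M)"
    proof (rule integral_mono)
      show "integrable M (\<lambda>x. (R x - m)\<^sup>2)" using intR by (simp add: power2_diff)
      fix x
      have "(R x - m)\<^sup>2 / \<tau>\<^sup>2 \<le> G x - 1"
        unfolding G_def using exp_ge_add_one_self[of "(R x - m)\<^sup>2 / \<tau>\<^sup>2"] by linarith
      hence "\<tau>\<^sup>2 * ((R x - m)\<^sup>2 / \<tau>\<^sup>2) \<le> \<tau>\<^sup>2 * (G x - 1)" by (intro mult_left_mono) simp_all
      thus "(R x - m)\<^sup>2 \<le> \<tau>\<^sup>2 * (G x - 1)" using \<tau> by simp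
    qed (use intG in simp)
    also have "\<dots> = \<tau>\<^sup>2 * ((\<integral>x. G x \<partial>M) - 1)" using intG by (simp add: prob_space)
    also have "\<dots> \<le> \<tau>\<^sup>2 * 1" using EG by (intro mult_left_mono) auto
    finally show ?thesis by (simp add: m_def)
  qed
  hence ER2: "(\<integral>x. (R x)\<^sup>2 \<partial>M) \<le> m\<^sup>2 + \<tau>\<^sup>2" using varR by simp
  have Zge: "exp (- t / 2 * (m\<^sup>2 + \<tau>\<^sup>2)) \<le> Z"
  proof -
    have "exp (- t / 2 * (m\<^sup>2 + \<tau>\<^sup>2)) \<le> exp (- t / 2 * (\<integral>x. (R x)\<^sup>2 \<partial>M))"
      using mult_left_mono[OF ER2, of "t / 2"] t by simp
    also have "\<dots> = exp (\<integral>x. - t / 2 * (R x)\<^sup>2 \<partial>M)" by simp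
    also have "\<dots> \<le> (\<integral>x. exp (- t / 2 * (R x)\<^sup>2) \<partial>M)"
      using intR(2) intw unfolding w_def[abs_def] by (intro exp_integral_le) simp_all
    finally show ?thesis by (simp add: Z_def w_def)
  qed
  define q where "q = t * \<tau>\<^sup>2 + t\<^sup>2 * m\<^sup>2 * \<tau>\<^sup>2"
  have q0: "0 \<le> q" unfolding q_def using t by simp
  have w2: "(w x)\<^sup>2 \<le> exp (- t * m\<^sup>2 + t\<^sup>2 * m\<^sup>2 * \<tau>\<^sup>2) * G x" for x
  proof -
    \<comment> \<open>Completing this square trades \<open>R x - m\<close> for the squared quotient whose exponential is \<open>G x\<close>.\<close>
    have "0 \<le> ((R x - m) / \<tau> + t * m * \<tau>)\<^sup>2" by simp
    also have "\<dots> = (R x - m)\<^sup>2 / \<tau>\<^sup>2 + t\<^sup>2 * m\<^sup>2 * \<tau>\<^sup>2 + 2 * t * m * (R x - m)"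
      using \<tau> by (simp add: power2_sum power_divide power_mult_distrib)
    finally have "- t * (m\<^sup>2 + 2 * m * (R x - m)) \<le> - t * m\<^sup>2 + t\<^sup>2 * m\<^sup>2 * \<tau>\<^sup>2 + (R x - m)\<^sup>2 / \<tau>\<^sup>2"
      by (simp add: algebra_simps)
    moreover have "t * (m\<^sup>2 + 2 * m * (R x - m)) \<le> t * (R x)\<^sup>2"
    proof (rule mult_left_mono[OF _ t])
      have "(R x)\<^sup>2 - (m\<^sup>2 + 2 * m * (R x - m)) = (R x - m)\<^sup>2"
        by (simp add: power2_eq_square algebra_simps)
      thus "m\<^sup>2 + 2 * m * (R x - m) \<le> (R x)\<^sup>2" using zero_le_power2[of "R x - m"] by linarith
    qed
    ultimately have "- t * (R x)\<^sup>2 \<le> - t * m\<^sup>2 + t\<^sup>2 * m\<^sup>2 * \<tau>\<^sup>2 + (R x - m)\<^sup>2 / \<tau>\<^sup>2" by simp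
    thus ?thesis by (simp add: w_def G_def flip: exp_double exp_add)
  qed
  have intw2: "integrable M (\<lambda>x. (w x)\<^sup>2)"
    by (rule Bochner_Integration.integrable_bound[OF integrable_mult_right[OF intG]])
      (use w2 in \<open>auto intro!: AE_I2 order_trans[OF _ abs_ge_self]\<close>)
  have "(\<integral>x. (w x)\<^sup>2 \<partial>M) \<le> (\<integral>x. exp (- t * m\<^sup>2 + t\<^sup>2 * m\<^sup>2 * \<tau>\<^sup>2) * G x \<partial>M)"
    using intw2 intG w2 by (intro integral_mono) auto
  also have "\<dots> = exp (- t * m\<^sup>2 + t\<^sup>2 * m\<^sup>2 * \<tau>\<^sup>2) * (\<integral>x. G x \<partial>M)" by simp
  also have "\<dots> \<le> exp (- t * m\<^sup>2 + t\<^sup>2 * m\<^sup>2 * \<tau>\<^sup>2) * 2" using EG by (intro mult_left_mono) auto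
  also have "\<dots> = 2 * exp q * (exp (- t / 2 * (m\<^sup>2 + \<tau>\<^sup>2)))\<^sup>2"
    unfolding q_def by (simp add: algebra_simps flip: exp_double exp_add)
  also have "\<dots> \<le> 2 * exp q * Z\<^sup>2" using Zge by (intro mult_left_mono power_mono) auto
  finally have D: "(\<integral>x. (w x)\<^sup>2 \<partial>M) \<le> 2 * exp q * Z\<^sup>2" .
  interpret T: exp_moments n "tilted n M t (\<lambda>_. 0)" by (rule exp_moments_tilted[OF t])
  have teq: "tilted n M t (\<lambda>_. 0) = reweight M w" unfolding tilted_eq_reweight[OF t] w_eq ..
  have "dir_var n (tilted n M t (\<lambda>_. 0)) u \<le> 8 * (1 + q)" if u: "norm_n n u \<le> 1" for u
  proof -
    define c where "c = inner_n n u mean"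
    define f where "f x = (inner_n n u x - c)\<^sup>2 / 8" for x
    have [measurable]: "f \<in> borel_measurable M" unfolding f_def[abs_def] by measurable
    have e2: "exp (2 * f x) = exp ((inner_n n u x - c)\<^sup>2 / 4)" for x by (simp add: f_def)
    have nn: "(\<integral>\<^sup>+x. ennreal (exp (2 * f x)) \<partial>M) \<le> ennreal (sqrt 2)"
      unfolding e2 c_def by (rule tilt_stable_exp_square_le[OF ts u])
    have int2: "integrable M (\<lambda>x. exp (2 * f x))"
      by (rule integrableI_nonneg) (use nn in \<open>auto intro: le_less_trans\<close>)
    have E2: "(\<integral>x. exp (2 * f x) \<partial>M) \<le> sqrt 2"
      using nn nn_integral_eq_integral[OF int2] by simp
    have amgm: "w x * exp (f x) \<le> (w x)\<^sup>2 / (2 * Z) + Z / 2 * exp (2 * f x)" for x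
    proof -
      have "0 \<le> (w x - Z * exp (f x))\<^sup>2 / (2 * Z)" using Z by simp
      also have "\<dots> = (w x)\<^sup>2 / (2 * Z) + Z / 2 * exp (2 * f x) - w x * exp (f x)"
        using Z unfolding exp_double
        by (simp add: power2_diff power_mult_distrib power2_eq_square field_simps)
      finally show ?thesis by simp
    qed
    have intb: "integrable M (\<lambda>x. (w x)\<^sup>2 / (2 * Z) + Z / 2 * exp (2 * f x))"
      using intw2 int2 by simp
    have intwf: "integrable M (\<lambda>x. w x * exp (f x))"
      by (rule Bochner_Integration.integrable_bound[OF intb])
        (use amgm wpos in \<open>auto intro!: AE_I2 order_trans[OF _ abs_ge_self] simp: abs_mult less_imp_le\<close>)
    have "(\<integral>x. w x * exp (f x) \<partial>M) \<le> (\<integral>x. (w x)\<^sup>2 / (2 * Z) + Z / 2 * exp (2 * f x) \<partial>M)"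
      using intwf intb amgm by (intro integral_mono) auto
    also have "\<dots> = (\<integral>x. (w x)\<^sup>2 \<partial>M) / (2 * Z) + Z / 2 * (\<integral>x. exp (2 * f x) \<partial>M)"
      using intw2 int2 by simp
    also have "\<dots> \<le> 2 * exp q * Z\<^sup>2 / (2 * Z) + Z / 2 * sqrt 2"
      using D E2 Z by (intro add_mono divide_right_mono mult_left_mono) auto
    also have "\<dots> \<le> exp q * Z + Z * exp q"
    proof -
      have "sqrt 2 \<le> (2 :: real)" by (rule real_le_lsqrt) simp_all
      moreover have "1 \<le> exp q" using q0 by simp
      ultimately have "sqrt 2 / 2 \<le> exp q" by linarith
      hence "Z * (sqrt 2 / 2) \<le> Z * exp q" using Z by (intro mult_left_mono) auto
      thus ?thesis using Z by (simp add: power2_eq_square)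
    qed
    finally have "(\<integral>x. w x * exp (f x) \<partial>M) / Z \<le> 2 * exp q" using Z by (simp add: field_simps)
    hence Ef: "T.expectation (\<lambda>x. exp (f x)) \<le> 2 * exp q"
      unfolding teq by (subst integral_reweight[OF intw wpos]) (simp_all add: Z_def)
    have intTf: "integrable (tilted n M t (\<lambda>_. 0)) (\<lambda>x. exp (f x))"
      unfolding teq by (subst integrable_reweight_iff[OF intw wpos]) (simp_all add: intwf)
    have intTf1: "integrable (tilted n M t (\<lambda>_. 0)) f"
      unfolding f_def[abs_def] using T.integrable_inner_sq[of u c] by simp
    have "T.expectation f \<le> ln (2 * exp q)"
      by (rule T.expectation_le_ln_exp[OF intTf1 intTf _ Ef]) simp
    also have "\<dots> = ln 2 + q" by (simp add: ln_mult)
    also have "\<dots> \<le> 1 + q" using ln_2_less_1 by simp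
    finally have "T.expectation (\<lambda>x. (inner_n n u x - c)\<^sup>2) \<le> 8 * (1 + q)"
      by (simp add: f_def[abs_def])
    moreover have "T.variance (inner_n n u) \<le> T.expectation (\<lambda>x. (inner_n n u x - c)\<^sup>2)"
      using T.integrable_inner_sq[of u 0]
      by (intro T.variance_le_second_moment T.integrable_inner) simp
    ultimately show ?thesis unfolding dir_var_def by linarith
  qed
  hence "dir_var n (tilted n M t (\<lambda>_. 0)) v \<le> 8 * (1 + q) * (norm_n n v)\<^sup>2"
    by (rule dir_var_le_of_unit)
  also have "\<dots> \<le> 8 * (1 + t * \<tau>\<^sup>2 + 2 * t\<^sup>2 * n * \<tau>\<^sup>2) * (norm_n n v)\<^sup>2"
  proof -
    have "t\<^sup>2 * \<tau>\<^sup>2 * m\<^sup>2 \<le> t\<^sup>2 * \<tau>\<^sup>2 * (2 * n)" using m2 by (intro mult_left_mono) auto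
    thus ?thesis unfolding q_def by (intro mult_right_mono) (simp_all add: algebra_simps)
  qed
  finally show ?thesis .
qed

end

text \<open>
  Completing the square around \<open>a = (h - k) / t\<close> exhibits the tilt by \<open>t\<close> and \<open>h\<close> as a translate of a
  purely Gaussian tilt of \<open>\<nu>\<close>, the linear tilt of \<open>\<mu>\<close> by \<open>k\<close> moved by \<open>a\<close>.  As \<open>\<nu>\<close> is again log-concave
  and tilt-stable, \<open>K_tilde n\<close> controls its norm.
\<close>

lemma dir_var_tilted_le_small_t:
  assumes lc: "log_concave n \<mu>" and ts: "tilt_stable n 1 \<mu>" and n: "1 \<le> n" and t: "0 < t"
    and K: "K_tilde n = ennreal K" "0 < K"
  shows "dir_var n (tilted n \<mu> t h) v \<le> 8 * (1 + 4 * t * K\<^sup>2 + 8 * t\<^sup>2 * n * K\<^sup>2) * (norm_n n v)\<^sup>2"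
proof -
  have t0: "0 \<le> t" using t by simp
  interpret exp_moments n \<mu> by (rule exp_moments_of_tilt_stable[OF lc ts])
  obtain k where k: "norm_n n (\<lambda>i. exp_moments.mean n (tilted n \<mu> 0 k) i - (h i - k i) / t) \<le> 1"
    using ex_almost_centred_tilt[OF ts t] by blast
  define a where "a = (\<lambda>i. (h i - k i) / t)"
  interpret T: exp_moments n "tilted n \<mu> 0 k" by (rule exp_moments_tilted) simp
  define \<nu> where "\<nu> = shift n a (tilted n \<mu> 0 k)"
  interpret N: exp_moments n \<nu> unfolding \<nu>_def by (rule T.exp_moments_shift)
  have lcN: "log_concave n \<nu>"
    unfolding \<nu>_def by (intro log_concave_shift log_concave_tilted lc exp_moments_axioms T.exp_moments_axioms)
  have tsN: "tilt_stable n 1 \<nu>"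
    unfolding \<nu>_def by (intro T.tilt_stable_shift tilt_stable_tilted ts)
  have meanN: "norm_n n N.mean \<le> 1"
    using k unfolding \<nu>_def T.mean_shift by (simp add: a_def)
  have tilt: "tilted n \<nu> t (\<lambda>_. 0) = shift n a (tilted n \<mu> t h)"
  proof -
    have "tilted n \<nu> t (\<lambda>_. 0) = shift n a (tilted n \<mu> t (\<lambda>i. k i + (0 + t * a i)))"
      unfolding \<nu>_def T.tilted_shift[OF t0] tilted_tilted[OF t0] ..
    also have "(\<lambda>i. k i + (0 + t * a i)) = h" using t by (simp add: a_def fun_eq_iff)
    finally show ?thesis .
  qed
  have "psi2_norm \<nu> (\<lambda>x. norm_n n x - (\<integral>y. norm_n n y \<partial>\<nu>)) \<le> K_tilde n"
    unfolding K_tilde_def using lcN tsN by (intro SUP_upper) simp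
  \<comment> \<open>The infimum defining the norm need not be attained, hence the factor 2.\<close>
  also have "\<dots> < ennreal (2 * K)" using K by (simp add: ennreal_lessI)
  finally obtain \<tau> where \<tau>: "0 < \<tau>" "ennreal \<tau> < ennreal (2 * K)"
    and psi: "(\<integral>\<^sup>+x. ennreal (exp ((norm_n n x - (\<integral>y. norm_n n y \<partial>\<nu>))\<^sup>2 / \<tau>\<^sup>2)) \<partial>\<nu>) \<le> 2"
    unfolding psi2_norm_def Inf_less_iff by blast
  have \<tau>K: "\<tau>\<^sup>2 \<le> 4 * K\<^sup>2"
    using \<tau> K power_mono[of \<tau> "2 * K" 2] by (simp add: ennreal_less_iff power_mult_distrib)
  have "dir_var n (tilted n \<mu> t h) v = dir_var n (tilted n \<nu> t (\<lambda>_. 0)) v"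
    unfolding tilt by (rule exp_moments.dir_var_shift[OF exp_moments_tilted[OF t0], symmetric])
  also have "\<dots> \<le> 8 * (1 + t * \<tau>\<^sup>2 + 2 * t\<^sup>2 * n * \<tau>\<^sup>2) * (norm_n n v)\<^sup>2"
    by (rule N.dir_var_gaussian_tilt_le[OF tsN n meanN t0 \<tau>(1) psi])
  also have "\<dots> \<le> 8 * (1 + t * (4 * K\<^sup>2) + 2 * t\<^sup>2 * n * (4 * K\<^sup>2)) * (norm_n n v)\<^sup>2"
  proof -
    have "t * \<tau>\<^sup>2 \<le> t * (4 * K\<^sup>2)" by (intro mult_left_mono \<tau>K t0)
    moreover have "2 * t\<^sup>2 * n * \<tau>\<^sup>2 \<le> 2 * t\<^sup>2 * n * (4 * K\<^sup>2)" by (intro mult_left_mono \<tau>K) simp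
    ultimately have "1 + t * \<tau>\<^sup>2 + 2 * t\<^sup>2 * n * \<tau>\<^sup>2 \<le> 1 + t * (4 * K\<^sup>2) + 2 * t\<^sup>2 * n * (4 * K\<^sup>2)"
      by linarith
    thus ?thesis by (intro mult_right_mono mult_left_mono) simp_all
  qed
  finally show ?thesis by (simp add: ac_simps)
qed

section \<open>Strong tilt stability\<close>

theorem lemma12:
  "\<exists>C::real. C > 0 \<and>
     (\<forall>n\<ge>1. \<forall>\<mu> :: (nat \<Rightarrow> real) measure.
        log_concave n \<mu> \<and> tilt_stable n 1 \<mu> \<longrightarrow>
        strongly_tilt_stable n (C * real n powr (1/6) * enn2real (K_tilde n) powr (1/3)) \<mu>)"
proof (intro exI[of _ 16] conjI allI impI)
  fix n :: nat and \<mu> :: "(nat \<Rightarrow> real) measure"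
  assume n: "1 \<le> n" and "log_concave n \<mu> \<and> tilt_stable n 1 \<mu>"
  hence lc: "log_concave n \<mu>" and ts: "tilt_stable n 1 \<mu>" by auto
  interpret exp_moments n \<mu> by (rule exp_moments_of_tilt_stable[OF lc ts])
  define K where "K = enn2real (K_tilde n)"
  have fin: "K_tilde n < \<top>" by (rule le_less_trans[OF K_tilde_le[OF n]]) simp
  hence K: "K_tilde n = ennreal K" by (simp add: K_def)
  have "1 / 50 \<le> K"
    using K_tilde_ge[OF n] unfolding K by (subst (asm) ennreal_le_iff) (simp_all add: K_def)
  hence Kpos: "0 < K" and K_lower: "1 / 2500 \<le> K\<^sup>2"
    using power_mono[of "1 / 50" K 2] by (simp_all add: power_divide)
  have "K \<le> sqrt (8 * n)" using K_tilde_le[OF n] unfolding K by (simp add: ennreal_le_iff)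
  hence K_upper: "K\<^sup>2 \<le> 8 * n"
    using Kpos power_mono[of K "sqrt (8 * n)" 2] by simp
  \<comment> \<open>The two variance bounds are both of order \<open>p\<close> at \<open>t = 1 / p\<close>; the first one serves larger \<open>t\<close>,
     the second one smaller \<open>t\<close>.\<close>
  define p where "p = real n powr (1/3) * K powr (2/3)"
  have p: "0 < p" unfolding p_def using n Kpos by simp
  have p3: "p ^ 3 = n * K\<^sup>2"
  proof -
    have "(real n powr (1/3)) ^ 3 = n" "(K powr (2/3)) ^ 3 = K\<^sup>2"
      using n Kpos by (simp_all add: powr_power)
    thus ?thesis by (simp add: p_def power_mult_distrib)
  qed
  have p_lower: "1 \<le> 14 * p"
  proof -
    have "1 / 2500 \<le> real n * K\<^sup>2"
      using mult_mono[of 1 "real n" "1 / 2500" "K\<^sup>2"] n K_lower by simp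
    hence "(1 :: real) ^ 3 \<le> (14 * p) ^ 3" by (simp add: power_mult_distrib p3)
    thus ?thesis using p by (subst (asm) power_mono_iff) auto
  qed
  have Kp: "K\<^sup>2 \<le> 2 * p\<^sup>2"
  proof -
    have "K\<^sup>2 \<le> 8 * (real n)\<^sup>2"
    proof -
      have "real n \<le> (real n)\<^sup>2" using n by (simp add: power2_eq_square)
      thus ?thesis using K_upper by linarith
    qed
    hence "(K\<^sup>2)\<^sup>2 * K\<^sup>2 \<le> (K\<^sup>2)\<^sup>2 * (8 * (real n)\<^sup>2)" by (intro mult_left_mono) auto
    hence "(K\<^sup>2) ^ 3 \<le> 8 * (p ^ 3)\<^sup>2" unfolding p3 by (simp add: power2_eq_square power3_eq_cube ac_simps)
    also have "8 * (p ^ 3)\<^sup>2 = (2 * p\<^sup>2) ^ 3" by (simp add: power_mult_distrib flip: power_mult)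
    finally show ?thesis by (subst (asm) power_mono_iff) auto
  qed
  define \<beta> where "\<beta> = 16 * real n powr (1/6) * K powr (1/3)"
  have \<beta>: "0 < \<beta>" unfolding \<beta>_def using n Kpos by simp
  have \<beta>2: "\<beta>\<^sup>2 = 256 * p"
    using n Kpos by (simp add: \<beta>_def p_def power_mult_distrib powr_power)
  have "strongly_tilt_stable n \<beta> \<mu>"
  proof (rule strongly_tilt_stableI[OF \<beta>])
    fix t :: real and h v assume t: "0 \<le> t"
    have "\<exists>B \<le> 256 * p. dir_var n (tilted n \<mu> t h) v \<le> B * (norm_n n v)\<^sup>2"
    proof -
      consider "t = 0" | "0 < t" "1 \<le> t * p" | "0 < t" "t * p < 1" using t by linarith
      thus ?thesis
      proof cases
        case 1
        thus ?thesis using ts p_lower p unfolding tilt_stable_iff by (intro exI[of _ 1]) auto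
      next
        case 2
        have "dir_var n (tilted n \<mu> t h) v \<le> 2 * (norm_n n v)\<^sup>2 / t"
          unfolding dir_var_def by (rule brascamp_lieb_linear[OF lc exp_moments_axioms 2(1)])
        moreover have "2 / t \<le> 256 * p" using 2 p by (simp add: divide_le_eq mult.commute)
        ultimately show ?thesis by (intro exI[of _ "2 / t"]) simp
      next
        case 3
        have "t * K\<^sup>2 \<le> t * (2 * p\<^sup>2)" using Kp t by (intro mult_left_mono)
        also have "\<dots> = (t * p) * (2 * p)" by (simp add: power2_eq_square)
        also have "\<dots> \<le> 1 * (2 * p)" using 3 p by (intro mult_right_mono) auto
        finally have a: "t * K\<^sup>2 \<le> 2 * p" by simp
        have "t\<^sup>2 * n * K\<^sup>2 = t\<^sup>2 * p ^ 3" unfolding p3 by (simp add: ac_simps)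
        also have "\<dots> = (t * p)\<^sup>2 * p" by (simp add: power2_eq_square power3_eq_cube)
        also have "\<dots> \<le> 1 * p" using 3 p t by (intro mult_right_mono power_le_one) auto
        finally have b: "t\<^sup>2 * n * K\<^sup>2 \<le> p" by simp
        \<comment> \<open>The three summands are at most \<open>14 * p\<close>, \<open>8 * p\<close> and \<open>8 * p\<close>; the constant 256 is the square of the
           witness 16.\<close>
        have "8 * (1 + 4 * t * K\<^sup>2 + 8 * t\<^sup>2 * n * K\<^sup>2) \<le> 256 * p"
          using a b p_lower by (simp add: mult.assoc)
        thus ?thesis using dir_var_tilted_le_small_t[OF lc ts n 3(1) K Kpos] by blast
      qed
    qed
    thus "dir_var n (tilted n \<mu> t h) v \<le> \<beta>\<^sup>2 * (norm_n n v)\<^sup>2"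
      unfolding \<beta>2 by (meson mult_right_mono order_trans zero_le_power2)
  qed
  thus "strongly_tilt_stable n (16 * real n powr (1/6) * enn2real (K_tilde n) powr (1/3)) \<mu>"
    by (simp only: \<beta>_def K_def)
qed simp

end
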